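(* Let $k$ be an algebraically closed field, $n\ge 2$, let $B\subseteq \mathrm{GL}_n(k)$ be the Borel subgroup of invertible upper triangular matrices, $\mathfrak b=\mathrm{Lie}\,B$ the upper triangular $n\times n$ matrices, $\mathfrak u\subseteq\mathfrak b$ the strictly upper triangular matrices and $\mathfrak u'=[\mathfrak u,\mathfrak u]$. Let $\mathfrak n$ be a Lie ideal of $\mathfrak b$ with $\mathfrak u'\subseteq\mathfrak n\subseteq\mathfrak u$, on which $B$ acts by conjugation, and let $\underline a=(a_0,a_1,\dots,a_r,a_{r+1})$ be the sequence attached to $\mathfrak n$ (see context). Put $e=\#\{i : 1\le i\le r,\ a_i \text{ even}\}$. Then: (1) $B$ acts on $\mathfrak n$ with a dense orbit if and only if $e\le 1$. (2) The minimal codimension in $\mathfrak n$ of a $B$-orbit (i.e. the codimension of a $B$-orbit of maximal dimension) equals $\max\{0,e-1\}$; in particular, if $B$ does not act on $\mathfrak n$ with a dense orbit, this codimension is $e-1$.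
   Context: Let $e_{i,j}$ denote the elementary matrix units. Let $\{i_0<i_1<\dots<i_r\}$ be the set of indices $i\in\{1,\dots,n-1\}$ with $e_{i,i+1}\in\mathfrak n$. Define $a_0=i_0$, $a_j=i_j-i_{j-1}$ for $1\le j\le r$, and $a_{r+1}=n-i_r$. (If no $e_{i,i+1}$ lies in $\mathfrak n$, the set of indices $1\le i\le r$ is empty and $e=0$.) *)

theory Defs
  imports "Jordan_Normal_Form.Matrix" "HOL-Computational_Algebra.Polynomial"
begin

definition alg_closed :: "'k::field itself \<Rightarrow> bool" where
  "alg_closed _ \<longleftrightarrow> (\<forall>p :: 'k poly. degree p \<ge> 1 \<longrightarrow> (\<exists>x. poly p x = 0))"

text \<open>Elementary matrix unit e_{i,j}, with 1-based indices as in the paper.\<close>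
definition elem_mat :: "nat \<Rightarrow> nat \<Rightarrow> nat \<Rightarrow> 'k::field mat" where
  "elem_mat n i j = mat n n (\<lambda>(a,b). if a = i - 1 \<and> b = j - 1 then 1 else 0)"

definition lie_bracket :: "'k::field mat \<Rightarrow> 'k mat \<Rightarrow> 'k mat" where
  "lie_bracket X Y = X * Y - Y * X"

definition borel :: "nat \<Rightarrow> 'k::field mat set" where
  "borel n = {g \<in> carrier_mat n n. upper_triangular g \<and> invertible_mat g}"

definition borel_lie :: "nat \<Rightarrow> 'k::field mat set" where
  "borel_lie n = {X \<in> carrier_mat n n. upper_triangular X}"

definition nilrad :: "nat \<Rightarrow> 'k::field mat set" where
  "nilrad n = {X \<in> carrier_mat n n. \<forall>i<n. \<forall>j<n. j \<le> i \<longrightarrow> X $$ (i,j) = 0}"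

text \<open>u' = [u,u]: the linear span of all brackets [X,Y] with X,Y in u
  (scalar multiples of brackets are brackets, so finite sums suffice).\<close>
inductive_set derived_nilrad :: "nat \<Rightarrow> 'k::field mat set" for n where
  zero: "0\<^sub>m n n \<in> derived_nilrad n"
| add: "X \<in> nilrad n \<Longrightarrow> Y \<in> nilrad n \<Longrightarrow> Z \<in> derived_nilrad n
          \<Longrightarrow> lie_bracket X Y + Z \<in> derived_nilrad n"

definition subspace_mat :: "nat \<Rightarrow> 'k::field mat set \<Rightarrow> bool" where
  "subspace_mat n N \<longleftrightarrow> N \<subseteq> carrier_mat n n \<and> 0\<^sub>m n n \<in> N \<and>
     (\<forall>X\<in>N. \<forall>Y\<in>N. X + Y \<in> N) \<and> (\<forall>c. \<forall>X\<in>N. c \<cdot>\<^sub>m X \<in> N)"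

definition lie_ideal_of_b :: "nat \<Rightarrow> 'k::field mat set \<Rightarrow> bool" where
  "lie_ideal_of_b n N \<longleftrightarrow> subspace_mat n N \<and> N \<subseteq> borel_lie n \<and>
     (\<forall>X\<in>borel_lie n. \<forall>Y\<in>N. lie_bracket X Y \<in> N)"

definition borel_orbit :: "nat \<Rightarrow> 'k::field mat \<Rightarrow> 'k mat set" where
  "borel_orbit n x = {y. \<exists>g\<in>borel n. \<exists>h \<in> carrier_mat n n.
       g * h = 1\<^sub>m n \<and> h * g = 1\<^sub>m n \<and> y = g * x * h}"

inductive_set poly_fun :: "nat \<Rightarrow> ('k::field mat \<Rightarrow> 'k) set" for n where
  const: "(\<lambda>A. c) \<in> poly_fun n"
| coord: "i < n \<Longrightarrow> j < n \<Longrightarrow> (\<lambda>A. A $$ (i,j)) \<in> poly_fun n"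
| add: "p \<in> poly_fun n \<Longrightarrow> q \<in> poly_fun n \<Longrightarrow> (\<lambda>A. p A + q A) \<in> poly_fun n"
| mult: "p \<in> poly_fun n \<Longrightarrow> q \<in> poly_fun n \<Longrightarrow> (\<lambda>A. p A * q A) \<in> poly_fun n"

definition zariski_closed :: "nat \<Rightarrow> 'k::field mat set \<Rightarrow> bool" where
  "zariski_closed n C \<longleftrightarrow> (\<exists>P \<subseteq> poly_fun n. C = {A \<in> carrier_mat n n. \<forall>p\<in>P. p A = 0})"

definition zariski_closure :: "nat \<Rightarrow> 'k::field mat set \<Rightarrow> 'k mat set" where
  "zariski_closure n S = \<Inter>{C. zariski_closed n C \<and> S \<subseteq> C}"

definition zariski_irreducible :: "nat \<Rightarrow> 'k::field mat set \<Rightarrow> bool" where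
  "zariski_irreducible n C \<longleftrightarrow> zariski_closed n C \<and> C \<noteq> {} \<and>
     (\<forall>C1 C2. zariski_closed n C1 \<and> zariski_closed n C2 \<and> C = C1 \<union> C2 \<longrightarrow> C = C1 \<or> C = C2)"

definition zariski_dim :: "nat \<Rightarrow> 'k::field mat set \<Rightarrow> nat" where
  "zariski_dim n S = (GREATEST m. \<exists>C :: nat \<Rightarrow> 'k mat set.
       (\<forall>i\<le>m. zariski_irreducible n (C i) \<and> C i \<subseteq> zariski_closure n S) \<and>
       (\<forall>i<m. C i \<subset> C (Suc i)))"

definition has_dense_orbit :: "nat \<Rightarrow> 'k::field mat set \<Rightarrow> bool" where
  "has_dense_orbit n N \<longleftrightarrow> (\<exists>x\<in>N. zariski_closure n (borel_orbit n x) = zariski_closure n N)"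

definition min_orbit_codim :: "nat \<Rightarrow> 'k::field mat set \<Rightarrow> nat" where
  "min_orbit_codim n N = (LEAST c. \<exists>x\<in>N. c = zariski_dim n N - zariski_dim n (borel_orbit n x))"

definition superdiag_indices :: "nat \<Rightarrow> 'k::field mat set \<Rightarrow> nat set" where
  "superdiag_indices n N = {i. 1 \<le> i \<and> i \<le> n - 1 \<and> elem_mat n i (i+1) \<in> N}"

definition seq_a :: "nat \<Rightarrow> 'k::field mat set \<Rightarrow> nat list" where
  "seq_a n N = (let s = sorted_list_of_set (superdiag_indices n N) in
     if s = [] then [n] else
     [hd s] @ map (\<lambda>j. s!j - s!(j-1)) [1..<length s] @ [n - last s])"

definition even_count :: "nat \<Rightarrow> 'k::field mat set \<Rightarrow> nat" where
  "even_count n N = (let a = seq_a n N; r = length a - 2 in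
     card {i. 1 \<le> i \<and> i \<le> r \<and> even (a!i)})"

end

theory Submission
  imports Defs "Jordan_Normal_Form.Determinant"
begin

text \<open>
  The ideal is the space of strictly upper triangular matrices whose entries \<open>(i, i + 1)\<close> vanish for
  \<open>i\<close> outside a set \<open>I\<close>. Descending from one of the last two indices by the smallest steps that a generic
  element allows (a step of one from \<open>i + 1\<close> to \<open>i\<close> if \<open>i \<in> I\<close>, of two otherwise) splits the indices into
  two classes \<open>P \<supseteq> I\<close> and its complement. A generic element has a triangular basis in which it acts on
  either class by descent, except for extra coefficients \<open>\<alpha> a\<close> sending the basis vector \<open>a + 1\<close> to a
  multiple of the vector \<open>a\<close>, one for each even gap between consecutive elements \<open>a < b\<close> of \<open>I\<close>. The
  coefficients are invariants of the orbit up to a common factor, which leaves \<open>e - 1\<close> parameters.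

  Fixing the ratio of two coefficients amounts to a rational expression for the entry \<open>(a, a + 2)\<close>, so a
  generic orbit is birational to a coordinate space of codimension \<open>e - 1\<close>. Krull dimension is bounded from
  above by the growth of the number of independent polynomial functions of bounded degree, which drops by one
  power at every proper inclusion of irreducible closed sets. For orbits this number is lower semicontinuous
  in the base point, so the bound for generic orbits holds for all of them.
\<close>

section \<open>Polynomial functions of bounded degree\<close>

text \<open>An odd gap gives no parameter: the colour of \<open>Suc a\<close> is then
  \<open>P\<close>, and the entry \<open>(a, Suc a)\<close> is itself a step of the descent. At an
  even gap this entry joins the two classes, and its normalisation would need a basis vector from
  above column \<open>Suc a\<close>, out of reach of a triangular base change. What remains is to
  scale one class against the other, because a matrix intertwining two normal forms has constant
  diagonal on each class. This is the common factor, and it is why a single even gap still permits a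
  dense orbit.

  The growth bound needs one constant for all degrees, whereas the generic point supplied by
  semicontinuity varies with the degree. The constant must therefore not depend on the orbit: the
  ratios of the coefficients enter the relations only as scalars and leave their degrees unchanged.
  The basis vectors are computed without fractions so that genericity is a single polynomial
  inequality. Irreducibility comes from rational curves, and lines suffice to build them: lines of
  triangular matrices for an orbit, lines in the free coordinates for the solutions of the
  relations.\<close>

inductive pdeg :: "(nat \<times> nat) set \<Rightarrow> nat \<Rightarrow> ('k::field mat \<Rightarrow> 'k) \<Rightarrow> bool" for T where
  const: "pdeg T m (\<lambda>A. c)"
| coord: "\<tau> \<in> T \<Longrightarrow> pdeg T (Suc 0) (\<lambda>A. A $$ \<tau>)"
| add: "pdeg T m p \<Longrightarrow> pdeg T m q \<Longrightarrow> pdeg T m (\<lambda>A. p A + q A)"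
| mult: "pdeg T m p \<Longrightarrow> pdeg T m' q \<Longrightarrow> pdeg T (m + m') (\<lambda>A. p A * q A)"
| mono: "pdeg T m p \<Longrightarrow> m \<le> m' \<Longrightarrow> pdeg T m' p"

abbreviation all_pos :: "nat \<Rightarrow> (nat \<times> nat) set" where
  "all_pos n \<equiv> {..<n} \<times> {..<n}"

lemma pdeg_imp_poly_fun: "pdeg T m p \<Longrightarrow> T \<subseteq> all_pos n \<Longrightarrow> p \<in> poly_fun n"
proof (induction rule: pdeg.induct)
  case (coord \<tau>)
  then show ?case using poly_fun.coord[of "fst \<tau>" n "snd \<tau>"] by auto
qed (auto intro: poly_fun.intros)

lemma poly_fun_imp_pdeg: "p \<in> poly_fun n \<Longrightarrow> \<exists>m. pdeg (all_pos n) m p"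
proof (induction rule: poly_fun.induct)
  case (const c)
  then show ?case using pdeg.const by blast
next
  case (coord i j)
  then show ?case by (intro exI[of _ "Suc 0"] pdeg.coord) auto
next
  case (add p q)
  then obtain m m' where "pdeg (all_pos n) m p" "pdeg (all_pos n) m' q" by blast
  then have "pdeg (all_pos n) (max m m') p" "pdeg (all_pos n) (max m m') q"
    by (auto intro: pdeg.mono)
  then show ?case using pdeg.add by blast
next
  case (mult p q)
  then show ?case using pdeg.mult by blast
qed

lemma pdeg_cmult: "pdeg T m p \<Longrightarrow> pdeg T m (\<lambda>A. c * p A)"
  using pdeg.mult[OF pdeg.const[of T 0 c]] by simp

lemma pdeg_diff: "pdeg T m p \<Longrightarrow> pdeg T m q \<Longrightarrow> pdeg T m (\<lambda>A. p A - q A)"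
  using pdeg.add[of T m p "\<lambda>A. -1 * q A"] pdeg_cmult[of T m q "-1"] by simp

lemma pdeg_sum: "(\<And>i. i \<in> S \<Longrightarrow> pdeg T m (p i)) \<Longrightarrow> pdeg T m (\<lambda>A. \<Sum>i\<in>S. p i A)"
proof (induction S rule: infinite_finite_induct)
  case (insert x F)
  then show ?case using pdeg.add[of T m "p x"] by simp
qed (auto intro: pdeg.const)

lemma pdeg_power: "pdeg T m p \<Longrightarrow> pdeg T (k * m) (\<lambda>A. p A ^ k)"
proof (induction k)
  case (Suc k)
  then show ?case using pdeg.mult[of T m p "k * m"] by simp
qed (auto intro: pdeg.const)

lemma pdeg_cong_on: "pdeg T m p \<Longrightarrow> (\<And>\<tau>. \<tau> \<in> T \<Longrightarrow> A $$ \<tau> = B $$ \<tau>) \<Longrightarrow> p A = p B"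
  by (induction rule: pdeg.induct) auto

text \<open>Precomposition with this map turns a polynomial function into one that formally involves
  only the positions in \<open>T\<close>.\<close>

definition restrict_mat :: "nat \<Rightarrow> (nat \<times> nat) set \<Rightarrow> 'k::field mat \<Rightarrow> 'k mat" where
  "restrict_mat n T A = mat n n (\<lambda>\<tau>. if \<tau> \<in> T then A $$ \<tau> else 0)"

lemma pdeg_restrict:
  "pdeg (all_pos n) m p \<Longrightarrow> pdeg T m (\<lambda>A. p (restrict_mat n T A))"
proof (induction rule: pdeg.induct)
  case (coord \<tau>)
  then obtain i j where "\<tau> = (i, j)" "i < n" "j < n" by auto
  then have "restrict_mat n T A $$ \<tau> = (if \<tau> \<in> T then A $$ \<tau> else 0)" for A :: "'a mat"
    by (auto simp: restrict_mat_def)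
  then show ?case
    by (cases "\<tau> \<in> T") (simp_all add: pdeg.coord pdeg.const)
qed (auto intro: pdeg.intros)

text \<open>Induction over the construction of \<open>p\<close>, regarded as a polynomial in the
  single coordinate \<open>\<tau>\<close>. The coefficients are bounded by \<open>m\<close> instead
  of \<open>m - i\<close>, which suffices for the count that follows; their vanishing beyond
  \<open>m\<close> is what the product formula asks for.\<close>

lemma pdeg_expand:
  assumes "pdeg (insert \<tau> T) m p"
  shows "\<exists>q. (\<forall>i. pdeg T m (q i)) \<and> (\<forall>i>m. q i = (\<lambda>A. 0)) \<and> (\<forall>A. p A = (\<Sum>i\<le>m. q i A * (A $$ \<tau>) ^ i))"
  using assms
proof (induction rule: pdeg.induct)
  case (const m c)
  let ?q = "\<lambda>i::nat. if i = 0 then (\<lambda>A. c) else (\<lambda>A::'a mat. 0)"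
  have "(\<Sum>i\<le>m. ?q i A * (A $$ \<tau>) ^ i) = c" for A
  proof -
    have "(\<Sum>i\<le>m. ?q i A * (A $$ \<tau>) ^ i) = (\<Sum>i\<le>m. if i = 0 then c else 0)"
      by (intro sum.cong) auto
    then show ?thesis by simp
  qed
  then show ?case by (intro exI[of _ ?q]) (auto intro: pdeg.const)
next
  case (coord \<sigma>)
  show ?case
  proof (cases "\<sigma> = \<tau>")
    case True
    let ?q = "\<lambda>i::nat. if i = 1 then (\<lambda>A. 1) else (\<lambda>A::'a mat. 0)"
    show ?thesis by (intro exI[of _ ?q]) (auto intro: pdeg.const simp: True)
  next
    case False
    let ?q = "\<lambda>i::nat. if i = 0 then (\<lambda>A. A $$ \<sigma>) else (\<lambda>A::'a mat. 0)"
    show ?thesis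
      using coord False by (intro exI[of _ ?q]) (auto intro: pdeg.const pdeg.coord)
  qed
next
  case (add m p q)
  from add.IH(1) obtain a where
    "\<forall>i. pdeg T m (a i)" "\<forall>i>m. a i = (\<lambda>A. 0)" "\<forall>A. p A = (\<Sum>i\<le>m. a i A * (A $$ \<tau>) ^ i)"
    by blast
  moreover from add.IH(2) obtain b where
    "\<forall>i. pdeg T m (b i)" "\<forall>i>m. b i = (\<lambda>A. 0)" "\<forall>A. q A = (\<Sum>i\<le>m. b i A * (A $$ \<tau>) ^ i)"
    by blast
  ultimately show ?case
    by (intro exI[of _ "\<lambda>i A. a i A + b i A"]) (auto intro: pdeg.add simp: sum.distrib algebra_simps)
next
  case (mult m p m' q)
  from mult.IH(1) obtain a where
    a: "\<forall>i. pdeg T m (a i)" "\<forall>i>m. a i = (\<lambda>A. 0)" "\<forall>A. p A = (\<Sum>i\<le>m. a i A * (A $$ \<tau>) ^ i)"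
    by blast
  from mult.IH(2) obtain b where
    b: "\<forall>i. pdeg T m' (b i)" "\<forall>i>m'. b i = (\<lambda>A. 0)" "\<forall>A. q A = (\<Sum>i\<le>m'. b i A * (A $$ \<tau>) ^ i)"
    by blast
  let ?c = "\<lambda>r A. \<Sum>k\<le>r. a k A * b (r - k) A"
  have "\<forall>r. pdeg T (m + m') (?c r)"
    using a b by (intro allI pdeg_sum pdeg.mult) auto
  moreover have "\<forall>r>m + m'. ?c r = (\<lambda>A. 0)"
  proof (intro allI impI ext sum.neutral ballI)
    fix r A k assume "m + m' < r" "k \<in> {..r}"
    then have "k > m \<or> r - k > m'" by auto
    then show "a k A * b (r - k) A = 0" using a b by auto
  qed
  moreover have "p A * q A = (\<Sum>r\<le>m + m'. ?c r A * (A $$ \<tau>) ^ r)" for A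
    using polynomial_product[of m "\<lambda>i. a i A" m' "\<lambda>i. b i A" "A $$ \<tau>"] a b by auto
  ultimately show ?case by (intro exI[of _ ?c]) auto
next
  case (mono m p m')
  then obtain a where
    a: "\<forall>i. pdeg T m (a i)" "\<forall>i>m. a i = (\<lambda>A. 0)" "\<forall>A. p A = (\<Sum>i\<le>m. a i A * (A $$ \<tau>) ^ i)"
    by blast
  have "p A = (\<Sum>i\<le>m'. a i A * (A $$ \<tau>) ^ i)" for A
    unfolding a(3)[rule_format] using a(2) mono.hyps
    by (intro sum.mono_neutral_left) (auto simp: not_le)
  then show ?case using a mono.hyps by (intro exI[of _ a]) (auto intro: pdeg.mono)
qed

text \<open>The family stands for the monomials with all exponents at most \<open>m\<close>: each
  further coordinate multiplies their number by \<open>m + 1\<close>.\<close>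

lemma pdeg_spanning_family:
  assumes "finite T"
  shows "\<exists>F. finite F \<and> card F \<le> (m + 1) ^ card T \<and>
     (\<forall>p::'k::field mat \<Rightarrow> 'k. pdeg T m p \<longrightarrow> (\<exists>c. \<forall>A. p A = (\<Sum>f\<in>F. c f * f A)))"
  using assms
proof (induction T)
  case empty
  have "\<exists>c. \<forall>A. p A = c" if "pdeg {} m p" for p :: "'k mat \<Rightarrow> 'k"
    using pdeg_cong_on[OF that] by blast
  then show ?case
    by (intro exI[of _ "{\<lambda>A. 1}"]) fastforce
next
  case (insert \<tau> T)
  then obtain F :: "('k mat \<Rightarrow> 'k) set" where F: "finite F" "card F \<le> (m + 1) ^ card T"
    "\<And>p. pdeg T m p \<Longrightarrow> \<exists>c. \<forall>A. p A = (\<Sum>f\<in>F. c f * f A)"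
    by blast
  let ?h = "\<lambda>(i::nat, f) A. f A * (A $$ \<tau>) ^ i :: 'k"
  let ?F = "?h ` ({..m} \<times> F)"
  have "card ?F \<le> card ({..m} \<times> F)" using F(1) by (intro card_image_le) auto
  also have "\<dots> = (m + 1) * card F" by (simp add: card_cartesian_product)
  also have "\<dots> \<le> (m + 1) * (m + 1) ^ card T" using F(2) by (rule mult_le_mono2)
  finally have "card ?F \<le> (m + 1) * (m + 1) ^ card T" .
  moreover have "\<exists>c. \<forall>A. p A = (\<Sum>f\<in>?F. c f * f A)" if p: "pdeg (insert \<tau> T) m p" for p
  proof -
    obtain q where q: "\<And>i. pdeg T m (q i)" "\<And>A. p A = (\<Sum>i\<le>m. q i A * (A $$ \<tau>) ^ i)"
      using pdeg_expand[OF p] by blast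
    then have "\<forall>i. \<exists>c. \<forall>A. q i A = (\<Sum>f\<in>F. c f * f A)" using F(3) by blast
    then obtain c where c: "\<And>i A. q i A = (\<Sum>f\<in>F. c i f * f A)" by (metis choice_iff)
    \<comment> \<open>Different pairs \<open>(i, f)\<close> may yield the same function, so
      coefficients are collected over the fibres of \<open>?h\<close>.\<close>
    let ?d = "\<lambda>g. \<Sum>x\<in>{x \<in> {..m} \<times> F. ?h x = g}. c (fst x) (snd x)"
    have "p A = (\<Sum>g\<in>?F. ?d g * g A)" for A
    proof -
      have "p A = (\<Sum>x\<in>{..m} \<times> F. c (fst x) (snd x) * ?h x A)"
        unfolding q(2) c by (simp add: sum_distrib_right sum.cartesian_product case_prod_beta mult.assoc)
      also have "\<dots> = (\<Sum>g\<in>?F. \<Sum>x\<in>{x \<in> {..m} \<times> F. ?h x = g}. c (fst x) (snd x) * ?h x A)"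
        using F(1) by (intro sum.group[symmetric]) auto
      also have "\<dots> = (\<Sum>g\<in>?F. ?d g * g A)"
        unfolding sum_distrib_right by (intro sum.cong refl) auto
      finally show ?thesis .
    qed
    then show ?thesis by (intro exI[of _ ?d] allI)
  qed
  ultimately show ?case
    using insert(1,2) F(1) by (intro exI[of _ ?F]) auto
qed

section \<open>Linearly independent families of functions\<close>

definition lin_indep_on :: "'a set \<Rightarrow> nat \<Rightarrow> (nat \<Rightarrow> 'a \<Rightarrow> 'k::field) \<Rightarrow> bool" where
  "lin_indep_on S R p \<longleftrightarrow> (\<forall>v. (\<forall>s\<in>S. (\<Sum>i<R. v i * p i s) = 0) \<longrightarrow> (\<forall>i<R. v i = 0))"

text \<open>For \<open>Ps = pdeg T m\<close> the largest such \<open>R\<close> is the dimension of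
  the space of restrictions to \<open>S\<close>, an affine Hilbert function. Speaking of families
  avoids quotient spaces.\<close>

definition has_indep :: "'a set \<Rightarrow> (('a \<Rightarrow> 'k::field) \<Rightarrow> bool) \<Rightarrow> nat \<Rightarrow> bool" where
  "has_indep S Ps R \<longleftrightarrow> (\<exists>p. (\<forall>i<R. Ps (p i)) \<and> lin_indep_on S R p)"

lemma det_zero_row:
  fixes A :: "'k::field mat"
  assumes "A \<in> carrier_mat R R" "k < R" "\<And>j. j < R \<Longrightarrow> A $$ (k, j) = 0"
  shows "det A = 0"
  using laplace_expansion_row[OF assms(1,2)] assms(3) by simp

text \<open>Zero rows pad the \<open>card F\<close> equations to a square system, whose determinant
  then vanishes.\<close>

lemma exists_linear_relation:
  fixes c :: "nat \<Rightarrow> 'b \<Rightarrow> 'k::field"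
  assumes "finite F" "card F < R"
  shows "\<exists>v. (\<exists>i<R. v i \<noteq> 0) \<and> (\<forall>f\<in>F. (\<Sum>i<R. v i * c i f) = 0)"
proof -
  obtain h where h: "bij_betw h {0..<card F} F"
    using ex_bij_betw_nat_finite[OF assms(1)] by blast
  define A where "A = mat R R (\<lambda>(k, i). if k < card F then c i (h k) else 0)"
  have A: "A \<in> carrier_mat R R" unfolding A_def by simp
  have "det A = 0"
    by (rule det_zero_row[OF A assms(2)]) (use assms(2) in \<open>auto simp: A_def\<close>)
  then obtain w where w: "w \<in> carrier_vec R" "w \<noteq> 0\<^sub>v R" "A *\<^sub>v w = 0\<^sub>v R"
    using det_0_iff_vec_prod_zero_field[OF A] by blast
  have "\<exists>i<R. w $ i \<noteq> 0"
    using w(1,2) by (metis carrier_vecD eq_vecI index_zero_vec(1) zero_carrier_vec)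
  moreover have "(\<Sum>i<R. w $ i * c i f) = 0" if f: "f \<in> F" for f
  proof -
    obtain k where k: "k < card F" "h k = f"
      using h f unfolding bij_betw_def by (metis atLeastLessThan_iff imageE)
    have "0 = (A *\<^sub>v w) $ k" using w(3) k(1) assms(2) by simp
    also have "\<dots> = (\<Sum>i<R. c i f * w $ i)"
      using k assms(2) w(1) by (auto simp: A_def scalar_prod_def lessThan_atLeast0)
    finally show ?thesis by (simp add: mult.commute)
  qed
  ultimately show ?thesis by (intro exI[of _ "\<lambda>i. w $ i"]) auto
qed

lemma has_indep_pdeg_le:
  assumes "finite T" "has_indep S (pdeg T m) R"
  shows "R \<le> (m + 1) ^ card T"
proof (rule ccontr)
  assume less: "\<not> R \<le> (m + 1) ^ card T"
  obtain F where F: "finite F" "card F \<le> (m + 1) ^ card T"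
     "\<And>p::'a mat \<Rightarrow> 'a. pdeg T m p \<Longrightarrow> \<exists>c. \<forall>A. p A = (\<Sum>f\<in>F. c f * f A)"
    using pdeg_spanning_family[OF assms(1), of m] by metis
  obtain p where p: "\<And>i. i < R \<Longrightarrow> pdeg T m (p i)" "lin_indep_on S R p"
    using assms(2) unfolding has_indep_def by blast
  have "\<forall>i. \<exists>c. i < R \<longrightarrow> (\<forall>A. p i A = (\<Sum>f\<in>F. c f * f A))" using p(1) F(3) by metis
  then obtain c where c: "\<And>i A. i < R \<Longrightarrow> p i A = (\<Sum>f\<in>F. c i f * f A)" by metis
  obtain v where v: "\<exists>i<R. v i \<noteq> 0" "\<And>f. f \<in> F \<Longrightarrow> (\<Sum>i<R. v i * c i f) = 0"
    using exists_linear_relation[OF F(1), of R c] F(2) less by force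
  have "(\<Sum>i<R. v i * p i s) = 0" for s
  proof -
    have "(\<Sum>i<R. v i * p i s) = (\<Sum>i<R. \<Sum>f\<in>F. v i * c i f * f s)"
      using c by (intro sum.cong refl) (simp add: sum_distrib_left mult.assoc)
    also have "\<dots> = (\<Sum>f\<in>F. (\<Sum>i<R. v i * c i f) * f s)"
      by (subst sum.swap) (simp add: sum_distrib_right)
    finally show ?thesis using v(2) by simp
  qed
  then show False using p(2) v(1) unfolding lin_indep_on_def by blast
qed

text \<open>A linear relation on \<open>S'\<close> is itself a function of degree at most
  \<open>m\<close>, so it propagates to \<open>S\<close>. This covers enlarging a set, descending
  from a closure to the set, and passing to a nonempty open part of an irreducible set.\<close>

lemma has_indep_transfer:
  assumes "has_indep S (pdeg T m) R" "\<And>q. pdeg T m q \<Longrightarrow> \<forall>s\<in>S'. q s = 0 \<Longrightarrow> \<forall>s\<in>S. q s = 0"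
  shows "has_indep S' (pdeg T m) R"
proof -
  obtain p where p: "\<And>i. i < R \<Longrightarrow> pdeg T m (p i)" "lin_indep_on S R p"
    using assms(1) unfolding has_indep_def by blast
  have "lin_indep_on S' R p"
    unfolding lin_indep_on_def
  proof (rule allI, rule impI)
    fix v assume v: "\<forall>s\<in>S'. (\<Sum>i<R. v i * p i s) = 0"
    have "pdeg T m (\<lambda>A. \<Sum>i<R. v i * p i A)" using p(1) by (intro pdeg_sum pdeg_cmult) auto
    from assms(2)[OF this v] show "\<forall>i<R. v i = 0" using p(2) unfolding lin_indep_on_def by blast
  qed
  then show ?thesis unfolding has_indep_def using p(1) by blast
qed

lemma has_indep_mono: "has_indep S (pdeg T m) R \<Longrightarrow> S \<subseteq> S' \<Longrightarrow> has_indep S' (pdeg T m) R"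
  by (erule has_indep_transfer) blast

text \<open>Clearing the denominator \<open>G\<close> of \<open>A $$ \<beta> = H A / G A\<close> eliminates the coordinate \<open>\<beta>\<close>.\<close>

lemma pdeg_eliminate:
  assumes "pdeg (insert \<beta> T) m p" "pdeg T \<delta> G" "pdeg T \<delta> H"
    and "\<And>A. A \<in> Z \<Longrightarrow> A $$ \<beta> * G A = H A"
  shows "\<exists>q. pdeg T (m * (1 + \<delta>)) q \<and> (\<forall>A\<in>Z. p A * G A ^ m = q A)"
  using assms(1)
proof (induction rule: pdeg.induct)
  case (const m c)
  have "pdeg T (m * (1 + \<delta>)) (\<lambda>A. c * G A ^ m)"
    by (rule pdeg.mono[OF pdeg_cmult[OF pdeg_power[OF assms(2)]]]) auto
  then show ?case by blast
next
  case (coord \<sigma>)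
  show ?case
  proof (cases "\<sigma> = \<beta>")
    case True
    then show ?thesis using assms(3,4) pdeg.mono[OF assms(3), of "1 + \<delta>"]
      by (intro exI[of _ H]) auto
  next
    case False
    then have "pdeg T (1 + \<delta>) (\<lambda>A. A $$ \<sigma> * G A)"
      using pdeg.mult[OF pdeg.coord[of \<sigma> T] assms(2)] coord by auto
    then show ?thesis by (intro exI[of _ "\<lambda>A. A $$ \<sigma> * G A"]) auto
  qed
next
  case (add m p q)
  then obtain p' q' where "pdeg T (m * (1 + \<delta>)) p'" "\<forall>A\<in>Z. p A * G A ^ m = p' A"
     "pdeg T (m * (1 + \<delta>)) q'" "\<forall>A\<in>Z. q A * G A ^ m = q' A" by blast
  then show ?case
    by (intro exI[of _ "\<lambda>A. p' A + q' A"]) (auto intro!: pdeg.add simp: distrib_right)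
next
  case (mult m p m' q)
  then obtain p' q' where *: "pdeg T (m * (1 + \<delta>)) p'" "\<forall>A\<in>Z. p A * G A ^ m = p' A"
     "pdeg T (m' * (1 + \<delta>)) q'" "\<forall>A\<in>Z. q A * G A ^ m' = q' A" by blast
  have "pdeg T ((m + m') * (1 + \<delta>)) (\<lambda>A. p' A * q' A)"
    using pdeg.mult[OF *(1,3)] by (simp only: distrib_right)
  moreover have "p A * q A * G A ^ (m + m') = p' A * q' A" if "A \<in> Z" for A
  proof -
    have "p A * q A * G A ^ (m + m') = (p A * G A ^ m) * (q A * G A ^ m')"
      by (simp add: power_add algebra_simps)
    then show ?thesis using *(2,4) that by simp
  qed
  ultimately show ?case by blast
next
  case (mono m p m')
  then obtain p' where *: "pdeg T (m * (1 + \<delta>)) p'" "\<forall>A\<in>Z. p A * G A ^ m = p' A" by blast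
  have "pdeg T (m * (1 + \<delta>) + (m' - m) * \<delta>) (\<lambda>A. p' A * G A ^ (m' - m))"
    by (intro pdeg.mult * pdeg_power assms(2))
  moreover have "m * (1 + \<delta>) + (m' - m) * \<delta> \<le> m' * (1 + \<delta>)"
  proof -
    have "m * (1 + \<delta>) + (m' - m) * \<delta> \<le> m * (1 + \<delta>) + (m' - m) * (1 + \<delta>)" by simp
    also have "\<dots> = m' * (1 + \<delta>)" using mono(2) by (metis distrib_right le_add_diff_inverse)
    finally show ?thesis .
  qed
  ultimately have "pdeg T (m' * (1 + \<delta>)) (\<lambda>A. p' A * G A ^ (m' - m))" by (rule pdeg.mono)
  moreover have "p A * G A ^ m' = p' A * G A ^ (m' - m)" if "A \<in> Z" for A
    using * that mono(2) by (metis le_add_diff_inverse mult.assoc power_add)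
  ultimately show ?case by blast
qed

text \<open>Multiplying all functions by the same \<open>G A ^ m\<close>, which vanishes nowhere on
  \<open>Z\<close>, keeps them independent. One coordinate disappears at the price of a factor
  \<open>1 + \<delta>\<close> in the degree.\<close>

lemma has_indep_eliminate:
  assumes "has_indep Z (pdeg (insert \<beta> T) m) R" "pdeg T \<delta> G" "pdeg T \<delta> H"
    and "\<And>A. A \<in> Z \<Longrightarrow> A $$ \<beta> * G A = H A" "\<And>A. A \<in> Z \<Longrightarrow> G A \<noteq> 0"
  shows "has_indep Z (pdeg T (m * (1 + \<delta>))) R"
proof -
  obtain p where p: "\<And>i. i < R \<Longrightarrow> pdeg (insert \<beta> T) m (p i)" "lin_indep_on Z R p"
    using assms(1) unfolding has_indep_def by blast
  have "\<forall>i. \<exists>q. i < R \<longrightarrow> pdeg T (m * (1 + \<delta>)) q \<and> (\<forall>A\<in>Z. p i A * G A ^ m = q A)"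
    using pdeg_eliminate[OF p(1) assms(2,3,4)] by blast
  then obtain q where q: "\<And>i. i < R \<Longrightarrow> pdeg T (m * (1 + \<delta>)) (q i)"
    "\<And>i A. i < R \<Longrightarrow> A \<in> Z \<Longrightarrow> q i A = p i A * G A ^ m" by metis
  have "\<forall>i<R. v i = 0" if v: "\<And>s. s \<in> Z \<Longrightarrow> (\<Sum>i<R. v i * q i s) = 0" for v
  proof -
    have "(\<Sum>i<R. v i * p i s) = 0" if s: "s \<in> Z" for s
    proof -
      have "(\<Sum>i<R. v i * q i s) = (\<Sum>i<R. v i * p i s) * G s ^ m"
        using q(2) s by (simp add: sum_distrib_right mult.assoc)
      then show ?thesis using v[OF s] assms(5)[OF s] by simp
    qed
    then show ?thesis using p(2) unfolding lin_indep_on_def by blast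
  qed
  then show ?thesis unfolding has_indep_def lin_indep_on_def using q(1) by blast
qed

text \<open>The points are found one at a time: expansion along the last column writes the
  determinant as a combination of the \<open>p i\<close> at the new point, and the last coefficient
  is the previous nonzero determinant.\<close>

lemma indep_det_points:
  assumes "lin_indep_on S R p"
  shows "\<exists>s. (\<forall>j<R. s j \<in> S) \<and> det (mat R R (\<lambda>(i, j). p i (s j))) \<noteq> 0"
  using assms
proof (induction R)
  case 0
  then show ?case by simp
next
  case (Suc R)
  have "lin_indep_on S R p"
    unfolding lin_indep_on_def
  proof (intro allI impI)
    fix v i assume v: "\<forall>s\<in>S. (\<Sum>i<R. v i * p i s) = 0" and "i < R"
    have "\<forall>s\<in>S. (\<Sum>i<Suc R. (if i < R then v i else 0) * p i s) = 0" using v by simp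
    then have "\<forall>i<Suc R. (if i < R then v i else 0) = 0"
      using Suc.prems[unfolded lin_indep_on_def, rule_format, of "\<lambda>i. if i < R then v i else 0"] by blast
    then show "v i = 0" using \<open>i < R\<close> by (metis less_Suc_eq)
  qed
  then obtain s where s: "\<And>j. j < R \<Longrightarrow> s j \<in> S" "det (mat R R (\<lambda>(i, j). p i (s j))) \<noteq> 0"
    using Suc.IH by blast
  define M where "M = (\<lambda>z. mat (Suc R) (Suc R) (\<lambda>(i, j). p i (if j < R then s j else z)))"
  have M: "M z \<in> carrier_mat (Suc R) (Suc R)" for z unfolding M_def by simp
  \<comment> \<open>The choice is arbitrary, since the cofactors delete the only column that
    contains the new point.\<close>
  define z0 where "z0 = (undefined :: 'a)"
  define v where "v = (\<lambda>i. cofactor (M z0) i R)"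
  have del: "mat_delete (M z) i R = mat_delete (M z0) i R" if "i < Suc R" for z i
    by (rule eq_matI) (use that in \<open>auto simp: mat_delete_def M_def\<close>)
  have det: "det (M z) = (\<Sum>i<Suc R. v i * p i z)" for z
    unfolding laplace_expansion_column[OF M lessI]
    by (intro sum.cong refl) (simp add: v_def cofactor_def del[of _ z], simp add: M_def mult.commute)
  have "mat_delete (M z0) R R = mat R R (\<lambda>(i, j). p i (s j))"
    by (rule eq_matI) (auto simp: mat_delete_def M_def)
  then have "v R \<noteq> 0" unfolding v_def cofactor_def using s(2) by simp
  then obtain z where z: "z \<in> S" "(\<Sum>i<Suc R. v i * p i z) \<noteq> 0"
    using Suc.prems[unfolded lin_indep_on_def, rule_format, of v R] by blast
  have "M z = mat (Suc R) (Suc R) (\<lambda>(i, j). p i ((s(R := z)) j))"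
    unfolding M_def by (rule eq_matI) auto
  then show ?case using z s(1) det[of z]
    by (intro exI[of _ "s(R := z)"]) (auto simp: less_Suc_eq)
qed

lemma det_points_indep:
  fixes p :: "nat \<Rightarrow> 'a \<Rightarrow> 'k::field"
  assumes "\<And>j. j < R \<Longrightarrow> s j \<in> S" "det (mat R R (\<lambda>(i, j). p i (s j))) \<noteq> 0"
  shows "lin_indep_on S R p"
  unfolding lin_indep_on_def
proof (rule allI, rule impI, rule ccontr)
  fix v assume v: "\<forall>z\<in>S. (\<Sum>i<R. v i * p i z) = 0" and ne: "\<not> (\<forall>i<R. v i = 0)"
  define A where "A = mat R R (\<lambda>(j, i). p i (s j))"
  have A: "A \<in> carrier_mat R R" unfolding A_def by simp
  have "A = transpose_mat (mat R R (\<lambda>(i, j). p i (s j)))" unfolding A_def by (rule eq_matI) auto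
  then have "det A \<noteq> 0" using assms(2) by (simp add: det_transpose[of _ R])
  moreover have "vec R v \<noteq> 0\<^sub>v R" using ne by (metis index_vec index_zero_vec(1))
  moreover have "A *\<^sub>v vec R v = 0\<^sub>v R"
  proof (rule eq_vecI)
    fix j assume "j < dim_vec (0\<^sub>v R :: 'k vec)"
    then have j: "j < R" by simp
    then have "(A *\<^sub>v vec R v) $ j = (\<Sum>i<R. v i * p i (s j))"
      by (auto simp: A_def scalar_prod_def lessThan_atLeast0 mult.commute intro!: sum.cong)
    then show "(A *\<^sub>v vec R v) $ j = 0\<^sub>v R $ j" using v assms(1)[OF j] j by simp
  qed (simp add: A_def)
  ultimately show False using det_0_iff_vec_prod_zero_field[OF A] vec_carrier by blast
qed

section \<open>Irreducible sets and chains\<close>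

lemma mem_zariski_closure_iff:
  assumes "S \<subseteq> carrier_mat n n"
  shows "A \<in> zariski_closure n S \<longleftrightarrow>
    A \<in> carrier_mat n n \<and> (\<forall>p\<in>poly_fun n. (\<forall>s\<in>S. p s = 0) \<longrightarrow> p A = 0)" (is "_ \<longleftrightarrow> ?R A")
proof
  assume A: "A \<in> zariski_closure n S"
  let ?P = "{p \<in> poly_fun n. \<forall>s\<in>S. p s = 0}"
  have "zariski_closed n {A \<in> carrier_mat n n. \<forall>p\<in>?P. p A = 0}"
    unfolding zariski_closed_def by blast
  moreover have "S \<subseteq> {A \<in> carrier_mat n n. \<forall>p\<in>?P. p A = 0}" using assms by auto
  ultimately show "?R A" using A unfolding zariski_closure_def by blast
next
  assume A: "?R A"
  show "A \<in> zariski_closure n S"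
    unfolding zariski_closure_def
  proof (rule InterI)
    fix C assume "C \<in> {C. zariski_closed n C \<and> S \<subseteq> C}"
    then obtain P where P: "P \<subseteq> poly_fun n" "C = {A \<in> carrier_mat n n. \<forall>p\<in>P. p A = 0}" "S \<subseteq> C"
      unfolding zariski_closed_def by blast
    show "A \<in> C" using A P by blast
  qed
qed

lemma zariski_closure_vanish:
  assumes "S \<subseteq> carrier_mat n n" "p \<in> poly_fun n" "\<forall>s\<in>S. p s = 0"
  shows "\<forall>A\<in>zariski_closure n S. p A = 0"
  using assms mem_zariski_closure_iff[OF assms(1)] by blast

lemma zariski_closed_closure:
  "S \<subseteq> carrier_mat n n \<Longrightarrow> zariski_closed n (zariski_closure n S)"
  unfolding zariski_closed_def
  by (rule exI[of _ "{p \<in> poly_fun n. \<forall>s\<in>S. p s = 0}"]) (auto simp: mem_zariski_closure_iff)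

lemma zariski_closure_subset: "S \<subseteq> zariski_closure n S"
  unfolding zariski_closure_def by blast

lemma zariski_closure_minimal: "zariski_closed n C \<Longrightarrow> S \<subseteq> C \<Longrightarrow> zariski_closure n S \<subseteq> C"
  unfolding zariski_closure_def by blast

lemma zariski_closure_mono: "S \<subseteq> S' \<Longrightarrow> zariski_closure n S \<subseteq> zariski_closure n S'"
  unfolding zariski_closure_def by blast

lemma zariski_closed_subset_carrier: "zariski_closed n C \<Longrightarrow> C \<subseteq> carrier_mat n n"
  unfolding zariski_closed_def by blast

text \<open>The functions vanishing on \<open>S\<close> form a prime ideal. In this form
  irreducibility applies to sets that are not closed, such as orbits and their open parts.\<close>

definition irr :: "nat \<Rightarrow> 'k::field mat set \<Rightarrow> bool" where
  "irr n S \<longleftrightarrow> S \<noteq> {} \<and> S \<subseteq> carrier_mat n n \<and>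
     (\<forall>p\<in>poly_fun n. \<forall>q\<in>poly_fun n. (\<forall>s\<in>S. p s * q s = 0) \<longrightarrow> (\<forall>s\<in>S. p s = 0) \<or> (\<forall>s\<in>S. q s = 0))"

lemma irr_imp_zariski_irreducible:
  assumes "irr n S"
  shows "zariski_irreducible n (zariski_closure n S)"
  unfolding zariski_irreducible_def
proof (intro conjI allI impI)
  have S: "S \<noteq> {}" "S \<subseteq> carrier_mat n n" using assms unfolding irr_def by auto
  show "zariski_closed n (zariski_closure n S)" by (rule zariski_closed_closure[OF S(2)])
  show "zariski_closure n S \<noteq> {}" using S(1) zariski_closure_subset by blast
  fix C1 C2
  assume C: "zariski_closed n C1 \<and> zariski_closed n C2 \<and> zariski_closure n S = C1 \<union> C2"
  show "zariski_closure n S = C1 \<or> zariski_closure n S = C2"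
  proof (rule ccontr)
    assume "\<not> ?thesis"
    then have "\<not> S \<subseteq> C1" "\<not> S \<subseteq> C2" using C zariski_closure_minimal by blast+
    moreover obtain P1 where P1: "P1 \<subseteq> poly_fun n" "C1 = {A \<in> carrier_mat n n. \<forall>p\<in>P1. p A = 0}"
      using C unfolding zariski_closed_def by blast
    moreover obtain P2 where P2: "P2 \<subseteq> poly_fun n" "C2 = {A \<in> carrier_mat n n. \<forall>p\<in>P2. p A = 0}"
      using C unfolding zariski_closed_def by blast
    ultimately obtain s1 s2 p1 p2 where *: "s1 \<in> S" "p1 \<in> P1" "p1 s1 \<noteq> 0" "s2 \<in> S" "p2 \<in> P2" "p2 s2 \<noteq> 0"
      using S(2) by blast
    have "p1 s * p2 s = 0" if "s \<in> S" for s
      using that C zariski_closure_subset[of S n] P1 P2 * by auto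
    then show False using assms * P1(1) P2(1) unfolding irr_def by (meson subsetD)
  qed
qed

lemma zariski_irreducible_imp_irr:
  assumes "zariski_irreducible n C"
  shows "irr n C"
  unfolding irr_def
proof (intro conjI ballI impI)
  have cl: "zariski_closed n C" and "C \<noteq> {}" using assms unfolding zariski_irreducible_def by auto
  then show "C \<noteq> {}" "C \<subseteq> carrier_mat n n" by (auto dest: zariski_closed_subset_carrier)
  fix p q assume pq: "p \<in> poly_fun n" "q \<in> poly_fun n" "\<forall>s\<in>C. p s * q s = 0"
  obtain P where P: "P \<subseteq> poly_fun n" "C = {A \<in> carrier_mat n n. \<forall>p\<in>P. p A = 0}"
    using cl unfolding zariski_closed_def by blast
  have closed: "zariski_closed n {A \<in> C. f A = 0}" if "f \<in> poly_fun n" for f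
    unfolding zariski_closed_def using P that by (intro exI[of _ "insert f P"]) auto
  have "C = {A \<in> C. p A = 0} \<union> {A \<in> C. q A = 0}" using pq(3) by auto
  then have "C = {A \<in> C. p A = 0} \<or> C = {A \<in> C. q A = 0}"
    using assms closed[OF pq(1)] closed[OF pq(2)] unfolding zariski_irreducible_def by blast
  then show "(\<forall>s\<in>C. p s = 0) \<or> (\<forall>s\<in>C. q s = 0)" by blast
qed

lemma irr_cancel:
  assumes "irr n S" "p \<in> poly_fun n" "q \<in> poly_fun n" "\<exists>s\<in>S. p s \<noteq> 0" "\<forall>s\<in>S. p s * q s = 0"
  shows "\<forall>s\<in>S. q s = 0"
  using assms unfolding irr_def by blast

section \<open>Growth of the number of independent functions\<close>

abbreviation pdegn :: "nat \<Rightarrow> nat \<Rightarrow> ('k::field mat \<Rightarrow> 'k) \<Rightarrow> bool" where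
  "pdegn n \<equiv> pdeg (all_pos n)"

lemma has_indep_closure:
  assumes "S \<subseteq> carrier_mat n n" "has_indep (zariski_closure n S) (pdegn n m) R"
  shows "has_indep S (pdegn n m) R"
  by (rule has_indep_transfer[OF assms(2)])
    (rule zariski_closure_vanish[OF assms(1) pdeg_imp_poly_fun[OF _ subset_refl]])

lemma has_indep_open_subset:
  assumes "irr n S" "Q \<in> poly_fun n" "\<exists>s\<in>S. Q s \<noteq> 0" "has_indep S (pdegn n m) R"
  shows "has_indep {s \<in> S. Q s \<noteq> 0} (pdegn n m) R"
  by (rule has_indep_transfer[OF assms(4)])
    (rule irr_cancel[OF assms(1,2) pdeg_imp_poly_fun[OF _ subset_refl] assms(3)], auto)

lemma sum_lessThan_add:
  fixes g :: "nat \<Rightarrow> 'b::comm_monoid_add"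
  shows "(\<Sum>i<R + R'. g i) = (\<Sum>i<R. g i) + (\<Sum>i<R'. g (R + i))"
  by (induction R') (auto simp: add.assoc)

text \<open>Multiplication by a function \<open>f\<close> vanishing on \<open>D\<close> but not on the irreducible set \<open>C\<close>
  embeds the functions on \<open>C\<close> into those that vanish on \<open>D\<close>.\<close>

lemma has_indep_add:
  assumes "irr n C" "D \<subseteq> C" "pdegn n d f" "\<forall>s\<in>D. f s = 0" "\<exists>s\<in>C. f s \<noteq> 0"
    and "has_indep D (pdegn n m) R" "has_indep C (pdegn n m') R'" "m \<le> m' + d"
  shows "has_indep C (pdegn n (m' + d)) (R + R')"
proof -
  obtain p where p: "\<And>i. i < R \<Longrightarrow> pdegn n m (p i)" "lin_indep_on D R p"
    using assms(6) unfolding has_indep_def by blast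
  obtain q where q: "\<And>i. i < R' \<Longrightarrow> pdegn n m' (q i)" "lin_indep_on C R' q"
    using assms(7) unfolding has_indep_def by blast
  define r where "r = (\<lambda>i. if i < R then p i else (\<lambda>A. f A * q (i - R) A))"
  have "pdegn n (m' + d) (r i)" if "i < R + R'" for i
  proof (cases "i < R")
    case True
    then show ?thesis using p(1) assms(8) by (auto simp: r_def intro: pdeg.mono)
  next
    case False
    then have "pdegn n (d + m') (r i)"
      using that q(1)[of "i - R"] assms(3) by (auto simp: r_def intro!: pdeg.mult)
    then show ?thesis by (simp add: add.commute)
  qed
  moreover have "lin_indep_on C (R + R') r"
    unfolding lin_indep_on_def
  proof (rule allI, rule impI)
    fix v assume v: "\<forall>s\<in>C. (\<Sum>i<R + R'. v i * r i s) = 0"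
    have eq: "(\<Sum>i<R + R'. v i * r i s) =
       (\<Sum>i<R. v i * p i s) + f s * (\<Sum>i<R'. v (R + i) * q i s)" for s
      unfolding sum_lessThan_add by (simp add: r_def sum_distrib_left algebra_simps)
    have "\<forall>s\<in>D. (\<Sum>i<R. v i * p i s) = 0"
      using v assms(2,4) unfolding eq by fastforce
    then have v1: "\<forall>i<R. v i = 0" using p(2) unfolding lin_indep_on_def by blast
    then have fq: "\<forall>s\<in>C. f s * (\<Sum>i<R'. v (R + i) * q i s) = 0"
      using v unfolding eq by simp
    have q': "(\<lambda>A. \<Sum>i<R'. v (R + i) * q i A) \<in> poly_fun n"
      by (rule pdeg_imp_poly_fun[of "all_pos n" m', OF _ subset_refl], intro pdeg_sum pdeg_cmult) (use q(1) in auto)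
    have "f \<in> poly_fun n" using assms(3) by (blast intro: pdeg_imp_poly_fun)
    from irr_cancel[OF assms(1) this q' assms(5) fq]
    have "\<forall>s\<in>C. (\<Sum>i<R'. v (R + i) * q i s) = 0" .
    then have "\<forall>i<R'. v (R + i) = 0"
      using q(2)[unfolded lin_indep_on_def, rule_format, of "\<lambda>i. v (R + i)"] by blast
    then show "\<forall>i<R + R'. v i = 0"
      using v1 by (metis add_diff_inverse_nat nat_add_left_cancel_less)
  qed
  ultimately show ?thesis unfolding has_indep_def by blast
qed

text \<open>The powers of one \<open>f\<close> that vanishes on \<open>D\<close> stack
  \<open>Suc k\<close> copies of the functions on \<open>D\<close> inside those on \<open>C\<close>.
  With \<open>k = m\<close> the degree \<open>m + m * d\<close> is still linear in \<open>m\<close>,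
  while the number of functions has gained the factor \<open>m + 1\<close>.\<close>

lemma growth_drop:
  fixes C D :: "'k::field mat set"
  assumes "irr n C" "zariski_closed n D" "D \<subset> C"
    and A: "\<And>m R. has_indep C (pdegn n m) R \<Longrightarrow> (m + 1) ^ j * R \<le> A * (m + 1) ^ t"
  shows "\<exists>A'. \<forall>m R. has_indep D (pdegn n m) R \<longrightarrow> (m + 1) ^ Suc j * R \<le> A' * (m + 1) ^ t"
proof -
  obtain P where P: "P \<subseteq> poly_fun n" "D = {A \<in> carrier_mat n n. \<forall>p\<in>P. p A = 0}"
    using assms(2) unfolding zariski_closed_def by blast
  obtain a where "a \<in> C" "a \<notin> D" using assms(3) by blast
  moreover have "a \<in> carrier_mat n n" using assms(1) \<open>a \<in> C\<close> unfolding irr_def by blast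
  ultimately obtain f where f: "f \<in> P" "f a \<noteq> 0" using P by blast
  then obtain d where d: "pdegn n d f" using P(1) poly_fun_imp_pdeg by blast
  have "(m + 1) ^ Suc j * R \<le> (A * (d + 1) ^ t) * (m + 1) ^ t" if ind: "has_indep D (pdegn n m) R" for m R
  proof -
    have iter: "has_indep C (pdegn n (m + k * d)) (Suc k * R)" for k
    proof (induction k)
      case 0
      then show ?case using has_indep_mono[OF ind, of C] assms(3) by auto
    next
      case (Suc k)
      have "has_indep C (pdegn n (m + k * d + d)) (R + Suc k * R)"
        by (rule has_indep_add[OF assms(1) _ d _ _ ind Suc]) (use P f assms(3) \<open>a \<in> C\<close> in auto)
      then show ?case by (simp add: algebra_simps)
    qed
    have "(m + 1) ^ Suc j * R = (m + 1) ^ j * (Suc m * R)" by (simp add: algebra_simps)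
    also have "\<dots> \<le> (m + m * d + 1) ^ j * (Suc m * R)" by (intro mult_le_mono power_mono) auto
    also have "\<dots> \<le> A * (m + m * d + 1) ^ t" by (rule A[OF iter])
    also have "\<dots> \<le> A * ((d + 1) * (m + 1)) ^ t" by (intro mult_le_mono power_mono) (auto simp: algebra_simps)
    finally show ?thesis by (simp only: power_mult_distrib mult.assoc)
  qed
  then show ?thesis by blast
qed

section \<open>Krull dimension from growth\<close>

definition irr_chain :: "nat \<Rightarrow> 'k::field mat set \<Rightarrow> nat \<Rightarrow> (nat \<Rightarrow> 'k mat set) \<Rightarrow> bool" where
  "irr_chain n S l C \<longleftrightarrow> (\<forall>i\<le>l. zariski_irreducible n (C i) \<and> C i \<subseteq> zariski_closure n S) \<and>
     (\<forall>i<l. C i \<subset> C (Suc i))"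

lemma zariski_dim_alt: "zariski_dim n S = (GREATEST m. \<exists>C. irr_chain n S m C)"
  unfolding zariski_dim_def irr_chain_def ..

text \<open>Each step down the chain costs one power of \<open>m + 1\<close>. At the bottom the
  constant function alone gives \<open>(m + 1) ^ l \<le> A * (m + 1) ^ t\<close> for all
  \<open>m\<close>, and \<open>m = A\<close> refutes \<open>l > t\<close>.\<close>

lemma irr_chain_length_le:
  fixes S :: "'k::field mat set"
  assumes "S \<subseteq> carrier_mat n n"
    and A: "\<And>m R. has_indep S (pdegn n m) R \<Longrightarrow> R \<le> A * (m + 1) ^ t"
    and "irr_chain n S l C"
  shows "l \<le> t"
proof -
  have irr: "irr n (C i)" "zariski_closed n (C i)" "C i \<subseteq> zariski_closure n S" if "i \<le> l" for i
    using assms(3) that unfolding irr_chain_def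
    by (auto intro: zariski_irreducible_imp_irr simp: zariski_irreducible_def)
  have "\<exists>A. \<forall>m R. has_indep (C (l - j)) (pdegn n m) R \<longrightarrow> (m + 1) ^ j * R \<le> A * (m + 1) ^ t" if "j \<le> l" for j
    using that
  proof (induction j)
    case 0
    have "R \<le> A * (m + 1) ^ t" if "has_indep (C l) (pdegn n m) R" for m R
      by (rule A, rule has_indep_closure[OF assms(1)], rule has_indep_mono[OF that]) (use irr in auto)
    then show ?case by auto
  next
    case (Suc j)
    then obtain A where "\<And>m R. has_indep (C (l - j)) (pdegn n m) R \<Longrightarrow> (m + 1) ^ j * R \<le> A * (m + 1) ^ t"
      by auto
    moreover have "C (l - Suc j) \<subset> C (Suc (l - Suc j))"
      using assms(3) Suc.prems unfolding irr_chain_def by auto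
    moreover have "Suc (l - Suc j) = l - j" using Suc.prems by simp
    ultimately show ?case using irr by (intro growth_drop[of n "C (l - j)"]) auto
  qed
  from this[of l] obtain A where A:
    "\<And>m R. has_indep (C 0) (pdegn n m) R \<Longrightarrow> (m + 1) ^ l * R \<le> A * (m + 1) ^ t" by auto
  have "C 0 \<noteq> {}" using irr(1)[of 0] unfolding irr_def by auto
  then have "has_indep (C 0) (pdegn n m) 1" for m
    unfolding has_indep_def lin_indep_on_def by (intro exI[of _ "\<lambda>_ _. 1"]) (auto intro: pdeg.const)
  from A[OF this[of A]] have *: "(A + 1) ^ l \<le> A * (A + 1) ^ t" by simp
  show "l \<le> t"
  proof (rule ccontr)
    assume "\<not> l \<le> t"
    then have "(A + 1) ^ Suc t \<le> (A + 1) ^ l" by (intro power_increasing) auto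
    then have "(A + 1) * (A + 1) ^ t \<le> A * (A + 1) ^ t" using * by (simp only: power_Suc)
    then show False by (simp only: mult_le_cancel2) simp
  qed
qed

text \<open>\<open>GREATEST\<close> is meaningful only for a nonempty bounded set of lengths: the
  given chain supplies the one, the growth estimate the other.\<close>

lemma zariski_dim_bounds:
  assumes "S \<subseteq> carrier_mat n n"
    and "\<And>m R. has_indep S (pdegn n m) R \<Longrightarrow> R \<le> A * (m + 1) ^ t"
    and "irr_chain n S l C"
  shows "l \<le> zariski_dim n S" "zariski_dim n S \<le> t"
proof -
  have b: "\<forall>y. (\<exists>C. irr_chain n S y C) \<longrightarrow> y \<le> t" using irr_chain_length_le[OF assms(1,2)] by blast
  have ex: "\<exists>C. irr_chain n S l C" using assms(3) by blast
  show "l \<le> zariski_dim n S" unfolding zariski_dim_alt 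
    by (rule Greatest_le_nat[of "\<lambda>m. \<exists>C. irr_chain n S m C" l t]) (use b ex in auto)
  have "\<exists>C. irr_chain n S (zariski_dim n S) C"
    unfolding zariski_dim_alt by (rule GreatestI_nat[of "\<lambda>m. \<exists>C. irr_chain n S m C" l t]) (use b ex in auto)
  then show "zariski_dim n S \<le> t" using b by blast
qed

section \<open>Rational curves\<close>

text \<open>Regularity is required at the endpoints 0 and 1 only. Where the denominator vanishes the
  value is arbitrary, which tolerates divisions by zero along a curve.\<close>

definition rat :: "('k::field \<Rightarrow> 'k) \<Rightarrow> bool" where
  "rat f \<longleftrightarrow> (\<exists>a b. poly b 0 \<noteq> 0 \<and> poly b 1 \<noteq> 0 \<and> (\<forall>s. poly b s \<noteq> 0 \<longrightarrow> f s * poly b s = poly a s))"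

lemma rat_poly: "rat (poly a)"
  unfolding rat_def by (intro exI[of _ a] exI[of _ 1]) auto

lemma rat_const: "rat (\<lambda>s. c)"
  using rat_poly[of "[:c:]"] by (simp add: rat_def)

lemma rat_common_denominator:
  assumes "rat f" "rat g"
  obtains a c b where "poly b 0 \<noteq> 0" "poly b 1 \<noteq> 0"
    "\<And>s. poly b s \<noteq> 0 \<Longrightarrow> f s * poly b s = poly a s \<and> g s * poly b s = poly c s"
proof -
  obtain a b where f: "poly b 0 \<noteq> 0" "poly b 1 \<noteq> 0" "\<And>s. poly b s \<noteq> 0 \<Longrightarrow> f s * poly b s = poly a s"
    using assms(1) unfolding rat_def by blast
  obtain c d where g: "poly d 0 \<noteq> 0" "poly d 1 \<noteq> 0" "\<And>s. poly d s \<noteq> 0 \<Longrightarrow> g s * poly d s = poly c s"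
    using assms(2) unfolding rat_def by blast
  show ?thesis
  proof (rule that[of "b * d" "a * d" "c * b"])
    fix s assume "poly (b * d) s \<noteq> 0"
    then show "f s * poly (b * d) s = poly (a * d) s \<and> g s * poly (b * d) s = poly (c * b) s"
      using f(3)[of s, symmetric] g(3)[of s, symmetric] by simp
  qed (use f g in auto)
qed

lemma rat_add:
  assumes "rat f" "rat g"
  shows "rat (\<lambda>s. f s + g s)"
proof -
  obtain a c b where "poly b 0 \<noteq> 0" "poly b 1 \<noteq> 0"
    "\<And>s. poly b s \<noteq> 0 \<Longrightarrow> f s * poly b s = poly a s \<and> g s * poly b s = poly c s"
    using rat_common_denominator[OF assms] by metis
  then show ?thesis
    unfolding rat_def by (intro exI[of _ "a + c"] exI[of _ b]) (auto simp: distrib_right)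
qed

lemma rat_mult:
  assumes "rat f" "rat g"
  shows "rat (\<lambda>s. f s * g s)"
proof -
  obtain a c b where b: "poly b 0 \<noteq> 0" "poly b 1 \<noteq> 0"
    "\<And>s. poly b s \<noteq> 0 \<Longrightarrow> f s * poly b s = poly a s \<and> g s * poly b s = poly c s"
    using rat_common_denominator[OF assms] by metis
  have "f s * g s * poly (b * b) s = poly (a * c) s" if "poly (b * b) s \<noteq> 0" for s
    using b(3)[of s, THEN conjunct1, symmetric] b(3)[of s, THEN conjunct2, symmetric] that by simp
  then show ?thesis
    unfolding rat_def using b by (intro exI[of _ "a * c"] exI[of _ "b * b"]) auto
qed

lemma rat_divide:
  assumes "rat f" "rat g" "g 0 \<noteq> 0" "g 1 \<noteq> 0"
  shows "rat (\<lambda>s. f s / g s)"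
proof -
  obtain c d where *: "poly d 0 \<noteq> 0" "poly d 1 \<noteq> 0" "\<And>s. poly d s \<noteq> 0 \<Longrightarrow> g s * poly d s = poly c s"
    using assms(2) unfolding rat_def by blast
  have "poly c 0 \<noteq> 0" "poly c 1 \<noteq> 0" using *(1,2) *(3)[of 0] *(3)[of 1] assms(3,4) by auto
  moreover have "inverse (g s) * poly (c * d) s = poly (d * d) s" if "poly (c * d) s \<noteq> 0" for s
  proof -
    have "g s \<noteq> 0" using that *(3)[of s] by auto
    then show ?thesis using that *(3)[of s] by (simp add: field_simps)
  qed
  ultimately have "rat (\<lambda>s. inverse (g s))"
    unfolding rat_def using * by (intro exI[of _ "d * d"] exI[of _ "c * d"]) auto
  then show ?thesis using rat_mult[OF assms(1)] by (simp add: divide_inverse)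
qed

lemma rat_poly_fun:
  "p \<in> poly_fun n \<Longrightarrow> (\<And>i j. i < n \<Longrightarrow> j < n \<Longrightarrow> rat (\<lambda>s. \<gamma> s $$ (i, j))) \<Longrightarrow> rat (\<lambda>s. p (\<gamma> s))"
  by (induction rule: poly_fun.induct) (auto intro: rat_const rat_add rat_mult)

lemma rat_nonzero_poly:
  assumes "rat f" "f 0 \<noteq> 0 \<or> f 1 \<noteq> 0"
  shows "\<exists>q. q \<noteq> 0 \<and> (\<forall>s. poly q s \<noteq> 0 \<longrightarrow> f s \<noteq> 0)"
proof -
  obtain a b where *: "poly b 0 \<noteq> 0" "poly b 1 \<noteq> 0" "\<And>s. poly b s \<noteq> 0 \<Longrightarrow> f s * poly b s = poly a s"
    using assms(1) unfolding rat_def by blast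
  have "poly a 0 \<noteq> 0 \<or> poly a 1 \<noteq> 0" using *(1,2) *(3)[of 0] *(3)[of 1] assms(2) by auto
  then have "a * b \<noteq> 0" using * by auto
  moreover have "f s \<noteq> 0" if "poly (a * b) s \<noteq> 0" for s using that *(3)[of s] by auto
  ultimately show ?thesis by blast
qed

lemma poly_nonroot_ex:
  assumes "infinite (UNIV :: 'k::field set)" "(q :: 'k poly) \<noteq> 0"
  shows "\<exists>s. poly q s \<noteq> 0"
  using poly_roots_finite[OF assms(2)] assms(1) by (metis (mono_tags) UNIV_I finite_subset mem_Collect_eq subsetI)

definition curve_connected :: "nat \<Rightarrow> 'k::field mat set \<Rightarrow> bool" where
  "curve_connected n S \<longleftrightarrow> (\<forall>x\<in>S. \<forall>y\<in>S. \<exists>\<gamma> q. (\<forall>i<n. \<forall>j<n. rat (\<lambda>s. \<gamma> s $$ (i, j))) \<and>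
     \<gamma> 0 = x \<and> \<gamma> 1 = y \<and> q \<noteq> 0 \<and> (\<forall>s. poly q s \<noteq> 0 \<longrightarrow> \<gamma> s \<in> S))"

text \<open>On a curve from a point with \<open>p\<close> nonzero to one with \<open>p'\<close>
  nonzero, each function vanishes for finitely many parameters only, so both are nonzero at a common
  parameter.\<close>

lemma curve_connected_imp_irr:
  fixes S :: "'k::field mat set"
  assumes "infinite (UNIV :: 'k set)" "curve_connected n S" "S \<noteq> {}" "S \<subseteq> carrier_mat n n"
  shows "irr n S"
  unfolding irr_def
proof (intro conjI ballI impI assms(3,4), rule ccontr)
  fix p p' assume p: "p \<in> poly_fun n" "p' \<in> poly_fun n" "\<forall>s\<in>S. p s * p' s = 0"
    and "\<not> ((\<forall>s\<in>S. p s = 0) \<or> (\<forall>s\<in>S. p' s = 0))"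
  then obtain x y where xy: "x \<in> S" "p x \<noteq> 0" "y \<in> S" "p' y \<noteq> 0" by blast
  obtain \<gamma> q where \<gamma>': "\<forall>i<n. \<forall>j<n. rat (\<lambda>s. \<gamma> s $$ (i, j))" and \<gamma>: "\<gamma> 0 = x" "\<gamma> 1 = y"
    "q \<noteq> 0" "\<forall>s. poly q s \<noteq> 0 \<longrightarrow> \<gamma> s \<in> S"
    using assms(2)[unfolded curve_connected_def, THEN bspec, OF xy(1), THEN bspec, OF xy(3)]
    by (elim exE conjE)
  note rat\<gamma> = \<gamma>'[rule_format]
  obtain a where a: "a \<noteq> 0" "\<And>s. poly a s \<noteq> 0 \<Longrightarrow> p (\<gamma> s) \<noteq> 0"
    using rat_nonzero_poly[OF rat_poly_fun[OF p(1) rat\<gamma>]] \<gamma>(1) xy(2) by auto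
  obtain b where b: "b \<noteq> 0" "\<And>s. poly b s \<noteq> 0 \<Longrightarrow> p' (\<gamma> s) \<noteq> 0"
    using rat_nonzero_poly[OF rat_poly_fun[OF p(2) rat\<gamma>]] \<gamma>(2) xy(4) by auto
  obtain s where "poly (a * b * q) s \<noteq> 0"
    using poly_nonroot_ex[OF assms(1), of "a * b * q"] a(1) b(1) \<gamma>(3) by auto
  then have "p (\<gamma> s) \<noteq> 0" "p' (\<gamma> s) \<noteq> 0" "\<gamma> s \<in> S" using a(2) b(2) \<gamma>(4) by auto
  then show False using p(3) by auto
qed

section \<open>Triangular systems\<close>

definition coord_space :: "nat \<Rightarrow> (nat \<times> nat) set \<Rightarrow> 'k::field mat set" where
  "coord_space n X = {A \<in> carrier_mat n n. \<forall>i<n. \<forall>j<n. (i, j) \<notin> X \<longrightarrow> A $$ (i, j) = 0}"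

definition upd_mat :: "nat \<Rightarrow> 'k::field mat \<Rightarrow> nat \<times> nat \<Rightarrow> 'k \<Rightarrow> 'k mat" where
  "upd_mat n A \<beta> v = mat n n (\<lambda>\<tau>. if \<tau> = \<beta> then v else A $$ \<tau>)"

lemma upd_mat_index: "\<tau> \<in> all_pos n \<Longrightarrow> upd_mat n A \<beta> v $$ \<tau> = (if \<tau> = \<beta> then v else A $$ \<tau>)"
  by (auto simp: upd_mat_def)

lemma upd_mat_carrier: "upd_mat n A \<beta> v \<in> carrier_mat n n"
  by (simp add: upd_mat_def)

lemma upd_mat_same: "A \<in> carrier_mat n n \<Longrightarrow> v = A $$ \<beta> \<Longrightarrow> upd_mat n A \<beta> v = A"
  by (rule eq_matI) (auto simp: upd_mat_def)

lemma upd_mat_coord_space: "A \<in> coord_space n X \<Longrightarrow> \<beta> \<in> X \<Longrightarrow> upd_mat n A \<beta> v \<in> coord_space n X"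
  by (auto simp: coord_space_def upd_mat_def)

lemma pdeg_mono_set: "pdeg T m p \<Longrightarrow> T \<subseteq> T' \<Longrightarrow> pdeg T' m p"
  by (induction rule: pdeg.induct) (auto intro: pdeg.intros)

fun solve :: "nat \<Rightarrow> (nat \<times> nat \<Rightarrow> 'k::field mat \<Rightarrow> 'k) \<Rightarrow> (nat \<times> nat \<Rightarrow> 'k mat \<Rightarrow> 'k) \<Rightarrow>
    (nat \<times> nat) list \<Rightarrow> 'k mat \<Rightarrow> 'k mat" where
  "solve n G H [] A = A"
| "solve n G H (\<beta> # \<beta>s) A = solve n G H \<beta>s (upd_mat n A \<beta> (H \<beta> A / G \<beta> A))"

lemma solve_index:
  "\<tau> \<in> all_pos n \<Longrightarrow> \<tau> \<notin> set \<beta>s \<Longrightarrow> solve n G H \<beta>s A $$ \<tau> = A $$ \<tau>"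
  by (induction \<beta>s arbitrary: A) (auto simp: upd_mat_index)

lemma solve_coord_space:
  "A \<in> coord_space n X \<Longrightarrow> set \<beta>s \<subseteq> X \<Longrightarrow> solve n G H \<beta>s A \<in> coord_space n X"
  by (induction \<beta>s arbitrary: A) (auto simp: upd_mat_coord_space)

lemma solve_fixed:
  "A \<in> carrier_mat n n \<Longrightarrow> \<forall>\<beta>\<in>set \<beta>s. G \<beta> A \<noteq> 0 \<and> A $$ \<beta> * G \<beta> A = H \<beta> A \<Longrightarrow> solve n G H \<beta>s A = A"
proof (induction \<beta>s)
  case (Cons \<beta> \<beta>s)
  then have "H \<beta> A / G \<beta> A = A $$ \<beta>" by (auto simp: field_simps)
  then show ?case using Cons by (auto simp: upd_mat_same)
qed simp

text \<open>Both endpoints satisfy the equations, so every substitution leaves them unchanged and no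
  denominator vanishes there.\<close>

lemma solve_rat:
  assumes "\<And>\<beta>. \<beta> \<in> set \<beta>s \<Longrightarrow> G \<beta> \<in> poly_fun n \<and> H \<beta> \<in> poly_fun n"
    and "\<And>i j. i < n \<Longrightarrow> j < n \<Longrightarrow> rat (\<lambda>s. \<gamma> s $$ (i, j))"
    and "\<gamma> 0 \<in> carrier_mat n n" "\<gamma> 1 \<in> carrier_mat n n"
    and "\<forall>\<beta>\<in>set \<beta>s. G \<beta> (\<gamma> 0) \<noteq> 0 \<and> \<gamma> 0 $$ \<beta> * G \<beta> (\<gamma> 0) = H \<beta> (\<gamma> 0)"
    and "\<forall>\<beta>\<in>set \<beta>s. G \<beta> (\<gamma> 1) \<noteq> 0 \<and> \<gamma> 1 $$ \<beta> * G \<beta> (\<gamma> 1) = H \<beta> (\<gamma> 1)"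
    and "i < n" "j < n"
  shows "rat (\<lambda>s. solve n G H \<beta>s (\<gamma> s) $$ (i, j))"
  using assms
proof (induction \<beta>s arbitrary: \<gamma>)
  case Nil
  then show ?case by simp
next
  case (Cons \<beta> \<beta>s)
  let ?g = "\<lambda>s. upd_mat n (\<gamma> s) \<beta> (H \<beta> (\<gamma> s) / G \<beta> (\<gamma> s))"
  have "G \<beta> \<in> poly_fun n" "H \<beta> \<in> poly_fun n" using Cons.prems(1)[of \<beta>] by auto
  then have "rat (\<lambda>s. H \<beta> (\<gamma> s))" "rat (\<lambda>s. G \<beta> (\<gamma> s))"
    by (auto intro: rat_poly_fun[OF _ Cons.prems(2)])
  then have "rat (\<lambda>s. H \<beta> (\<gamma> s) / G \<beta> (\<gamma> s))"
    by (rule rat_divide) (use Cons.prems(5,6) in auto)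
  then have rat: "rat (\<lambda>s. ?g s $$ (i, j))" if "i < n" "j < n" for i j
    using that Cons.prems(2)[OF that] by (cases "(i, j) = \<beta>") (auto simp: upd_mat_index)
  have "?g 0 = \<gamma> 0" "?g 1 = \<gamma> 1"
    using Cons.prems by (auto intro!: upd_mat_same simp: field_simps)
  then show ?case
    unfolding solve.simps using Cons.prems rat by (intro Cons.IH) auto
qed

text \<open>The solutions \<open>Z\<close> form a set birational to the space of the free
  coordinates \<open>X - set \<beta>s\<close>: each equation expresses one unknown rationally
  through free coordinates and unknowns that precede it in the list.\<close>

locale triangular_system =
  fixes n :: nat and X :: "(nat \<times> nat) set" and \<beta>s :: "(nat \<times> nat) list"
    and T :: "nat \<times> nat \<Rightarrow> (nat \<times> nat) set" and \<delta> :: nat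
    and G H :: "nat \<times> nat \<Rightarrow> 'k::field mat \<Rightarrow> 'k" and Q :: "'k mat \<Rightarrow> 'k"
  assumes X: "X \<subseteq> all_pos n"
    and distinct: "distinct \<beta>s" and \<beta>s_X: "set \<beta>s \<subseteq> X"
    and triangular: "sorted_wrt (\<lambda>\<beta> \<beta>'. \<beta>' \<notin> T \<beta>) \<beta>s"
    and T: "\<And>\<beta>. \<beta> \<in> set \<beta>s \<Longrightarrow> \<beta> \<notin> T \<beta> \<and> T \<beta> \<subseteq> X"
    and GH: "\<And>\<beta>. \<beta> \<in> set \<beta>s \<Longrightarrow> pdeg (T \<beta>) \<delta> (G \<beta>) \<and> pdeg (T \<beta>) \<delta> (H \<beta>)"
    and Q: "Q \<in> poly_fun n"
    and G_nonzero: "\<And>A \<beta>. A \<in> coord_space n X \<Longrightarrow> Q A \<noteq> 0 \<Longrightarrow> \<beta> \<in> set \<beta>s \<Longrightarrow> G \<beta> A \<noteq> 0"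
begin

definition Z :: "'k mat set" where
  "Z = {A \<in> coord_space n X. Q A \<noteq> 0 \<and> (\<forall>\<beta>\<in>set \<beta>s. A $$ \<beta> * G \<beta> A = H \<beta> A)}"

lemma Z_carrier: "Z \<subseteq> carrier_mat n n"
  unfolding Z_def coord_space_def by blast

text \<open>Unknowns are eliminated from the end of the list, so that the equation in use involves
  only coordinates still present. The degree grows by a constant factor in total, which affects the
  constant but not the exponent.\<close>

lemma has_indep_Z_le:
  assumes "has_indep Z (pdegn n m) R"
  shows "R \<le> ((1 + \<delta>) ^ length \<beta>s) ^ (card X - length \<beta>s) * (m + 1) ^ (card X - length \<beta>s)"
proof -
  have finX: "finite X" using X finite_subset by blast
  have start: "has_indep Z (pdeg X m) R"
  proof -
    obtain p where p: "\<And>i. i < R \<Longrightarrow> pdegn n m (p i)" "lin_indep_on Z R p"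
      using assms unfolding has_indep_def by blast
    have "restrict_mat n X A = A" if "A \<in> Z" for A
      using that by (intro eq_matI) (auto simp: restrict_mat_def Z_def coord_space_def)
    then have "lin_indep_on Z R (\<lambda>i A. p i (restrict_mat n X A))"
      using p(2) unfolding lin_indep_on_def by simp
    moreover have "pdeg X m (\<lambda>A. p i (restrict_mat n X A))" if "i < R" for i
      by (rule pdeg_restrict[OF p(1)[OF that]])
    ultimately show ?thesis
      unfolding has_indep_def by (intro exI[of _ "\<lambda>i A. p i (restrict_mat n X A)"] conjI allI impI)
  qed
  have "has_indep Z (pdeg (X - set vs) (m * (1 + \<delta>) ^ length vs)) R" if "\<beta>s = us @ vs" for us vs
    using that
  proof (induction vs arbitrary: us)
    case Nil
    then show ?case using start by simp
  next
    case (Cons v vs)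
    have v: "v \<in> set \<beta>s" "v \<notin> set vs" "set vs \<inter> T v = {}"
      using Cons.prems distinct triangular by (auto simp: sorted_wrt_append)
    have sub: "T v \<subseteq> X - set (v # vs)" using T[OF v(1)] v(3) by auto
    have eq: "X - set vs = insert v (X - set (v # vs))" using v \<beta>s_X by auto
    have "has_indep Z (pdeg (X - set (v # vs)) (m * (1 + \<delta>) ^ length vs * (1 + \<delta>))) R"
    proof (rule has_indep_eliminate[of _ v _ _ _ _ "G v" "H v"])
      show "has_indep Z (pdeg (insert v (X - set (v # vs))) (m * (1 + \<delta>) ^ length vs)) R"
        using Cons.IH[of "us @ [v]"] Cons.prems unfolding eq by simp
      show "pdeg (X - set (v # vs)) \<delta> (G v)" "pdeg (X - set (v # vs)) \<delta> (H v)"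
        using GH[OF v(1)] pdeg_mono_set[OF _ sub] by auto
    qed (use v(1) G_nonzero in \<open>auto simp: Z_def\<close>)
    then show ?case by (simp only: list.size(4) add_0_right power_add power_one_right mult.assoc One_nat_def[symmetric])
  qed
  from this[of "[]" \<beta>s] have "R \<le> (m * (1 + \<delta>) ^ length \<beta>s + 1) ^ card (X - set \<beta>s)"
    using has_indep_pdeg_le[of "X - set \<beta>s"] finX by auto
  also have "card (X - set \<beta>s) = card X - length \<beta>s"
    using \<beta>s_X distinct finX by (simp add: card_Diff_subset distinct_card)
  also have "(m * (1 + \<delta>) ^ length \<beta>s + 1) ^ (card X - length \<beta>s) \<le>
      ((1 + \<delta>) ^ length \<beta>s * (m + 1)) ^ (card X - length \<beta>s)"
    by (intro power_mono) (auto simp: algebra_simps)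
  finally show ?thesis by (simp only: power_mult_distrib)
qed

lemma GH_poly_fun: "\<beta> \<in> set \<beta>s \<Longrightarrow> G \<beta> \<in> poly_fun n \<and> H \<beta> \<in> poly_fun n"
  using pdeg_imp_poly_fun[of "T \<beta>" \<delta> _ n] GH[of \<beta>] T[of \<beta>] X by blast

text \<open>Later substitutions do not touch \<open>T \<beta>\<close>, so \<open>G \<beta>\<close>
  and \<open>H \<beta>\<close> keep the values they had when \<open>\<beta>\<close> was set.\<close>

lemma solve_solution:
  assumes "\<beta> \<in> set \<beta>s" "G \<beta> (solve n G H \<beta>s A) \<noteq> 0"
  shows "solve n G H \<beta>s A $$ \<beta> * G \<beta> (solve n G H \<beta>s A) = H \<beta> (solve n G H \<beta>s A)"
proof -
  have "solve n G H bs A $$ \<beta> * G \<beta> (solve n G H bs A) = H \<beta> (solve n G H bs A)"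
    if "distinct bs" "sorted_wrt (\<lambda>\<beta> \<beta>'. \<beta>' \<notin> T \<beta>) bs" "set bs \<subseteq> set \<beta>s" "\<beta> \<in> set bs"
      "G \<beta> (solve n G H bs A) \<noteq> 0" for bs
    using that
  proof (induction bs arbitrary: A)
    case (Cons b bs)
    show ?case
    proof (cases "\<beta> = b")
      case True
      let ?A = "upd_mat n A b (H b A / G b A)"
      have b: "b \<in> all_pos n" "b \<in> set \<beta>s" using Cons.prems \<beta>s_X X by auto
      have agree: "solve n G H bs ?A $$ \<tau> = A $$ \<tau>" if "\<tau> \<in> T b" for \<tau>
      proof -
        have "\<tau> \<in> all_pos n" "\<tau> \<noteq> b" "\<tau> \<notin> set bs" using that T[OF b(2)] X Cons.prems(2) by auto
        then show ?thesis by (simp add: solve_index upd_mat_index)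
      qed
      have "G b (solve n G H bs ?A) = G b A" "H b (solve n G H bs ?A) = H b A"
        using pdeg_cong_on[OF GH[OF b(2), THEN conjunct1] agree]
          pdeg_cong_on[OF GH[OF b(2), THEN conjunct2] agree] by auto
      moreover have "solve n G H bs ?A $$ b = H b A / G b A"
        using Cons.prems(1) b(1) by (simp add: solve_index upd_mat_index)
      ultimately show ?thesis using Cons.prems(5) True by simp
    next
      case False
      then show ?thesis using Cons by auto
    qed
  qed simp
  then show ?thesis using assms distinct triangular by blast
qed

lemma solve_in_Z:
  assumes "A \<in> coord_space n X" "Q (solve n G H \<beta>s A) \<noteq> 0"
  shows "solve n G H \<beta>s A \<in> Z"
  using assms solve_coord_space[OF assms(1) \<beta>s_X] G_nonzero solve_solution
  unfolding Z_def by blast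

lemma Z_equations:
  assumes "A \<in> Z"
  shows "A \<in> carrier_mat n n" "\<forall>\<beta>\<in>set \<beta>s. G \<beta> A \<noteq> 0 \<and> A $$ \<beta> * G \<beta> A = H \<beta> A"
  using assms G_nonzero unfolding Z_def coord_space_def by blast+

lemma solve_Z: "A \<in> Z \<Longrightarrow> solve n G H \<beta>s A = A"
  by (rule solve_fixed) (use Z_equations in auto)

text \<open>\<open>solve\<close> repairs a rational curve with endpoints in \<open>Z\<close>. The
  inequality for \<open>Q\<close> holds at an endpoint, hence for almost all parameters, and it
  forces the denominators to be nonzero as well.\<close>

lemma Z_curve:
  assumes "\<gamma> 0 \<in> Z" "\<gamma> 1 \<in> Z" "\<And>s. \<gamma> s \<in> coord_space n X"
    and "\<And>i j. i < n \<Longrightarrow> j < n \<Longrightarrow> rat (\<lambda>s. \<gamma> s $$ (i, j))"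
  shows "\<exists>q. q \<noteq> 0 \<and> (\<forall>s. poly q s \<noteq> 0 \<longrightarrow> solve n G H \<beta>s (\<gamma> s) \<in> Z)"
proof -
  have "rat (\<lambda>s. Q (solve n G H \<beta>s (\<gamma> s)))"
    by (rule rat_poly_fun[OF Q], rule solve_rat)
      (use GH_poly_fun Z_equations[OF assms(1)] Z_equations[OF assms(2)] assms(4) in auto)
  moreover have "Q (solve n G H \<beta>s (\<gamma> 0)) \<noteq> 0"
    unfolding solve_Z[OF assms(1)] using assms(1) unfolding Z_def by simp
  ultimately obtain q where "q \<noteq> 0" "\<And>s. poly q s \<noteq> 0 \<Longrightarrow> Q (solve n G H \<beta>s (\<gamma> s)) \<noteq> 0"
    using rat_nonzero_poly by blast
  then show ?thesis using solve_in_Z[OF assms(3)] by blast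
qed

text \<open>The segment between two points is repaired by \<open>solve\<close>, which changes
  unknowns only; the coordinates in \<open>F\<close> agree at both ends and so stay
  constant.\<close>

lemma Z_slice_curve_connected:
  assumes F: "F \<subseteq> X - set \<beta>s"
  shows "curve_connected n {A \<in> Z. \<forall>\<tau>\<in>F. A $$ \<tau> = y $$ \<tau>}"
  unfolding curve_connected_def
proof (intro ballI)
  fix x x' assume x: "x \<in> {A \<in> Z. \<forall>\<tau>\<in>F. A $$ \<tau> = y $$ \<tau>}" and x': "x' \<in> {A \<in> Z. \<forall>\<tau>\<in>F. A $$ \<tau> = y $$ \<tau>}"
  define l where "l = (\<lambda>s. mat n n (\<lambda>\<tau>. x $$ \<tau> + s * (x' $$ \<tau> - x $$ \<tau>)))"
  have c: "x \<in> carrier_mat n n" "x' \<in> carrier_mat n n" using x x' Z_carrier by auto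
  have l01: "l 0 = x" "l 1 = x'" using c by (auto simp: l_def intro!: eq_matI)
  have rat: "rat (\<lambda>s. l s $$ (i, j))" if "i < n" "j < n" for i j
    using that rat_poly[of "[:x $$ (i, j), x' $$ (i, j) - x $$ (i, j):]"]
    by (auto simp: l_def rat_def algebra_simps)
  have lX: "l s \<in> coord_space n X" for s
    using x x' by (auto simp: l_def Z_def coord_space_def)
  obtain q where q: "q \<noteq> 0" "\<And>s. poly q s \<noteq> 0 \<Longrightarrow> solve n G H \<beta>s (l s) \<in> Z"
    using Z_curve[of l] l01 x x' lX rat by auto
  have "solve n G H \<beta>s (l s) $$ \<tau> = y $$ \<tau>" if "\<tau> \<in> F" for \<tau> s
  proof -
    have t: "\<tau> \<in> all_pos n" "\<tau> \<notin> set \<beta>s" using that F X by auto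
    obtain i j where ij: "\<tau> = (i, j)" by fastforce
    have "solve n G H \<beta>s (l s) $$ \<tau> = l s $$ \<tau>" by (rule solve_index[OF t])
    also have "\<dots> = y $$ \<tau>" using t(1) that x x' ij by (auto simp: l_def)
    finally show ?thesis .
  qed
  moreover have "solve n G H \<beta>s (l 0) = x" "solve n G H \<beta>s (l 1) = x'"
    using l01 solve_Z x x' by auto
  moreover have "rat (\<lambda>s. solve n G H \<beta>s (l s) $$ (i, j))" if "i < n" "j < n" for i j
    by (rule solve_rat[OF _ rat]) (use GH_poly_fun Z_equations x x' l01 that in auto)
  ultimately show "\<exists>\<gamma> q. (\<forall>i<n. \<forall>j<n. rat (\<lambda>s. \<gamma> s $$ (i, j))) \<and> \<gamma> 0 = x \<and> \<gamma> 1 = x' \<and> q \<noteq> 0 \<and>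
      (\<forall>s. poly q s \<noteq> 0 \<longrightarrow> \<gamma> s \<in> {A \<in> Z. \<forall>\<tau>\<in>F. A $$ \<tau> = y $$ \<tau>})"
    using q by (intro exI[of _ "\<lambda>s. solve n G H \<beta>s (l s)"] exI[of _ q]) auto
qed

lemma Z_irr:
  assumes "infinite (UNIV :: 'k set)" "Z \<noteq> {}"
  shows "irr n Z"
  by (rule curve_connected_imp_irr[OF assms(1)]) (use Z_slice_curve_connected[of "{}"] assms(2) Z_carrier in auto)

lemma Z_move_free_coordinate:
  assumes inf: "infinite (UNIV :: 'k set)" and y: "y \<in> Z" and \<tau>: "\<tau> \<in> X - set \<beta>s"
  shows "\<exists>A\<in>Z. A $$ \<tau> \<noteq> y $$ \<tau> \<and> (\<forall>\<sigma>\<in>X - set \<beta>s - {\<tau>}. A $$ \<sigma> = y $$ \<sigma>)"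
proof -
  \<comment> \<open>The perturbation \<open>s * (s - 1)\<close> vanishes at both endpoints because
    \<open>Z_curve\<close> wants a curve that starts and ends in \<open>Z\<close>, and
    \<open>y\<close> serves as both ends.\<close>
  define g where "g = (\<lambda>s. upd_mat n y \<tau> (y $$ \<tau> + s * (s - 1)))"
  have c: "y \<in> carrier_mat n n" using y Z_carrier by auto
  have g01: "g 0 = y" "g 1 = y" unfolding g_def by (auto intro!: upd_mat_same[OF c])
  have "rat (\<lambda>s. y $$ \<tau> + s * (s - 1))"
    using rat_poly[of "[:y $$ \<tau>, -1, 1:]"] by (simp add: rat_def algebra_simps)
  then have rat: "rat (\<lambda>s. g s $$ (i, j))" if "i < n" "j < n" for i j
    using that rat_const unfolding g_def by (cases "(i, j) = \<tau>") (auto simp: upd_mat_index)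
  have "g s \<in> coord_space n X" for s
    using y \<tau> unfolding g_def by (intro upd_mat_coord_space) (auto simp: Z_def)
  then obtain q where q: "q \<noteq> 0" "\<And>s. poly q s \<noteq> 0 \<Longrightarrow> solve n G H \<beta>s (g s) \<in> Z"
    using Z_curve[of g] g01 y rat by auto
  have "q * [:0, -1, 1:] \<noteq> 0" unfolding mult_eq_0_iff using q(1) by simp
  then obtain s where s: "poly (q * [:0, -1, 1:]) s \<noteq> 0"
    using poly_nonroot_ex[OF inf] by blast
  let ?A = "solve n G H \<beta>s (g s)"
  have idx: "?A $$ \<sigma> = (if \<sigma> = \<tau> then y $$ \<tau> + s * (s - 1) else y $$ \<sigma>)" if "\<sigma> \<in> X - set \<beta>s" for \<sigma>
  proof -
    have s: "\<sigma> \<in> all_pos n" "\<sigma> \<notin> set \<beta>s" using that X by auto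
    show ?thesis unfolding solve_index[OF s] g_def upd_mat_index[OF s(1)] ..
  qed
  have "s * (s - 1) \<noteq> 0" using s by (auto simp: algebra_simps)
  then have "?A $$ \<tau> \<noteq> y $$ \<tau>" using idx[OF \<tau>] by simp
  moreover have "?A \<in> Z" using q(2) s by auto
  ultimately show ?thesis using idx by (intro bexI[of _ ?A]) simp_all
qed

text \<open>Starting from \<open>y\<close>, the free coordinates are released one after the other.
  The closures of the slices increase strictly, as the coordinate just released separates
  them.\<close>

lemma Z_chain:
  assumes inf: "infinite (UNIV :: 'k set)" and y: "y \<in> Z"
  shows "\<exists>C. irr_chain n Z (card X - length \<beta>s) C"
proof -
  have finX: "finite X" using X finite_subset by blast
  then obtain ts where ts: "set ts = X - set \<beta>s" "distinct ts"
    using finite_distinct_list[of "X - set \<beta>s"] by blast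
  have len: "length ts = card X - length \<beta>s"
    using ts distinct_card[OF ts(2)] \<beta>s_X distinct finX by (simp add: card_Diff_subset distinct_card)
  define L where "L = (\<lambda>i. {A \<in> Z. \<forall>\<tau>\<in>set (drop i ts). A $$ \<tau> = y $$ \<tau>})"
  have L: "irr n (L i)" "L i \<subseteq> Z" "y \<in> L i" for i
  proof -
    show Li: "L i \<subseteq> Z" "y \<in> L i" using y unfolding L_def by auto
    show "irr n (L i)"
      by (rule curve_connected_imp_irr[OF inf])
        (use Z_slice_curve_connected[of "set (drop i ts)" y] ts set_drop_subset[of i ts] Li Z_carrier
          in \<open>auto simp: L_def\<close>)
  qed
  define C where "C = (\<lambda>i. zariski_closure n (L i))"
  have strict: "C i \<subset> C (Suc i)" if i: "i < length ts" for i
  proof -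
    have d: "drop i ts = ts ! i # drop (Suc i) ts" using i by (rule Cons_nth_drop_Suc[symmetric])
    let ?\<tau> = "ts ! i"
    have \<tau>: "?\<tau> \<in> X - set \<beta>s" using i ts(1) nth_mem by blast
    have "L i \<subseteq> L (Suc i)" unfolding L_def d by auto
    then have sub: "C i \<subseteq> C (Suc i)" unfolding C_def by (rule zariski_closure_mono)
    have "distinct (drop i ts)" using ts(2) by (rule distinct_drop)
    then have "?\<tau> \<notin> set (drop (Suc i) ts)" unfolding d by simp
    moreover have "set (drop (Suc i) ts) \<subseteq> X - set \<beta>s" using ts(1) set_drop_subset[of "Suc i" ts] by blast
    moreover obtain A where A: "A \<in> Z" "A $$ ?\<tau> \<noteq> y $$ ?\<tau>" "\<And>\<sigma>. \<sigma> \<in> X - set \<beta>s - {?\<tau>} \<Longrightarrow> A $$ \<sigma> = y $$ \<sigma>"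
      using Z_move_free_coordinate[OF inf y \<tau>] by blast
    ultimately have "\<forall>\<tau>\<in>set (drop (Suc i) ts). A $$ \<tau> = y $$ \<tau>" by blast
    then have "A \<in> L (Suc i)" unfolding L_def using A(1) by simp
    then have "A \<in> C (Suc i)" unfolding C_def using zariski_closure_subset by blast
    moreover have "A \<notin> C i"
    proof
      assume "A \<in> C i"
      let ?p = "\<lambda>A :: 'k mat. A $$ ?\<tau> + - (y $$ ?\<tau>)"
      have p: "?p \<in> poly_fun n"
      proof -
        have "fst ?\<tau> < n" "snd ?\<tau> < n" using \<tau> X by auto
        from poly_fun.add[OF poly_fun.coord[OF this] poly_fun.const] show ?thesis by (simp only: prod.collapse)
      qed
      have "\<forall>s\<in>L i. ?p s = 0" unfolding L_def d by auto
      from zariski_closure_vanish[OF _ p this] have "?p A = 0"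
        using \<open>A \<in> C i\<close> L(2)[of i] Z_carrier unfolding C_def by blast
      then show False using A(2) by simp
    qed
    ultimately show ?thesis using sub by blast
  qed
  have "irr_chain n Z (length ts) C"
    unfolding irr_chain_def
  proof (intro conjI allI impI)
    fix i
    show "zariski_irreducible n (C i)" unfolding C_def by (rule irr_imp_zariski_irreducible[OF L(1)])
    show "C i \<subseteq> zariski_closure n Z" unfolding C_def by (rule zariski_closure_mono[OF L(2)])
  qed (rule strict)
  then show ?thesis unfolding len by blast
qed

end

text \<open>A coordinate space is the solution set of the system without equations.\<close>

lemma
  fixes X :: "(nat \<times> nat) set"
  assumes "infinite (UNIV :: 'k::field set)" "X \<subseteq> all_pos n"
  shows coord_space_irr: "irr n (coord_space n X :: 'k mat set)"
    and zariski_dim_coord_space: "zariski_dim n (coord_space n X :: 'k mat set) = card X"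
proof -
  interpret triangular_system n X "[]" "\<lambda>_. {}" 0 "\<lambda>_ _. 0 :: 'k" "\<lambda>_ _. 0" "\<lambda>_. 1"
    by unfold_locales (use assms(2) in \<open>auto intro: poly_fun.const\<close>)
  have eq: "Z = coord_space n X" unfolding Z_def by auto
  have z: "0\<^sub>m n n \<in> Z" unfolding eq coord_space_def by auto
  then show "irr n (coord_space n X :: 'k mat set)" using Z_irr[OF assms(1)] eq by auto
  obtain C where C: "irr_chain n Z (card X) C" using Z_chain[OF assms(1) z] by auto
  have b: "R \<le> 1 * (m + 1) ^ card X" if "has_indep Z (pdegn n m) R" for m R
    using has_indep_Z_le[OF that] by simp
  show "zariski_dim n (coord_space n X :: 'k mat set) = card X"
    using zariski_dim_bounds[OF Z_carrier b C] unfolding eq by simp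
qed

section \<open>Orbits of the Borel subgroup\<close>

lemma upper_triangular_mult:
  assumes "A \<in> carrier_mat n n" "B \<in> carrier_mat n n" "upper_triangular A" "upper_triangular B"
  shows "upper_triangular (A * B)"
proof (rule upper_triangularI)
  fix i j assume "j < i" "i < dim_row (A * B)"
  then have ij: "j < i" "i < n" using assms by auto
  have "(A * B) $$ (i, j) = (\<Sum>k = 0..<n. A $$ (i, k) * B $$ (k, j))"
    using assms ij by (auto simp: scalar_prod_def)
  also have "\<dots> = 0"
  proof (rule sum.neutral, rule ballI)
    fix k assume k: "k \<in> {0..<n}"
    have "k < i \<or> j < k" using ij by linarith
    then show "A $$ (i, k) * B $$ (k, j) = 0" using assms ij k by (auto dest: upper_triangularD)
  qed
  finally show "(A * B) $$ (i, j) = 0" .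
qed

lemma upper_triangular_diag_nonzero:
  fixes g :: "'k::field mat"
  assumes "g \<in> carrier_mat n n" "upper_triangular g" "det g \<noteq> 0" "i < n"
  shows "g $$ (i, i) \<noteq> 0"
  using upper_triangular_imp_det_eq_0_iff[OF assms(1,2)] assms(1,3,4) unfolding diag_mat_def by force

lemma upper_triangular_det_nonzero:
  fixes g :: "'k::field mat"
  assumes "g \<in> carrier_mat n n" "upper_triangular g" "\<And>i. i < n \<Longrightarrow> g $$ (i, i) \<noteq> 0"
  shows "det g \<noteq> 0"
  using upper_triangular_imp_det_eq_0_iff[OF assms(1,2)] assms(1,3) unfolding diag_mat_def by auto

lemma det_nonzero_of_inverse:
  fixes g :: "'k::field mat"
  assumes "g \<in> carrier_mat n n" "h \<in> carrier_mat n n" "g * h = 1\<^sub>m n"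
  shows "det g \<noteq> 0"
  using det_mult[OF assms(1,2)] assms(3) by auto

lemma det_nonzero_inverse:
  fixes g :: "'k::field mat"
  assumes "g \<in> carrier_mat n n" "det g \<noteq> 0"
  shows "\<exists>h\<in>carrier_mat n n. g * h = 1\<^sub>m n \<and> h * g = 1\<^sub>m n"
proof -
  note a = adj_mat[OF assms(1)]
  have "g * (inverse (det g) \<cdot>\<^sub>m adj_mat g) = 1\<^sub>m n"
    unfolding mult_smult_distrib[OF assms(1) a(1)] a(2) using assms(2) by (intro eq_matI) auto
  moreover have "(inverse (det g) \<cdot>\<^sub>m adj_mat g) * g = 1\<^sub>m n"
    unfolding mult_smult_assoc_mat[OF a(1) assms(1)] a(3) using assms(2) by (intro eq_matI) auto
  ultimately show ?thesis using a(1) by (intro bexI[of _ "inverse (det g) \<cdot>\<^sub>m adj_mat g"]) auto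
qed

lemma upper_triangular_inverse:
  fixes g :: "'k::field mat"
  assumes g: "g \<in> carrier_mat n n" "upper_triangular g" and h: "h \<in> carrier_mat n n" and gh: "g * h = 1\<^sub>m n"
  shows "upper_triangular h"
proof (rule upper_triangularI)
  fix i j assume "j < i" "i < dim_row h"
  then have "j < i" "i < n" using h by auto
  then show "h $$ (i, j) = 0"
  proof (induction "n - i" arbitrary: i rule: less_induct)
    case less
    have "0 = (g * h) $$ (i, j)" unfolding gh using less.prems by simp
    also have "\<dots> = (\<Sum>k = 0..<n. g $$ (i, k) * h $$ (k, j))"
      using g h less.prems by (auto simp: scalar_prod_def)
    also have "\<dots> = (\<Sum>k\<in>{i}. g $$ (i, k) * h $$ (k, j))"
    proof (rule sum.mono_neutral_right)
      show "\<forall>k\<in>{0..<n} - {i}. g $$ (i, k) * h $$ (k, j) = 0"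
      proof
        fix k assume k: "k \<in> {0..<n} - {i}"
        show "g $$ (i, k) * h $$ (k, j) = 0"
        proof (cases "k < i")
          case True
          then show ?thesis using g less.prems by (auto dest: upper_triangularD)
        next
          case False
          then have "i < k" "k < n" using k by auto
          then have "n - k < n - i" by simp
          from less.hyps[OF this] have "h $$ (k, j) = 0" using less.prems \<open>i < k\<close> \<open>k < n\<close> by simp
          then show ?thesis by simp
        qed
      qed
    qed (use less.prems in auto)
    finally show ?case
      using upper_triangular_diag_nonzero[OF g det_nonzero_of_inverse[OF g(1) h gh] less.prems(2)] by auto
  qed
qed

lemma borel_iff: "g \<in> borel n \<longleftrightarrow> g \<in> carrier_mat n n \<and> upper_triangular g \<and> det g \<noteq> 0"
proof
  assume "g \<in> borel n"
  then have g: "g \<in> carrier_mat n n" "upper_triangular g" "invertible_mat g" unfolding borel_def by auto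
  then obtain h where h: "inverts_mat g h" "inverts_mat h g" unfolding invertible_mat_def by blast
  then have "g * h = 1\<^sub>m n" "h \<in> carrier_mat n n"
    using g(1) unfolding inverts_mat_def
    by (auto, metis carrier_matD(2) carrier_matI index_mult_mat(2,3) index_one_mat(2,3))
  then show "g \<in> carrier_mat n n \<and> upper_triangular g \<and> det g \<noteq> 0"
    using g det_nonzero_of_inverse by blast
next
  assume g: "g \<in> carrier_mat n n \<and> upper_triangular g \<and> det g \<noteq> 0"
  then obtain h where "h \<in> carrier_mat n n" "g * h = 1\<^sub>m n" "h * g = 1\<^sub>m n"
    using det_nonzero_inverse by blast
  then have "invertible_mat g"
    using g unfolding invertible_mat_def inverts_mat_def square_mat.simps by auto
  then show "g \<in> borel n" using g unfolding borel_def by auto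
qed

lemma inverse_in_borel:
  assumes "g \<in> borel n" "h \<in> carrier_mat n n" "g * h = 1\<^sub>m n" "h * g = 1\<^sub>m n"
  shows "h \<in> borel n"
  using assms upper_triangular_inverse[of g n h] det_nonzero_of_inverse[of h n g] unfolding borel_iff by auto

text \<open>The equation \<open>y * g = g * x\<close> avoids the inverse, so membership in an orbit
  can be checked column by column.\<close>

lemma borel_orbitI:
  assumes "g \<in> carrier_mat n n" "upper_triangular g" "\<And>i. i < n \<Longrightarrow> g $$ (i, i) \<noteq> 0"
    and "x \<in> carrier_mat n n" "y \<in> carrier_mat n n" "y * g = g * x"
  shows "y \<in> borel_orbit n x"
proof -
  have "det g \<noteq> 0" using assms(1-3) by (rule upper_triangular_det_nonzero)
  then obtain h where h: "h \<in> carrier_mat n n" "g * h = 1\<^sub>m n" "h * g = 1\<^sub>m n"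
    using det_nonzero_inverse[OF assms(1)] by blast
  have "g * x * h = y * (g * h)"
    using assms h by (simp add: assms(6)[symmetric] assoc_mult_mat[of _ n n _ n _ n])
  also have "\<dots> = y" using h assms by simp
  finally have y: "y = g * x * h" by simp
  have "g \<in> borel n" unfolding borel_iff using assms(1,2) \<open>det g \<noteq> 0\<close> by blast
  then show ?thesis unfolding borel_orbit_def using h y by blast
qed

lemma borel_orbitE:
  assumes "y \<in> borel_orbit n x" "x \<in> carrier_mat n n"
  obtains g h where "g \<in> borel n" "g \<in> carrier_mat n n" "h \<in> carrier_mat n n" "g * h = 1\<^sub>m n" "h * g = 1\<^sub>m n"
    "y = g * x * h" "y * g = g * x" "y \<in> carrier_mat n n"
proof -
  obtain g h where *: "g \<in> borel n" "h \<in> carrier_mat n n" "g * h = 1\<^sub>m n" "h * g = 1\<^sub>m n" "y = g * x * h"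
    using assms(1) unfolding borel_orbit_def by blast
  have g: "g \<in> carrier_mat n n" using *(1) unfolding borel_def by blast
  have "y * g = g * x * (h * g)"
    unfolding *(5) using g * assms(2) by (simp add: assoc_mult_mat[of _ n n _ n _ n])
  also have "\<dots> = g * x" using g assms(2) * by simp
  finally show ?thesis using that[OF *(1) g *(2-5)] * g assms(2) by auto
qed

lemma borel_orbit_carrier: "x \<in> carrier_mat n n \<Longrightarrow> borel_orbit n x \<subseteq> carrier_mat n n"
  by (auto elim: borel_orbitE)

lemma borel_orbit_refl: "x \<in> carrier_mat n n \<Longrightarrow> x \<in> borel_orbit n x"
  by (rule borel_orbitI[of "1\<^sub>m n"]) auto

lemma borel_orbit_sym:
  assumes "y \<in> borel_orbit n x" "x \<in> carrier_mat n n"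
  shows "x \<in> borel_orbit n y"
proof -
  obtain g h where *: "g \<in> borel n" "g \<in> carrier_mat n n" "h \<in> carrier_mat n n" "g * h = 1\<^sub>m n" "h * g = 1\<^sub>m n"
    "y = g * x * h" "y * g = g * x" "y \<in> carrier_mat n n" using borel_orbitE[OF assms] .
  have "h * y * g = h * (y * g)" by (rule assoc_mult_mat[OF *(3,8,2)])
  also have "\<dots> = (h * g) * x" unfolding *(7) by (rule assoc_mult_mat[OF *(3,2) assms(2), symmetric])
  also have "\<dots> = x" unfolding *(5) using assms(2) by simp
  finally have "x = h * y * g" by simp
  then show ?thesis unfolding borel_orbit_def using inverse_in_borel[OF *(1,3,4,5)] *(2,4,5) by blast
qed

lemma borel_orbit_trans:
  assumes "z \<in> borel_orbit n y" "y \<in> borel_orbit n x" "x \<in> carrier_mat n n"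
  shows "z \<in> borel_orbit n x"
proof -
  have y: "y \<in> carrier_mat n n" using assms(2,3) borel_orbit_carrier by blast
  obtain g h where *: "g \<in> borel n" "g \<in> carrier_mat n n" "z * g = g * y" "z \<in> carrier_mat n n"
    using borel_orbitE[OF assms(1) y] by metis
  obtain g' where **: "g' \<in> borel n" "g' \<in> carrier_mat n n" "y * g' = g' * x"
    using borel_orbitE[OF assms(2,3)] by metis
  have c: "g * g' \<in> carrier_mat n n" using * ** by auto
  have u: "upper_triangular (g * g')" using * ** upper_triangular_mult unfolding borel_iff by blast
  have "det (g * g') \<noteq> 0" using * ** det_mult[of g n g'] unfolding borel_iff by auto
  then have d: "i < n \<Longrightarrow> (g * g') $$ (i, i) \<noteq> 0" for i
    using upper_triangular_diag_nonzero[OF c u] by blast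
  have "z * (g * g') = (z * g) * g'" using *(2,4) **(2) by (simp add: assoc_mult_mat[of _ n n _ n _ n])
  also have "\<dots> = g * (y * g')" unfolding *(3) using *(2) **(2) y by (simp add: assoc_mult_mat[of _ n n _ n _ n])
  also have "\<dots> = (g * g') * x" unfolding **(3) using *(2) **(2) assms(3) by (simp add: assoc_mult_mat[of _ n n _ n _ n])
  finally show ?thesis using c u d assms(3) *(4) by (intro borel_orbitI[of "g * g'"]) auto
qed

lemma mult3_index:
  fixes g x h :: "'k::comm_ring_1 mat"
  assumes "g \<in> carrier_mat n n" "x \<in> carrier_mat n n" "h \<in> carrier_mat n n" "i < n" "j < n"
  shows "(g * x * h) $$ (i, j) = (\<Sum>l = 0..<n. (\<Sum>k = 0..<n. g $$ (i, k) * x $$ (k, l)) * h $$ (l, j))"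
  using assms by (auto simp: scalar_prod_def simp del: assoc_mult_mat)

text \<open>Multiplication by triangular matrices from both sides moves entries only upwards and to
  the right.\<close>

lemma borel_orbit_coord_space:
  assumes up: "\<And>i j k l. (k, l) \<in> X \<Longrightarrow> i \<le> k \<Longrightarrow> l \<le> j \<Longrightarrow> j < n \<Longrightarrow> (i, j) \<in> X"
    and x: "x \<in> coord_space n X"
  shows "borel_orbit n x \<subseteq> coord_space n X"
proof
  fix y assume y: "y \<in> borel_orbit n x"
  have xc: "x \<in> carrier_mat n n" using x unfolding coord_space_def by blast
  obtain g h where *: "g \<in> borel n" "g \<in> carrier_mat n n" "h \<in> carrier_mat n n" "g * h = 1\<^sub>m n" "h * g = 1\<^sub>m n"
    "y = g * x * h" "y \<in> carrier_mat n n" using borel_orbitE[OF y xc] .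
  have ut: "upper_triangular g" "upper_triangular h"
    using inverse_in_borel[OF *(1,3,4,5)] *(1) unfolding borel_iff by auto
  have "y $$ (i, j) = 0" if ij: "i < n" "j < n" "(i, j) \<notin> X" for i j
  proof -
    have "g $$ (i, k) * x $$ (k, l) * h $$ (l, j) = 0" if "k < n" "l < n" for k l
    proof (rule ccontr)
      assume "\<not> ?thesis"
      then have "g $$ (i, k) \<noteq> 0" "x $$ (k, l) \<noteq> 0" "h $$ (l, j) \<noteq> 0" by auto
      moreover have "k < i \<Longrightarrow> g $$ (i, k) = 0" "j < l \<Longrightarrow> h $$ (l, j) = 0"
        using ut *(2,3) that ij(1) by (auto dest: upper_triangularD)
      moreover have "(k, l) \<notin> X \<Longrightarrow> x $$ (k, l) = 0" using x that unfolding coord_space_def by blast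
      ultimately have "i \<le> k" "l \<le> j" "(k, l) \<in> X" by (meson not_le)+
      then show False using up ij by blast
    qed
    then show ?thesis
      unfolding *(6) mult3_index[OF *(2) xc *(3) ij(1,2)] sum_distrib_right by (intro sum.neutral ballI) auto
  qed
  then show "y \<in> coord_space n X" using *(7) unfolding coord_space_def by blast
qed

section \<open>Lines of matrices and irreducibility of orbits\<close>

abbreviation eval_mat :: "'k::field \<Rightarrow> 'k poly mat \<Rightarrow> 'k mat" where
  "eval_mat s \<equiv> map_mat (\<lambda>p. poly p s)"

lemma poly_fun_eval_mat:
  assumes "p \<in> poly_fun n" "M \<in> carrier_mat n n"
  shows "\<exists>q. \<forall>s. p (eval_mat s M) = poly q s"
  using assms
proof (induction rule: poly_fun.induct)
  case (const c)
  show ?case by (rule exI[of _ "[:c:]"]) simp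
next
  case (coord i j)
  then show ?case by (intro exI[of _ "M $$ (i, j)"]) auto
next
  case (add p q)
  then obtain a b where "\<forall>s. p (eval_mat s M) = poly a s" "\<forall>s. q (eval_mat s M) = poly b s" by blast
  then show ?case by (intro exI[of _ "a + b"]) auto
next
  case (mult p q)
  then obtain a b where "\<forall>s. p (eval_mat s M) = poly a s" "\<forall>s. q (eval_mat s M) = poly b s" by blast
  then show ?case by (intro exI[of _ "a * b"]) auto
qed

lemma eval_mat_mult:
  "A \<in> carrier_mat n n \<Longrightarrow> B \<in> carrier_mat n n \<Longrightarrow> eval_mat s (A * B) = eval_mat s A * eval_mat s B"
proof -
  interpret ph: comm_ring_hom "\<lambda>p. poly p s" by unfold_locales auto
  show "A \<in> carrier_mat n n \<Longrightarrow> B \<in> carrier_mat n n \<Longrightarrow> ?thesis" by (rule ph.mat_hom_mult)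
qed

lemma det_eval_mat: "det (eval_mat s A) = poly (det A) s"
proof -
  interpret ph: comm_ring_hom "\<lambda>p. poly p s" by unfold_locales auto
  show ?thesis by (rule ph.hom_det)
qed

definition line_mat :: "nat \<Rightarrow> 'k::field mat \<Rightarrow> 'k mat \<Rightarrow> 'k poly mat" where
  "line_mat n x y = mat n n (\<lambda>\<tau>. [:x $$ \<tau>, y $$ \<tau> - x $$ \<tau>:])"

lemma line_mat_carrier [simp]: "line_mat n x y \<in> carrier_mat n n"
  by (simp add: line_mat_def)

lemma eval_line_mat:
  assumes "i < n" "j < n"
  shows "eval_mat s (line_mat n x y) $$ (i, j) = x $$ (i, j) + s * (y $$ (i, j) - x $$ (i, j))"
  using assms by (simp add: line_mat_def)

lemma eval_line_mat_0: "x \<in> carrier_mat n n \<Longrightarrow> eval_mat 0 (line_mat n x y) = x"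
  by (rule eq_matI) (auto simp: line_mat_def)

lemma eval_line_mat_1: "y \<in> carrier_mat n n \<Longrightarrow> eval_mat 1 (line_mat n x y) = y"
  by (rule eq_matI) (auto simp: line_mat_def)

lemma eval_const_mat: "eval_mat s (map_mat (\<lambda>a. [:a:]) x) = x"
  by (rule eq_matI) auto

lemma inverse_unique:
  fixes g :: "'k::field mat"
  assumes "g \<in> carrier_mat n n" "h \<in> carrier_mat n n" "h' \<in> carrier_mat n n" "h * g = 1\<^sub>m n" "g * h' = 1\<^sub>m n"
  shows "h = h'"
proof -
  have "h = h * (g * h')" unfolding assms(5) using assms(2) by simp
  also have "\<dots> = (h * g) * h'" by (rule assoc_mult_mat[OF assms(2,1,3), symmetric])
  also have "\<dots> = h'" unfolding assms(4) using assms(3) by simp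
  finally show ?thesis .
qed

text \<open>Two conjugating matrices are joined by a line of triangular matrices. The inverse along
  it is the adjugate over the determinant \<open>D\<close>, which is nonzero at both ends.\<close>

lemma borel_orbit_irr:
  fixes x :: "'k::field mat"
  assumes inf: "infinite (UNIV :: 'k set)" and x: "x \<in> carrier_mat n n"
  shows "irr n (borel_orbit n x)"
proof (rule curve_connected_imp_irr[OF inf])
  show "borel_orbit n x \<noteq> {}" using borel_orbit_refl[OF x] by blast
  show "borel_orbit n x \<subseteq> carrier_mat n n" by (rule borel_orbit_carrier[OF x])
  show "curve_connected n (borel_orbit n x)"
    unfolding curve_connected_def
  proof (intro ballI)
    fix y y' assume y: "y \<in> borel_orbit n x" and y': "y' \<in> borel_orbit n x"
    obtain g h where g: "g \<in> borel n" "g \<in> carrier_mat n n" "h \<in> carrier_mat n n" "g * h = 1\<^sub>m n"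
      "h * g = 1\<^sub>m n" "y = g * x * h" using borel_orbitE[OF y x] .
    obtain g' h' where g': "g' \<in> borel n" "g' \<in> carrier_mat n n" "h' \<in> carrier_mat n n" "g' * h' = 1\<^sub>m n"
      "h' * g' = 1\<^sub>m n" "y' = g' * x * h'" using borel_orbitE[OF y' x] .
    define L where "L = line_mat n g g'"
    define x1 where "x1 = map_mat (\<lambda>a. [:a:]) x"
    define D where "D = det L"
    define M where "M = L * x1 * adj_mat L"
    define \<gamma> where "\<gamma> = (\<lambda>s. mat n n (\<lambda>\<tau>. poly (M $$ \<tau>) s / poly D s))"
    have L: "L \<in> carrier_mat n n" unfolding L_def by simp
    have x1: "x1 \<in> carrier_mat n n" unfolding x1_def using x by simp
    note adj = adj_mat[OF L]
    have M: "M \<in> carrier_mat n n" unfolding M_def using L x1 adj(1) by simp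
    have eval: "\<gamma> s = eval_mat s L * x * h1"
      if "poly D s \<noteq> 0" "h1 \<in> carrier_mat n n" "h1 * eval_mat s L = 1\<^sub>m n" for s h1
    proof -
      let ?a = "inverse (poly D s) \<cdot>\<^sub>m eval_mat s (adj_mat L)"
      have Ls: "eval_mat s L \<in> carrier_mat n n" "eval_mat s (adj_mat L) \<in> carrier_mat n n"
        using L adj(1) by auto
      have "eval_mat s L * eval_mat s (adj_mat L) = eval_mat s (D \<cdot>\<^sub>m 1\<^sub>m n)"
        using eval_mat_mult[OF L adj(1)] adj(2) unfolding D_def by simp
      also have "\<dots> = poly D s \<cdot>\<^sub>m 1\<^sub>m n" by (rule eq_matI) auto
      finally have "eval_mat s L * ?a = 1\<^sub>m n"
        unfolding mult_smult_distrib[OF Ls] using that(1) by (intro eq_matI) auto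
      then have h1: "h1 = ?a" using inverse_unique[OF Ls(1) that(2) _ that(3)] Ls(2) by auto
      have "eval_mat s M = eval_mat s L * x * eval_mat s (adj_mat L)"
        unfolding M_def using L x1 adj(1) by (simp add: eval_mat_mult[of _ n] x1_def eval_const_mat)
      moreover have "\<gamma> s = inverse (poly D s) \<cdot>\<^sub>m eval_mat s M"
        unfolding \<gamma>_def using M by (intro eq_matI) (auto simp: divide_inverse mult.commute)
      moreover have "eval_mat s L * x * ?a = inverse (poly D s) \<cdot>\<^sub>m (eval_mat s L * x * eval_mat s (adj_mat L))"
        using Ls x by (intro mult_smult_distrib) auto
      ultimately show ?thesis unfolding h1 by simp
    qed
    have ev: "eval_mat 0 L = g" "eval_mat 1 L = g'"
      unfolding L_def using eval_line_mat_0 eval_line_mat_1 g(2) g'(2) by auto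
    have D01: "poly D 0 \<noteq> 0" "poly D 1 \<noteq> 0"
      using g(1) g'(1) unfolding D_def det_eval_mat[symmetric] ev borel_iff by auto
    have "\<gamma> 0 = y" "\<gamma> 1 = y'"
      using eval[of 0 h] eval[of 1 h'] D01 g g' ev by auto
    moreover have "rat (\<lambda>s. \<gamma> s $$ (i, j))" if "i < n" "j < n" for i j
      using that D01 rat_divide[OF rat_poly rat_poly, of D "M $$ (i, j)"] by (simp add: \<gamma>_def)
    moreover have "\<gamma> s \<in> borel_orbit n x" if s: "poly D s \<noteq> 0" for s
    proof -
      have Ls: "eval_mat s L \<in> carrier_mat n n" using L by simp
      have "upper_triangular (eval_mat s L)"
        unfolding L_def
      proof (rule upper_triangularI)
        fix i j assume "j < i" "i < dim_row (eval_mat s (line_mat n g g'))"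
        then have ij: "j < i" "i < n" "j < n" by (auto simp: line_mat_def)
        then have "g $$ (i, j) = 0" "g' $$ (i, j) = 0"
          using g(1,2) g'(1,2) unfolding borel_iff by (auto dest: upper_triangularD)
        then show "eval_mat s (line_mat n g g') $$ (i, j) = 0" unfolding eval_line_mat[OF ij(2,3)] by simp
      qed
      moreover have d: "det (eval_mat s L) \<noteq> 0" using s unfolding det_eval_mat D_def .
      ultimately have "eval_mat s L \<in> borel n" unfolding borel_iff using Ls by blast
      moreover obtain h1 where h1: "h1 \<in> carrier_mat n n" "eval_mat s L * h1 = 1\<^sub>m n" "h1 * eval_mat s L = 1\<^sub>m n"
        using det_nonzero_inverse[OF Ls d] by blast
      ultimately show ?thesis using eval[OF s h1(1,3)] unfolding borel_orbit_def by blast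
    qed
    moreover have "D \<noteq> 0" using D01 by auto
    ultimately show "\<exists>\<gamma> q. (\<forall>i<n. \<forall>j<n. rat (\<lambda>s. \<gamma> s $$ (i, j))) \<and> \<gamma> 0 = y \<and> \<gamma> 1 = y' \<and> q \<noteq> 0 \<and>
        (\<forall>s. poly q s \<noteq> 0 \<longrightarrow> \<gamma> s \<in> borel_orbit n x)"
      by (intro exI[of _ \<gamma>] exI[of _ D]) auto
  qed
qed

text \<open>The number of independent polynomial functions of bounded degree on an orbit is lower
  semicontinuous in the base point: on the line from \<open>x0\<close> to \<open>x1\<close> a nonzero
  evaluation determinant stays nonzero for almost all parameters.\<close>

lemma has_indep_orbit_semicontinuous:
  fixes x0 x1 :: "'k::field mat"
  assumes inf: "infinite (UNIV :: 'k set)"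
    and x0: "x0 \<in> coord_space n X" and x1: "x1 \<in> coord_space n X" and Q: "Q \<in> poly_fun n" "Q x1 \<noteq> 0"
    and ind: "has_indep (borel_orbit n x0) (pdegn n m) R"
  shows "\<exists>x\<in>coord_space n X. Q x \<noteq> 0 \<and> has_indep (borel_orbit n x) (pdegn n m) R"
proof -
  have c: "x0 \<in> carrier_mat n n" "x1 \<in> carrier_mat n n" using x0 x1 unfolding coord_space_def by auto
  obtain p where p: "\<And>i. i < R \<Longrightarrow> pdegn n m (p i)" "lin_indep_on (borel_orbit n x0) R p"
    using ind unfolding has_indep_def by blast
  obtain y where y: "\<And>j. j < R \<Longrightarrow> y j \<in> borel_orbit n x0" "det (mat R R (\<lambda>(i, j). p i (y j))) \<noteq> 0"
    using indep_det_points[OF p(2)] by blast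
  have "\<forall>j. \<exists>g h. j < R \<longrightarrow> g \<in> borel n \<and> g \<in> carrier_mat n n \<and> h \<in> carrier_mat n n \<and> g * h = 1\<^sub>m n \<and>
      h * g = 1\<^sub>m n \<and> y j = g * x0 * h"
    using y(1) borel_orbitE[OF _ c(1)] by metis
  then obtain g h where gh: "\<And>j. j < R \<Longrightarrow> g j \<in> borel n \<and> g j \<in> carrier_mat n n \<and> h j \<in> carrier_mat n n \<and>
      g j * h j = 1\<^sub>m n \<and> h j * g j = 1\<^sub>m n \<and> y j = g j * x0 * h j"
    by metis
  define L where "L = line_mat n x0 x1"
  define K where "K = (\<lambda>j. map_mat (\<lambda>a. [:a:]) (g j) * L * map_mat (\<lambda>a. [:a:]) (h j))"
  have L: "L \<in> carrier_mat n n" unfolding L_def by simp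
  have K: "K j \<in> carrier_mat n n" and evK: "eval_mat s (K j) = g j * eval_mat s L * h j" if "j < R" for j s
    using gh[OF that] L unfolding K_def by (auto simp: eval_mat_mult[of _ n] eval_const_mat)
  have "\<forall>i j. \<exists>q. i < R \<longrightarrow> j < R \<longrightarrow> (\<forall>s. p i (eval_mat s (K j)) = poly q s)"
    using poly_fun_eval_mat[OF pdeg_imp_poly_fun[OF p(1) subset_refl] K] by blast
  then obtain q where q: "\<And>i j s. i < R \<Longrightarrow> j < R \<Longrightarrow> p i (eval_mat s (K j)) = poly (q i j) s" by metis
  define E where "E = det (mat R R (\<lambda>(i, j). q i j))"
  have E: "poly E s = det (mat R R (\<lambda>(i, j). p i (g j * eval_mat s L * h j)))" for s
    unfolding E_def det_eval_mat[symmetric]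
    by (intro arg_cong[of _ _ det] eq_matI) (auto simp: q[symmetric] evK)
  have ev: "eval_mat 0 L = x0" "eval_mat 1 L = x1"
    unfolding L_def using eval_line_mat_0 eval_line_mat_1 c by auto
  have "mat R R (\<lambda>(i, j). p i (g j * eval_mat 0 L * h j)) = mat R R (\<lambda>(i, j). p i (y j))"
    unfolding ev using gh by (intro eq_matI) auto
  then have "poly E 0 \<noteq> 0" unfolding E using y(2) by simp
  then have "E \<noteq> 0" by auto
  obtain r where r: "\<And>s. Q (eval_mat s L) = poly r s" using poly_fun_eval_mat[OF Q(1) L] by blast
  have "r \<noteq> 0" using r[of 1] Q(2) ev by auto
  then obtain s where s: "poly (E * r) s \<noteq> 0"
    using poly_nonroot_ex[OF inf, of "E * r"] \<open>E \<noteq> 0\<close> by auto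
  let ?x = "eval_mat s L"
  have "?x $$ (i, j) = 0" if "i < n" "j < n" "(i, j) \<notin> X" for i j
    using that x0 x1 unfolding L_def eval_line_mat[OF that(1,2)] coord_space_def by auto
  then have xX: "?x \<in> coord_space n X" unfolding coord_space_def using L by auto
  have "lin_indep_on (borel_orbit n ?x) R p"
  proof (rule det_points_indep[of R "\<lambda>j. g j * ?x * h j"])
    show "g j * ?x * h j \<in> borel_orbit n ?x" if "j < R" for j
      using gh[OF that] unfolding borel_orbit_def by blast
    show "det (mat R R (\<lambda>(i, j). p i (g j * ?x * h j))) \<noteq> 0" using s unfolding E[symmetric] by auto
  qed
  then have "has_indep (borel_orbit n ?x) (pdegn n m) R" unfolding has_indep_def using p(1) by blast
  moreover have "Q ?x \<noteq> 0" using s r by auto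
  ultimately show ?thesis using xX by blast
qed

section \<open>Normal forms\<close>

definition nxt :: "nat \<Rightarrow> nat set \<Rightarrow> nat \<Rightarrow> nat \<Rightarrow> bool" where
  "nxt n P i j \<longleftrightarrow> i < j \<and> j < n \<and> (i \<in> P \<longleftrightarrow> j \<in> P) \<and> (\<forall>l. i < l \<and> l < j \<longrightarrow> (l \<in> P) \<noteq> (i \<in> P))"

lemma nxt_less: "nxt n P i j \<Longrightarrow> i < j \<and> j < n"
  unfolding nxt_def by blast

lemma nxt_unique_right: "nxt n P i j \<Longrightarrow> nxt n P i j' \<Longrightarrow> j = j'"
  unfolding nxt_def by (metis linorder_neqE_nat)

lemma nxt_unique_left: "nxt n P i j \<Longrightarrow> nxt n P i' j \<Longrightarrow> i = i'"
  unfolding nxt_def by (metis linorder_neqE_nat)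

lemma the_nxt: "nxt n P i j \<Longrightarrow> (THE j. nxt n P i j) = j"
  by (rule the_equality) (auto intro: nxt_unique_right)

lemma nxt_ex_right:
  assumes "i < j" "j < n" "i \<in> P \<longleftrightarrow> j \<in> P"
  shows "\<exists>u\<le>j. nxt n P i u"
proof -
  let ?p = "\<lambda>u. i < u \<and> (u \<in> P \<longleftrightarrow> i \<in> P)"
  define u where "u = Least ?p"
  have pj: "?p j" using assms by simp
  have u: "?p u" unfolding u_def by (rule LeastI[of ?p, OF pj])
  have uj: "u \<le> j" unfolding u_def by (rule Least_le[of ?p, OF pj])
  have "\<not> ?p l" if "l < u" for l using that unfolding u_def by (rule not_less_Least)
  then have "nxt n P i u" unfolding nxt_def using u uj assms(2) by auto
  then show ?thesis using uj by blast
qed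

lemma nxt_ex_left:
  assumes "i < j" "j < n" "i \<in> P \<longleftrightarrow> j \<in> P"
  shows "\<exists>u\<ge>i. nxt n P u j"
  using assms
proof (induction "j - i" arbitrary: i rule: less_induct)
  case less
  obtain u where u: "u \<le> j" "nxt n P i u" using nxt_ex_right[OF less.prems] by blast
  show ?case
  proof (cases "u = j")
    case True
    then show ?thesis using u by blast
  next
    case False
    then have "u < j" "i < u" "u \<in> P \<longleftrightarrow> j \<in> P" using u less.prems unfolding nxt_def by auto
    then obtain v where "v \<ge> u" "nxt n P v j"
      using less.hyps[of u] less.prems diff_less_mono2[of i u j] by auto
    then show ?thesis using \<open>i < u\<close> by (intro exI[of _ v]) auto
  qed
qed

section \<open>A triangular basis with polynomial entries\<close>

definition mulv :: "nat \<Rightarrow> 'k::field mat \<Rightarrow> (nat \<Rightarrow> 'k) \<Rightarrow> nat \<Rightarrow> 'k" where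
  "mulv n A v = (\<lambda>l. if l < n then (\<Sum>j<n. A $$ (l, j) * v j) else 0)"

definition unit_fun :: "nat \<Rightarrow> nat \<Rightarrow> 'k::field" where
  "unit_fun i = (\<lambda>l. if l = i then 1 else 0)"

text \<open>Fraction-free elimination of the entries \<open>k, \<dots>, u - 1\<close> of \<open>v\<close> by vectors \<open>f p\<close>
  whose last nonzero entry is in position \<open>p\<close>.\<close>

definition elim :: "(nat \<Rightarrow> nat \<Rightarrow> 'k::field) \<Rightarrow> nat \<Rightarrow> nat \<Rightarrow> (nat \<Rightarrow> 'k) \<Rightarrow> nat \<Rightarrow> 'k" where
  "elim f k u v = foldr (\<lambda>p w l. f p p * w l - w p * f p l) [k..<u] v"

lemma elim_base: "elim f u u v = v"
  unfolding elim_def by simp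

lemma elim_step:
  "k < u \<Longrightarrow> elim f k u v = (\<lambda>l. f k k * elim f (Suc k) u v l - elim f (Suc k) u v k * f k l)"
  unfolding elim_def by (simp add: upt_conv_Cons)

lemma elim_support:
  assumes "k \<le> u" "\<And>p l. k \<le> p \<Longrightarrow> p < u \<Longrightarrow> p < l \<Longrightarrow> f p l = 0" "\<And>l. u \<le> l \<Longrightarrow> v l = 0" "k \<le> l"
  shows "elim f k u v l = 0"
  using assms(1,2,4)
proof (induction arbitrary: l rule: inc_induct)
  case base
  then show ?case using assms(3) by (simp add: elim_base)
next
  case (step k)
  have IH: "elim f (Suc k) u v m = 0" if "Suc k \<le> m" for m using step.IH[of m] step.prems(1) that by auto
  show ?case
  proof (cases "l = k")
    case True
    then show ?thesis using step.hyps by (simp add: elim_step)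
  next
    case False
    then have "k < l" using step.prems by simp
    then show ?thesis using step.hyps IH[of l] step.prems(1)[of k l] by (simp add: elim_step)
  qed
qed

text \<open>Every fraction-free step multiplies the vector by its pivot, so the product of the
  pivots accumulates; \<open>colead\<close> later divides it out.\<close>

lemma elim_linear:
  assumes "k \<le> u"
  shows "\<exists>\<zeta>. \<forall>l. elim f k u v l = (\<Prod>p\<in>{k..<u}. f p p) * v l - (\<Sum>p\<in>{k..<u}. \<zeta> p * f p l)"
  using assms
proof (induction rule: inc_induct)
  case base
  then show ?case by (auto simp: elim_base)
next
  case (step k)
  then obtain \<zeta> where \<zeta>: "\<And>l. elim f (Suc k) u v l = (\<Prod>p\<in>{Suc k..<u}. f p p) * v l - (\<Sum>p\<in>{Suc k..<u}. \<zeta> p * f p l)"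
    by blast
  have split: "{k..<u} = insert k {Suc k..<u}" using step.hyps by auto
  let ?z = "\<lambda>p. if p = k then elim f (Suc k) u v k else f k k * \<zeta> p"
  have "elim f k u v l = (\<Prod>p\<in>{k..<u}. f p p) * v l - (\<Sum>p\<in>{k..<u}. ?z p * f p l)" for l
  proof -
    have "(\<Sum>p\<in>{k..<u}. ?z p * f p l) = elim f (Suc k) u v k * f k l + f k k * (\<Sum>p\<in>{Suc k..<u}. \<zeta> p * f p l)"
      unfolding split by (simp add: sum_distrib_left mult.assoc)
    moreover have "(\<Prod>p\<in>{k..<u}. f p p) = f k k * (\<Prod>p\<in>{Suc k..<u}. f p p)" unfolding split by simp
    ultimately show ?thesis
      using step.hyps(2) unfolding elim_step[OF step.hyps(2)] \<zeta>[of l] by (simp add: algebra_simps)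
  qed
  then show ?case by (intro exI[of _ ?z] allI)
qed

lemma elim_cong:
  assumes "k \<le> u" "r \<le> k" "\<And>p l. k \<le> p \<Longrightarrow> p < u \<Longrightarrow> r \<le> l \<Longrightarrow> f p l = f' p l" "\<And>l. r \<le> l \<Longrightarrow> v l = v' l" "r \<le> l"
  shows "elim f k u v l = elim f' k u v' l"
  using assms(1,2,3,5)
proof (induction arbitrary: l rule: inc_induct)
  case base
  then show ?case using assms(4) by (simp add: elim_base)
next
  case (step k)
  have "elim f (Suc k) u v m = elim f' (Suc k) u v' m" if "r \<le> m" for m
    using step.IH[of m] step.prems that by auto
  then show ?case using step.hyps step.prems by (simp add: elim_step)
qed

lemma elim_unit:
  assumes "k \<le> u" "\<And>p. k \<le> p \<Longrightarrow> p < u \<Longrightarrow> f p = unit_fun p"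
  shows "elim f k u v = (\<lambda>l. if k \<le> l \<and> l < u then 0 else v l)"
  using assms
proof (induction rule: inc_induct)
  case base
  then show ?case by (auto simp: elim_base fun_eq_iff)
next
  case (step k)
  have "elim f (Suc k) u v = (\<lambda>l. if Suc k \<le> l \<and> l < u then 0 else v l)"
    using step.IH step.prems by auto
  then have "elim f k u v l = (if k \<le> l \<and> l < u then 0 else v l)" for l
    using step.hyps step.prems[of k] by (cases "l = k") (auto simp: elim_step unit_fun_def)
  then show ?case by blast
qed

lemma elim_poly_fun:
  assumes "k \<le> u" "\<And>p l. k \<le> p \<Longrightarrow> p < u \<Longrightarrow> (\<lambda>A. f A p l) \<in> poly_fun n" "\<And>l. (\<lambda>A. v A l) \<in> poly_fun n"
  shows "(\<lambda>A. elim (f A) k u (v A) l) \<in> poly_fun n"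
  using assms(1,2)
proof (induction arbitrary: l rule: inc_induct)
  case base
  then show ?case using assms(3) by (simp add: elim_base)
next
  case (step k)
  have IH: "(\<lambda>A. elim (f A) (Suc k) u (v A) m) \<in> poly_fun n" for m
    using step.IH[of m] step.prems by auto
  have f: "(\<lambda>A. f A k m) \<in> poly_fun n" for m using step.prems[of k m] step.hyps by auto
  have "(\<lambda>A. f A k k * elim (f A) (Suc k) u (v A) l + (-1) * (elim (f A) (Suc k) u (v A) k * f A k l)) \<in> poly_fun n"
    by (intro poly_fun.add poly_fun.mult IH f poly_fun.const)
  then show ?case using step.hyps by (simp add: elim_step)
qed

text \<open>The vectors of the triangular basis, up to scaling and up to correction by vectors of class \<open>P\<close>,
  as polynomials in the entries of the matrix.\<close>

function bv :: "nat \<Rightarrow> nat set \<Rightarrow> 'k::field mat \<Rightarrow> nat \<Rightarrow> nat \<Rightarrow> 'k" where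
  "bv n P A i = (if \<exists>j. nxt n P i j then
      (if i \<in> P then mulv n A (bv n P A (THE j. nxt n P i j))
       else foldr (\<lambda>p w l. bv n P A p p * w l - w p * bv n P A p l) [Suc i..<(THE j. nxt n P i j)]
          (mulv n A (bv n P A (THE j. nxt n P i j))))
    else unit_fun i)"
  by auto
termination
  by (relation "measure (\<lambda>(n, P, A, i). n - i)") (auto simp: the_nxt intro!: diff_less_mono2 dest: nxt_less)

declare bv.simps [simp del]

lemma bv_top: "\<nexists>j. nxt n P i j \<Longrightarrow> bv n P A i = unit_fun i"
  by (subst bv.simps) (simp only: if_False)

lemma bv_P: "nxt n P i j \<Longrightarrow> i \<in> P \<Longrightarrow> bv n P A i = mulv n A (bv n P A j)"
  by (subst bv.simps) (auto simp: the_nxt)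

text \<open>The definition of \<open>bv\<close> spells out the fold so that the recursive calls are
  visibly made at list members, as termination requires; here the fold is recognised as
  \<open>elim\<close>.\<close>

lemma bv_C: "nxt n P i j \<Longrightarrow> i \<notin> P \<Longrightarrow> bv n P A i = elim (bv n P A) (Suc i) j (mulv n A (bv n P A j))"
  by (subst bv.simps) (auto simp: the_nxt elim_def)

lemma bv_cases [case_names top P C]:
  obtains "\<nexists>j. nxt n P i j" | j where "nxt n P i j" "i \<in> P" | j where "nxt n P i j" "i \<notin> P"
  by blast

lemma mulv_poly_fun:
  assumes "\<And>l. (\<lambda>A. v A l) \<in> poly_fun n"
  shows "(\<lambda>A. mulv n A (v A) l) \<in> poly_fun n"
proof (cases "l < n")
  case True
  have "(\<lambda>A. \<Sum>j\<in>S. A $$ (l, j) * v A j) \<in> poly_fun n" if "finite S" "S \<subseteq> {..<n}" for S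
    using that by (induction S) (auto intro!: poly_fun.intros assms True)
  from this[of "{..<n}"] show ?thesis using True by (simp add: mulv_def)
qed (simp add: mulv_def poly_fun.const)

lemma bv_poly_fun: "(\<lambda>A :: 'k::field mat. bv n P A i l) \<in> poly_fun n"
proof (induction "n - i" arbitrary: i l rule: less_induct)
  case less
  have IH: "(\<lambda>A :: 'k mat. bv n P A p m) \<in> poly_fun n" if "i < p" "p < n" for p m
    by (rule less) (use that in auto)
  show ?case
  proof (cases n P i rule: bv_cases)
    case top
    then show ?thesis by (simp add: bv_top poly_fun.const)
  next
    case (P j)
    then show ?thesis unfolding bv_P[OF P] by (intro mulv_poly_fun IH) (auto simp: nxt_def)
  next
    case (C j)
    then show ?thesis unfolding bv_C[OF C] by (intro elim_poly_fun mulv_poly_fun IH) (auto simp: nxt_def)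
  qed
qed

lemma mulv_add: "mulv n A (\<lambda>l. v l + w l) = (\<lambda>l. mulv n A v l + mulv n A w l)"
  by (auto simp: mulv_def algebra_simps sum.distrib)

lemma mulv_scale: "mulv n A (\<lambda>l. c * v l) = (\<lambda>l. c * mulv n A v l)"
  by (auto simp: mulv_def algebra_simps sum_distrib_left)

lemma mulv_zero: "mulv n A (\<lambda>l. 0) = (\<lambda>l. 0)"
  by (auto simp: mulv_def)

text \<open>\<open>I\<close> contains the 0-based rows whose superdiagonal entry is allowed. An
  index outside \<open>P\<close> is outside \<open>I\<close>, so its upper neighbour is in
  \<open>P\<close>: the complement has no two neighbours, and steps inside \<open>P\<close> have
  length at most two. The colour above \<open>Max I\<close> is fixed so that the last element of
  \<open>I\<close> contributes no parameter.\<close>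

locale colouring =
  fixes n :: nat and I P :: "nat set"
  assumes I_bound: "i \<in> I \<Longrightarrow> Suc i < n"
    and P_bound: "i \<in> P \<Longrightarrow> i < n"
    and I_P: "i \<in> I \<Longrightarrow> i \<in> P"
    and alternate: "i \<notin> I \<Longrightarrow> Suc i < n \<Longrightarrow> (i \<in> P \<longleftrightarrow> Suc i \<notin> P)"
    and top_I: "I \<noteq> {} \<Longrightarrow> Suc (Max I) \<in> P"
begin

text \<open>At these rows the superdiagonal entry maps the complement into \<open>P\<close> and
  belongs to neither descent. They are the lower ends of the even gaps, see
  \<open>J_iff_even_gap\<close>.\<close>

definition J :: "nat set" where
  "J = {a \<in> I. Suc a \<notin> P}"

definition X :: "(nat \<times> nat) set" where
  "X = {(i, j). j < n \<and> (Suc i < j \<or> j = Suc i \<and> i \<in> I)}"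

abbreviation N :: "'k::field mat set" where
  "N \<equiv> coord_space n X"

lemma finite_I: "finite I"
  using I_bound by (meson Suc_lessD bounded_nat_set_is_finite)

lemma finite_J: "finite J"
  using finite_I unfolding J_def by simp

lemma finite_P: "finite P"
  using P_bound bounded_nat_set_is_finite by blast

lemma X_subset: "X \<subseteq> all_pos n"
  unfolding X_def by auto

lemma N_entry: "A \<in> N \<Longrightarrow> i < n \<Longrightarrow> j < n \<Longrightarrow> (i, j) \<notin> X \<Longrightarrow> A $$ (i, j) = 0"
  unfolding coord_space_def by blast

lemma N_carrier: "A \<in> N \<Longrightarrow> A \<in> carrier_mat n n"
  unfolding coord_space_def by blast

lemma nxt_P:
  assumes "nxt n P i j" "i \<in> P"
  shows "j = Suc i \<and> i \<in> I \<or> j = Suc (Suc i) \<and> Suc i \<notin> P"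
proof (cases "Suc i \<in> P")
  case True
  then have "Suc i < n" by (rule P_bound)
  then have "i \<in> I" using True assms(2) alternate by blast
  moreover have "j = Suc i" using assms True unfolding nxt_def by (metis Suc_lessI lessI)
  ultimately show ?thesis by blast
next
  case False
  have j: "i < j" "j < n" "j \<in> P" "\<And>l. i < l \<Longrightarrow> l < j \<Longrightarrow> l \<notin> P" using assms unfolding nxt_def by auto
  then have "j \<noteq> Suc i" using False by blast
  then have "Suc (Suc i) \<le> j" using j(1) by simp
  moreover have "Suc (Suc i) \<in> P" using False alternate[of "Suc i"] I_P j(2) \<open>Suc (Suc i) \<le> j\<close> by auto
  ultimately have "j = Suc (Suc i)" using j(4)[of "Suc (Suc i)"] by (metis le_neq_implies_less less_Suc_eq lessI)
  then show ?thesis using False by blast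
qed

lemma pred_C: "c \<notin> P \<Longrightarrow> c < n \<Longrightarrow> 0 < c \<Longrightarrow> c - 1 \<in> P"
  using alternate[of "c - 1"] I_P[of "c - 1"] by auto

lemma succ_C: "c \<notin> P \<Longrightarrow> Suc c < n \<Longrightarrow> Suc c \<in> P"
  using alternate[of c] I_P by auto

text \<open>\<open>Suc a\<close> is outside \<open>P\<close>, whereas both \<open>Max I\<close> and
  \<open>Suc (Max I)\<close> are in it.\<close>

lemma J_less_Max: "a \<in> J \<Longrightarrow> Suc (Suc a) \<le> Max I"
proof -
  assume a: "a \<in> J"
  then have "a \<in> I" "Suc a \<notin> P" unfolding J_def by auto
  then have "I \<noteq> {}" "a \<le> Max I" using finite_I by auto
  moreover have "Max I \<in> P" using I_P Max_in finite_I \<open>I \<noteq> {}\<close> by blast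
  ultimately show ?thesis
    using top_I \<open>Suc a \<notin> P\<close> by (metis Suc_leI le_neq_implies_less)
qed

lemma J_facts:
  assumes "a \<in> J"
  shows "a \<in> I" "a \<in> P" "Suc a \<notin> P" "Suc (Suc a) \<in> P" "Suc (Suc a) < n" "nxt n P a (Suc (Suc a))"
proof -
  show a: "a \<in> I" "Suc a \<notin> P" using assms unfolding J_def by auto
  show "a \<in> P" using a I_P by blast
  have "I \<noteq> {}" using a by blast
  then have "Max I \<in> I" using finite_I Max_in by blast
  then show lt: "Suc (Suc a) < n" using J_less_Max[OF assms] I_bound by fastforce
  then show "Suc (Suc a) \<in> P" using succ_C[OF a(2)] by blast
  then show "nxt n P a (Suc (Suc a))"
    unfolding nxt_def using a(2) lt \<open>a \<in> P\<close> by (auto simp: less_Suc_eq)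
qed

lemma X_up: "(k, l) \<in> X \<Longrightarrow> i \<le> k \<Longrightarrow> l \<le> j \<Longrightarrow> j < n \<Longrightarrow> (i, j) \<in> X"
  unfolding X_def by (auto simp: le_eq_less_or_eq)

text \<open>A step of one within a class occurs only at an element of \<open>I\<close>, so the
  descent uses entries that the ideal allows.\<close>

lemma nxt_X: "nxt n P i j \<Longrightarrow> (i, j) \<in> X"
proof -
  assume nx: "nxt n P i j"
  then have ij: "i < j" "j < n" "i \<in> P \<longleftrightarrow> j \<in> P" unfolding nxt_def by auto
  show ?thesis
  proof (cases "i \<in> P")
    case True
    then show ?thesis using nxt_P[OF nx] ij unfolding X_def by auto
  next
    case False
    then have "j \<noteq> Suc i" using succ_C[of i] ij by auto
    then show ?thesis using ij unfolding X_def by auto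
  qed
qed

lemma mulv_support:
  assumes "A \<in> N" "\<And>l. u < l \<Longrightarrow> v l = 0" "u \<le> l \<or> Suc l = u \<and> l \<notin> I"
  shows "mulv n A v l = 0"
proof -
  have "A $$ (l, j) * v j = 0" if "l < n" "j < n" for j
  proof (cases "u < j")
    case False
    then have "(l, j) \<notin> X" using assms(3) unfolding X_def by auto
    then show ?thesis using N_entry[OF assms(1) that] by simp
  qed (use assms(2) in simp)
  then show ?thesis by (auto simp: mulv_def simp del: mult_eq_0_iff intro!: sum.neutral)
qed

lemma bv_support:
  assumes "A \<in> N"
  shows "i < l \<Longrightarrow> bv n P A i l = 0"
proof (induction "n - i" arbitrary: i l rule: less_induct)
  case less
  have IH: "bv n P A p m = 0" if "i < p" "p < n" "p < m" for p m
    using less.hyps[of p m] that by auto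
  show ?case
  proof (cases n P i rule: bv_cases)
    case top
    then show ?thesis using less.prems by (simp add: bv_top unit_fun_def)
  next
    case (P j)
    then have j: "i < j" "j < n" unfolding nxt_def by auto
    show ?thesis
    proof (cases "j \<le> l")
      case True
      then show ?thesis unfolding bv_P[OF P] using IH[OF j] by (intro mulv_support[OF assms, of j]) auto
    next
      \<comment> \<open>A step of two inside \<open>P\<close> skips an index outside
        \<open>I\<close>, and the superdiagonal entry in the skipped row is zero.\<close>
      case False
      then have "j = Suc (Suc i)" "Suc i \<notin> P" "l = Suc i" using nxt_P[OF P] less.prems by auto
      then show ?thesis unfolding bv_P[OF P] using IH[OF j] I_P
        by (intro mulv_support[OF assms, of j]) auto
    qed
  next
    case (C j)
    then have j: "i < j" "j < n" unfolding nxt_def by auto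
    then show ?thesis unfolding bv_C[OF C] using IH less.prems
      by (intro elim_support mulv_support[OF assms, of j]) auto
  qed
qed

text \<open>By strict upper triangularity a coordinate of the image reads only later coordinates, so
  nothing above row \<open>r\<close> enters. This later makes the relations between the parameters
  triangular.\<close>

lemma bv_row_cong:
  assumes "A \<in> N" "B \<in> N" "\<And>i j. r \<le> i \<Longrightarrow> i < n \<Longrightarrow> j < n \<Longrightarrow> A $$ (i, j) = B $$ (i, j)"
  shows "r \<le> l \<Longrightarrow> bv n P A i l = bv n P B i l"
proof (induction "n - i" arbitrary: i l rule: less_induct)
  case less
  have IH: "bv n P A p m = bv n P B p m" if "i < p" "p < n" "r \<le> m" for p m
    using less.hyps[of p m] that by auto
  have mul: "mulv n A (bv n P A p) m = mulv n B (bv n P B p) m" if "i < p" "p < n" "r \<le> m" for p m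
  proof -
    have "A $$ (m, j) * bv n P A p j = B $$ (m, j) * bv n P B p j" if "m < n" "j < n" for j
    proof (cases "m < j")
      case True
      then show ?thesis using IH[of p j] assms(3)[of m j] \<open>i < p\<close> \<open>p < n\<close> \<open>r \<le> m\<close> that by simp
    next
      case False
      then have "(m, j) \<notin> X" unfolding X_def by auto
      then show ?thesis using N_entry[OF assms(1) that] N_entry[OF assms(2) that] by simp
    qed
    then show ?thesis by (auto simp: mulv_def intro!: sum.cong)
  qed
  show ?case
  proof (cases n P i rule: bv_cases)
    case top
    then show ?thesis by (simp add: bv_top)
  next
    case (P j)
    then show ?thesis unfolding bv_P[OF P] using mul[of j l] less.prems by (auto simp: nxt_def)
  next
    case (C j)
    then have j: "i < j" "j < n" unfolding nxt_def by auto
    show ?thesis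
    proof (cases "i < l")
      case True
      then show ?thesis using bv_support[OF assms(1)] bv_support[OF assms(2)] by simp
    next
      case False
      then show ?thesis unfolding bv_C[OF C] using IH mul j less.prems
        by (intro elim_cong[where r = r]) auto
    qed
  qed
qed

definition nf :: "(nat \<Rightarrow> 'k::field) \<Rightarrow> 'k mat" where
  "nf \<alpha> = mat n n (\<lambda>(i, j). if nxt n P i j then 1 else if i \<in> J \<and> j = Suc i then \<alpha> i else 0)"

lemma nf_carrier: "nf \<alpha> \<in> carrier_mat n n"
  unfolding nf_def by simp

lemma nf_N: "nf \<alpha> \<in> N"
  unfolding coord_space_def using nxt_X J_facts(1)
  by (auto simp: nf_def X_def)

lemma nf_cong: "(\<And>a. a \<in> J \<Longrightarrow> \<alpha> a = \<beta> a) \<Longrightarrow> nf \<alpha> = nf \<beta>"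
  unfolding nf_def by (intro eq_matI) auto

lemma not_nxt_J: "a \<in> J \<Longrightarrow> \<not> nxt n P a (Suc a)"
  using J_facts unfolding nxt_def by blast

lemma nf_entry:
  "i < n \<Longrightarrow> j < n \<Longrightarrow> nf \<alpha> $$ (i, j) = (if nxt n P i j then 1 else 0) + (if i \<in> J \<and> j = Suc i then \<alpha> i else 0)"
  unfolding nf_def using not_nxt_J by auto

lemma mulv_unit: "u < n \<Longrightarrow> mulv n A (unit_fun u) = (\<lambda>l. if l < n then A $$ (l, u) else 0)"
  by (simp add: mulv_def unit_fun_def fun_eq_iff if_distrib[where f = "\<lambda>x. _ * x"] sum.delta cong: if_cong)

text \<open>A normal form has the standard basis as its triangular basis, so its leading
  coefficients are one and its parameters can be read off.\<close>

lemma bv_nf: "i < n \<Longrightarrow> bv n P (nf \<alpha>) i = unit_fun i"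
proof (induction "n - i" arbitrary: i rule: less_induct)
  case less
  have IH: "bv n P (nf \<alpha>) p = unit_fun p" if "i < p" "p < n" for p
    using less.hyps[of p] that by auto
  show ?case
  proof (cases n P i rule: bv_cases)
    case top
    then show ?thesis by (simp add: bv_top)
  next
    case (P j)
    then have j: "i < j" "j < n" "j \<in> P" unfolding nxt_def by auto
    have "(if l < n then nf \<alpha> $$ (l, j) else 0) = unit_fun i l" for l
    proof (cases "l < n")
      case True
      have "nxt n P l j \<longleftrightarrow> l = i" using P(1) nxt_unique_left by blast
      moreover have "\<not> (l \<in> J \<and> j = Suc l)" using j(3) J_facts(3) by blast
      ultimately show ?thesis using True nf_entry[OF True j(2), of \<alpha>] by (cases "l = i") (auto simp: unit_fun_def)
    qed (use j in \<open>simp add: unit_fun_def\<close>)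
    then show ?thesis unfolding bv_P[OF P] IH[OF j(1,2)] mulv_unit[OF j(2)] by auto
  next
    case (C j)
    then have j: "i < j" "j < n" unfolding nxt_def by auto
    have "(if Suc i \<le> l \<and> l < j then 0 else if l < n then nf \<alpha> $$ (l, j) else 0) = unit_fun i l" for l
    proof (cases "l < n \<and> \<not> (Suc i \<le> l \<and> l < j)")
      case True
      have "nxt n P l j \<longleftrightarrow> l = i" using C(1) nxt_unique_left by blast
      moreover have "\<not> (l \<in> J \<and> j = Suc l)"
      proof
        assume l: "l \<in> J \<and> j = Suc l"
        then have "l = i" using True j by linarith
        then show False using l C(2) J_facts(2) by blast
      qed
      ultimately show ?thesis using True nf_entry[of l j \<alpha>] j(2) by (cases "l = i") (auto simp: unit_fun_def)
    qed (use j in \<open>auto simp: unit_fun_def\<close>)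
    moreover have "elim (bv n P (nf \<alpha>)) (Suc i) j v = (\<lambda>l. if Suc i \<le> l \<and> l < j then 0 else v l)" for v
      by (rule elim_unit) (use j IH in auto)
    ultimately show ?thesis unfolding bv_C[OF C] IH[OF j] mulv_unit[OF j(2)] by auto
  qed
qed

end

section \<open>Reduction of a generic matrix to normal form\<close>

inductive_set bspan :: "(nat \<Rightarrow> nat \<Rightarrow> 'k::field) \<Rightarrow> nat set \<Rightarrow> (nat \<Rightarrow> 'k) set"
  for f :: "nat \<Rightarrow> nat \<Rightarrow> 'k" and S :: "nat set" where
  zero: "(\<lambda>l. 0) \<in> bspan f S"
| add: "v \<in> bspan f S \<Longrightarrow> p \<in> S \<Longrightarrow> (\<lambda>l. c * f p l + v l) \<in> bspan f S"

lemma bspan_mono: "v \<in> bspan f S \<Longrightarrow> S \<subseteq> S' \<Longrightarrow> v \<in> bspan f S'"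
  by (induction rule: bspan.induct) (auto intro: bspan.intros)

lemma bspan_add: "v \<in> bspan f S \<Longrightarrow> w \<in> bspan f S \<Longrightarrow> (\<lambda>l. v l + w l) \<in> bspan f S"
proof (induction rule: bspan.induct)
  case (add v p c)
  then show ?case using bspan.add[of "\<lambda>l. v l + w l" f S p c] by (simp add: add.assoc)
qed simp

lemma bspan_scale: "v \<in> bspan f S \<Longrightarrow> (\<lambda>l. c * v l) \<in> bspan f S"
proof (induction rule: bspan.induct)
  case (add v p d)
  then show ?case using bspan.add[of "\<lambda>l. c * v l" f S p "c * d"] by (simp add: algebra_simps)
qed (simp add: bspan.zero)

lemma bspan_sum: "finite F \<Longrightarrow> F \<subseteq> S \<Longrightarrow> (\<lambda>l. \<Sum>p\<in>F. c p * f p l) \<in> bspan f S"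
proof (induction F rule: finite_induct)
  case (insert p F)
  then show ?case using bspan.add[of "\<lambda>l. \<Sum>p\<in>F. c p * f p l" f S p "c p"] by simp
qed (simp add: bspan.zero)

lemma bspan_support: "v \<in> bspan f S \<Longrightarrow> (\<And>p. p \<in> S \<Longrightarrow> f p l = 0) \<Longrightarrow> v l = 0"
  by (induction rule: bspan.induct) auto

context colouring
begin

definition lead :: "'k::field mat \<Rightarrow> nat \<Rightarrow> 'k" where
  "lead A i = bv n P A i i"

text \<open>Up to a factor common to all \<open>c\<close>, these are the pivots accumulated by the
  eliminations behind \<open>bv n P A c\<close>. Division by them makes the complement descend with
  coefficient one, modulo vectors of class \<open>P\<close>.\<close>

definition colead :: "'k::field mat \<Rightarrow> nat \<Rightarrow> 'k" where
  "colead A c = (\<Prod>p\<in>{p \<in> P. c < p}. lead A p)"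

text \<open>The coefficient of \<open>bv n P A a\<close> in the image of
  \<open>bv n P A (Suc a)\<close> divided by \<open>colead A (Suc a)\<close>, found by comparing
  coordinate \<open>a\<close>.\<close>

definition inv_alpha :: "'k::field mat \<Rightarrow> nat \<Rightarrow> 'k" where
  "inv_alpha A a = A $$ (a, Suc a) * lead A (Suc a) / (lead A a * colead A (Suc a))"

text \<open>The lowest element of \<open>P\<close> is 0 or 1, as the complement has no two
  neighbours. If it is 1, then 0 is outside \<open>I\<close> and the entry \<open>(0, 1)\<close> is
  zero.\<close>

lemma mulv_bottom_P:
  assumes "A \<in> N" "p \<in> P" "\<nexists>i. nxt n P i p"
  shows "mulv n A (bv n P A p) = (\<lambda>l. 0)"
proof
  fix l
  have pn: "p < n" by (rule P_bound[OF assms(2)])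
  have "q \<notin> P" if "q < p" for q using nxt_ex_left[OF that pn] assms(2,3) that by blast
  then have "p \<le> 1"
    using pred_C[of "p - 1"] pn less_imp_diff_less[OF pn, of 1] by (cases "p \<le> 1") auto
  then consider "p \<le> l" | "Suc l = p" "l \<notin> P"
    using \<open>\<And>q. q < p \<Longrightarrow> q \<notin> P\<close> by (cases "p \<le> l") auto
  then show "mulv n A (bv n P A p) l = 0"
  proof cases
    case 1
    then show ?thesis using bv_support[OF assms(1)] by (intro mulv_support[OF assms(1), of p]) auto
  next
    case 2
    then show ?thesis using bv_support[OF assms(1)] I_P by (intro mulv_support[OF assms(1), of p]) auto
  qed
qed

lemma mulv_at_pred:
  assumes "A \<in> N" "0 < c" "c < n"
  shows "mulv n A (bv n P A c) (c - 1) = A $$ (c - 1, c) * lead A c"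
proof -
  have "(\<Sum>j<n. A $$ (c - 1, j) * bv n P A c j) = (\<Sum>j\<in>{c}. A $$ (c - 1, j) * bv n P A c j)"
  proof (rule sum.mono_neutral_right)
    show "\<forall>j\<in>{..<n} - {c}. A $$ (c - 1, j) * bv n P A c j = 0"
    proof
      fix j assume j: "j \<in> {..<n} - {c}"
      show "A $$ (c - 1, j) * bv n P A c j = 0"
      proof (cases "c < j")
        case True
        then show ?thesis using bv_support[OF assms(1)] by simp
      next
        case False
        then have "(c - 1, j) \<notin> X" using j assms(2) unfolding X_def by auto
        then show ?thesis using N_entry[OF assms(1), of "c - 1" j] j assms by simp
      qed
    qed
  qed (use assms in auto)
  then show ?thesis using assms by (simp add: mulv_def lead_def)
qed

text \<open>This reads the elimination backwards. The indices between \<open>i\<close> and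
  \<open>c\<close> are all in \<open>P\<close>; the coefficient at \<open>c - 1\<close> is
  determined by that coordinate, to which all other vectors contribute nothing, and the remaining
  vectors go into \<open>R\<close>.\<close>

lemma mulv_C_decomposition:
  assumes A: "A \<in> N" and nz: "\<And>i. i < n \<Longrightarrow> lead A i \<noteq> 0" and c: "c \<notin> P" "c < n" "0 < c"
  shows "\<exists>R\<in>bspan (bv n P A) {p \<in> P. p < c - 1}.
     ((\<exists>i. nxt n P i c) \<longrightarrow> (\<exists>i. nxt n P i c \<and> (\<forall>l. mulv n A (bv n P A c) l =
        colead A c / colead A i * bv n P A i l + A $$ (c - 1, c) * lead A c / lead A (c - 1) * bv n P A (c - 1) l + R l))) \<and>
     ((\<nexists>i. nxt n P i c) \<longrightarrow> (\<forall>l. mulv n A (bv n P A c) l =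
        A $$ (c - 1, c) * lead A c / lead A (c - 1) * bv n P A (c - 1) l + R l))"
proof -
  let ?f = "bv n P A"
  let ?v = "mulv n A (?f c)"
  \<comment> \<open>Both cases are treated at once: without a predecessor the elimination runs down
    to 0 and leaves the zero vector.\<close>
  obtain k w where kw: "k \<le> c - 1" "\<And>p. k \<le> p \<Longrightarrow> p < c \<Longrightarrow> p \<in> P" "\<And>l. elim ?f k c ?v l = w l"
     "\<And>i. nxt n P i c \<Longrightarrow> k = Suc i \<and> w = ?f i" "\<nexists>i. nxt n P i c \<Longrightarrow> k = 0 \<and> w = (\<lambda>l. 0)"
  proof (cases "\<exists>i. nxt n P i c")
    case True
    then obtain i where i: "nxt n P i c" by blast
    then have iC: "i \<notin> P" "i < c" "\<And>p. i < p \<Longrightarrow> p < c \<Longrightarrow> p \<in> P" using c unfolding nxt_def by auto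
    have "i \<noteq> c - 1" using pred_C[OF c] iC(1) by blast
    show ?thesis
    proof (rule that[of "Suc i" "?f i"])
      show "elim ?f (Suc i) c ?v l = ?f i l" for l using bv_C[OF i iC(1), of A] by simp
      show "Suc i \<le> c - 1" using iC(2) \<open>i \<noteq> c - 1\<close> by linarith
      show "p \<in> P" if "Suc i \<le> p" "p < c" for p using iC(3) that by simp
      show "Suc i = Suc i' \<and> ?f i = ?f i'" if "nxt n P i' c" for i' using nxt_unique_left[OF i that] by simp
      show "Suc i = 0 \<and> ?f i = (\<lambda>l. 0)" if "\<nexists>i. nxt n P i c" using that i by blast
    qed
  next
    case False
    have allP: "p \<in> P" if "p < c" for p using nxt_ex_left[OF that c(2)] False c(1) that by blast
    show ?thesis
    proof (rule that[of 0 "\<lambda>l. 0"])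
      show "elim ?f 0 c ?v l = 0" for l
        by (rule elim_support) (use bv_support[OF A] mulv_support[OF A, of c "?f c"] in auto)
      show "0 = Suc i \<and> (\<lambda>l. 0) = ?f i" if "nxt n P i c" for i using that False by blast
    qed (use allP in auto)
  qed
  define Pi where "Pi = (\<Prod>p\<in>{k..<c}. lead A p)"
  have Pi0: "Pi \<noteq> 0" unfolding Pi_def using nz c(2) by auto
  have "k \<le> c" using kw(1) by linarith
  then obtain \<zeta> where \<zeta>: "\<And>l. w l = Pi * ?v l - (\<Sum>p\<in>{k..<c}. \<zeta> p * ?f p l)"
    using elim_linear[of k c ?f ?v] unfolding kw(3) Pi_def lead_def by blast
  have split: "{k..<c} = insert (c - 1) {k..<c - 1}" using kw(1) c(3) by auto
  have w0: "w (c - 1) = 0"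
  proof (cases "\<exists>i. nxt n P i c")
    case True
    then obtain i where i: "nxt n P i c" by blast
    then have "i < c - 1" using kw(1,4) by auto
    then show ?thesis using kw(4)[OF i] bv_support[OF A] by simp
  qed (use kw(5) in auto)
  have "(\<Sum>p\<in>{k..<c - 1}. \<zeta> p * ?f p (c - 1)) = 0"
    by (rule sum.neutral) (use bv_support[OF A] in auto)
  then have "\<zeta> (c - 1) * lead A (c - 1) = Pi * ?v (c - 1)"
    using \<zeta>[of "c - 1"] w0 unfolding split lead_def by simp
  then have \<zeta>c: "\<zeta> (c - 1) = Pi * (A $$ (c - 1, c) * lead A c / lead A (c - 1))"
    unfolding mulv_at_pred[OF A c(3,2)] using nz[of "c - 1"] c(2) by (simp add: field_simps)
  define R where "R = (\<lambda>l. (1 / Pi) * (\<Sum>p\<in>{k..<c - 1}. \<zeta> p * ?f p l))"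
  have R: "R \<in> bspan ?f {p \<in> P. p < c - 1}"
    unfolding R_def by (intro bspan_scale bspan_sum) (use kw(2) in auto)
  have v: "?v l = w l / Pi + A $$ (c - 1, c) * lead A c / lead A (c - 1) * ?f (c - 1) l + R l" for l
  proof -
    have "Pi * ?v l = w l + \<zeta> (c - 1) * ?f (c - 1) l + (\<Sum>p\<in>{k..<c - 1}. \<zeta> p * ?f p l)"
      using \<zeta>[of l] unfolding split by simp
    also have "\<dots> = Pi * (w l / Pi + A $$ (c - 1, c) * lead A c / lead A (c - 1) * ?f (c - 1) l + R l)"
      unfolding \<zeta>c R_def using Pi0 by (simp add: algebra_simps)
    finally show ?thesis using Pi0 by simp
  qed
  \<comment> \<open>The pivots between \<open>i\<close> and \<open>c\<close> are exactly what
    \<open>colead\<close> gains on the way down.\<close>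
  have co: "colead A c / colead A i = 1 / Pi" if i: "nxt n P i c" for i
  proof -
    have "{p \<in> P. i < p} = {k..<c} \<union> {p \<in> P. c < p}"
      using kw(2) kw(4)[OF i] c(1) nxt_less[OF i] by (auto simp: not_less Suc_le_eq) (metis le_neq_implies_less)
    then have "colead A i = Pi * colead A c"
      unfolding colead_def Pi_def using finite_P by (simp add: prod.union_disjoint Int_def disjoint_iff)
    moreover have "colead A c \<noteq> 0" unfolding colead_def using nz P_bound finite_P by auto
    ultimately show ?thesis by simp
  qed
  show ?thesis
  proof (intro bexI[OF _ R] conjI impI)
    assume "\<exists>i. nxt n P i c"
    then obtain i where i: "nxt n P i c" by blast
    have "?v l = colead A c / colead A i * ?f i l +
        A $$ (c - 1, c) * lead A c / lead A (c - 1) * ?f (c - 1) l + R l" for l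
      using v[of l] kw(4)[OF i] unfolding co[OF i] by simp
    then show "\<exists>i. nxt n P i c \<and> (\<forall>l. ?v l = colead A c / colead A i * ?f i l +
        A $$ (c - 1, c) * lead A c / lead A (c - 1) * ?f (c - 1) l + R l)"
      using i by blast
  next
    assume "\<nexists>i. nxt n P i c"
    then show "\<forall>l. ?v l = A $$ (c - 1, c) * lead A c / lead A (c - 1) * ?f (c - 1) l + R l"
      using v kw(5) by auto
  qed
qed

text \<open>For \<open>p\<close> in \<open>P\<close> below \<open>c - 1\<close> the successor within
  \<open>P\<close> is at most \<open>c - 1\<close>, since \<open>c - 1\<close> is in
  \<open>P\<close>; the basis vector at that successor is a preimage.\<close>

lemma bspan_lift:
  assumes c: "c \<notin> P" "c < n" "0 < c"
    and "w \<in> bspan (bv n P A) {p \<in> P. p < c - 1}"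
  shows "\<exists>z\<in>bspan (bv n P A) {p \<in> P. p < c}. mulv n A z = w"
  using assms(4)
proof (induction rule: bspan.induct)
  case zero
  show ?case using mulv_zero bspan.zero by blast
next
  case (add v p d)
  then obtain z where z: "z \<in> bspan (bv n P A) {p \<in> P. p < c}" "mulv n A z = v" by blast
  have p: "p \<in> P" "p < c - 1" using add by auto
  obtain j where j: "j \<le> c - 1" "nxt n P p j"
    using nxt_ex_right[of p "c - 1" n P] p pred_C[OF c] less_imp_diff_less[OF c(2), of 1] by auto
  have jP: "j \<in> P" using j(2) p(1) unfolding nxt_def by blast
  have "(\<lambda>l. d * bv n P A j l + z l) \<in> bspan (bv n P A) {p \<in> P. p < c}"
    using z(1) jP j(1) c(3) by (intro bspan.add) auto
  moreover have "mulv n A (\<lambda>l. d * bv n P A j l + z l) = (\<lambda>l. d * bv n P A p l + v l)"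
    unfolding mulv_add mulv_scale z(2) bv_P[OF j(2) p(1)] ..
  ultimately show ?case by blast
qed

definition J_term :: "'k::field mat \<Rightarrow> 'k \<Rightarrow> nat \<Rightarrow> nat \<Rightarrow> 'k" where
  "J_term A t c l = (if 0 < c \<and> c - 1 \<in> J then t * inv_alpha A (c - 1) * bv n P A (c - 1) l else 0)"

text \<open>Built upwards in \<open>c\<close>. A correction by vectors of class \<open>P\<close>
  absorbs the remainder \<open>R\<close> together with the correction made at the predecessor. The
  term at \<open>c - 1\<close> stays, because the successor of \<open>c - 1\<close> within
  \<open>P\<close> lies above \<open>c\<close>. The factor \<open>t\<close> scales the whole
  complement.\<close>

lemma C_columns:
  fixes A :: "'k::field mat"
  assumes A: "A \<in> N" and nz: "\<And>i. i < n \<Longrightarrow> lead A i \<noteq> 0"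
  shows "\<exists>b. \<forall>c<k. c \<notin> P \<longrightarrow> c < n \<longrightarrow>
      (\<lambda>l. b c l + - (t / colead A c * bv n P A c l)) \<in> bspan (bv n P A) {p \<in> P. p < c} \<and>
      (\<forall>i. nxt n P i c \<longrightarrow> (\<forall>l. mulv n A (b c) l = b i l + J_term A t c l)) \<and>
      ((\<nexists>i. nxt n P i c) \<longrightarrow> (\<forall>l. mulv n A (b c) l = J_term A t c l))"
    (is "\<exists>b. \<forall>c<k. c \<notin> P \<longrightarrow> c < n \<longrightarrow> ?Q b c")
proof (induction k)
  case 0
  then show ?case by simp
next
  case (Suc k)
  let ?f = "bv n P A"
  obtain b where b: "\<And>c. c < k \<Longrightarrow> c \<notin> P \<Longrightarrow> c < n \<Longrightarrow> ?Q b c"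
    using Suc.IH by blast
  show ?case
  proof (cases "k \<notin> P \<and> k < n")
    case False
    then show ?thesis using b by (intro exI[of _ b]) (auto simp: less_Suc_eq)
  next
    case True
    have co: "colead A i \<noteq> 0" for i unfolding colead_def using nz P_bound finite_P by auto
    obtain bk where bk: "(\<lambda>l. bk l + - (t / colead A k * ?f k l)) \<in> bspan ?f {p \<in> P. p < k}"
      "\<And>i l. nxt n P i k \<Longrightarrow> mulv n A bk l = b i l + J_term A t k l"
      "\<And>l. \<nexists>i. nxt n P i k \<Longrightarrow> mulv n A bk l = J_term A t k l"
    proof (cases "k = 0")
      case True
      have "mulv n A (?f 0) = (\<lambda>l. 0)"
        using mulv_support[OF A, of 0 "?f 0"] bv_support[OF A] by auto
      then have "mulv n A (\<lambda>l. t / colead A k * ?f k l) = (\<lambda>l. 0)"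
        unfolding mulv_scale True by simp
      then show ?thesis
        using that[of "\<lambda>l. t / colead A k * ?f k l"] True
        by (auto simp: bspan.zero J_term_def nxt_def)
    next
      case False
      let ?th = "A $$ (k - 1, k) * lead A k / lead A (k - 1)"
      obtain R where R: "R \<in> bspan ?f {p \<in> P. p < k - 1}"
        "\<And>i l. nxt n P i k \<Longrightarrow> mulv n A (?f k) l = colead A k / colead A i * ?f i l + ?th * ?f (k - 1) l + R l"
        "\<And>l. \<nexists>i. nxt n P i k \<Longrightarrow> mulv n A (?f k) l = ?th * ?f (k - 1) l + R l"
        using mulv_C_decomposition[OF A nz, of k] True False nxt_unique_left[of n P _ k] by blast
      define z where "z = (\<lambda>l. if \<exists>i. nxt n P i k then b (THE i. nxt n P i k) l +
          - (t / colead A (THE i. nxt n P i k) * ?f (THE i. nxt n P i k) l) else 0)"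
      have the: "(THE i. nxt n P i k) = i" if "nxt n P i k" for i
        using that by (intro the_equality) (auto intro: nxt_unique_left)
      have z: "z \<in> bspan ?f {p \<in> P. p < k - 1}"
      proof (cases "\<exists>i. nxt n P i k")
        case nx: True
        then obtain i where i: "nxt n P i k" by blast
        then have "i < k" "i \<notin> P" "i < n" using True unfolding nxt_def by auto
        then have "(\<lambda>l. b i l + - (t / colead A i * ?f i l)) \<in> bspan ?f {p \<in> P. p < i}" using b by blast
        moreover have "z = (\<lambda>l. b i l + - (t / colead A i * ?f i l))"
          unfolding z_def the[OF i] using nx by auto
        ultimately show ?thesis using \<open>i < k\<close> by (auto intro: bspan_mono)
      next
        case False
        then show ?thesis unfolding z_def by (simp add: bspan.zero)
      qed
      \<comment> \<open>The image of the correction at \<open>k\<close> has to reproduce the one at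
        the predecessor and to cancel the scaled remainder.\<close>
      have "(\<lambda>l. z l + (- (t / colead A k)) * R l) \<in> bspan ?f {p \<in> P. p < k - 1}"
        by (intro bspan_add bspan_scale z R(1))
      then obtain y where y: "y \<in> bspan ?f {p \<in> P. p < k}"
        "mulv n A y = (\<lambda>l. z l + (- (t / colead A k)) * R l)"
        using bspan_lift[of k] True False by blast
      define bk where "bk = (\<lambda>l. t / colead A k * ?f k l + y l)"
      have mul: "mulv n A bk l = t / colead A k * mulv n A (?f k) l + z l - t / colead A k * R l" for l
        unfolding bk_def mulv_add mulv_scale y(2) by simp
      have J: "t / colead A k * (?th * ?f (k - 1) l) = J_term A t k l" for l
      proof (cases "k - 1 \<in> J")
        case True
        then show ?thesis using False by (simp add: J_term_def inv_alpha_def mult.commute)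
      next
        case notJ: False
        then have "k - 1 \<notin> I" using True False unfolding J_def by auto
        then have "(k - 1, k) \<notin> X" using False unfolding X_def by auto
        then have "A $$ (k - 1, k) = 0" using N_entry[OF A, of "k - 1" k] True by linarith
        then show ?thesis using notJ by (simp add: J_term_def)
      qed
      show ?thesis
      proof (rule that[of bk])
        show "(\<lambda>l. bk l + - (t / colead A k * ?f k l)) \<in> bspan ?f {p \<in> P. p < k}"
          using y(1) unfolding bk_def by simp
        fix i l assume i: "nxt n P i k"
        have zl: "z l = b i l - t / colead A i * ?f i l" unfolding z_def the[OF i] using i by auto
        have "mulv n A bk l = t / colead A k * (colead A k / colead A i) * ?f i l +
            t / colead A k * (?th * ?f (k - 1) l) + z l"
          unfolding mul R(2)[OF i] by (simp only: distrib_left mult.assoc add_diff_eq) simp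
        also have "\<dots> = b i l + J_term A t k l"
          unfolding J zl using co[of k] by simp
        finally show "mulv n A bk l = b i l + J_term A t k l" .
      next
        fix l assume i: "\<nexists>i. nxt n P i k"
        then have "z l = 0" unfolding z_def by simp
        then have "mulv n A bk l = t / colead A k * (?th * ?f (k - 1) l)"
          unfolding mul R(3)[OF i] by (simp only: distrib_left) simp
        then show "mulv n A bk l = J_term A t k l" unfolding J .
      qed
    qed
    have "k \<noteq> i" if "nxt n P i c" "c < Suc k" for i c using that unfolding nxt_def by auto
    then show ?thesis using b bk
      by (intro exI[of _ "b(k := bk)"]) (auto simp: less_Suc_eq)
  qed
qed

lemma sum_nxt_left:
  assumes "nxt n P i j"
  shows "(\<Sum>k = 0..<n. F k * (if nxt n P k j then 1 else 0 :: 'k::field)) = F i"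
proof -
  have "i < n" using nxt_less[OF assms] by simp
  have eq: "nxt n P k j \<longleftrightarrow> k = i" for k using assms nxt_unique_left by blast
  have "(\<Sum>k = 0..<n. F k * (if nxt n P k j then 1 else 0)) = (\<Sum>k = 0..<n. if k = i then F i else 0)"
    unfolding eq by (intro sum.cong) auto
  then show ?thesis using \<open>i < n\<close> by simp
qed

lemma sum_nxt_right:
  assumes "nxt n P i j"
  shows "(\<Sum>k = 0..<n. (if nxt n P i k then 1 else 0 :: 'k::field) * F k) = F j"
proof -
  have "j < n" using nxt_less[OF assms] by simp
  have eq: "nxt n P i k \<longleftrightarrow> k = j" for k using assms nxt_unique_right by blast
  have "(\<Sum>k = 0..<n. (if nxt n P i k then 1 else 0) * F k) = (\<Sum>k = 0..<n. if k = j then F j else 0)"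
    unfolding eq by (intro sum.cong) auto
  then show ?thesis using \<open>j < n\<close> by simp
qed

lemma mult_nf_entry:
  assumes "g \<in> carrier_mat n n" "l < n" "j < n"
  shows "(g * nf \<alpha>) $$ (l, j) = (\<Sum>k = 0..<n. g $$ (l, k) * (if nxt n P k j then 1 else 0)) +
     (if 0 < j \<and> j - 1 \<in> J then \<alpha> (j - 1) * g $$ (l, j - 1) else 0)"
proof -
  have "(g * nf \<alpha>) $$ (l, j) = (\<Sum>k = 0..<n. g $$ (l, k) * nf \<alpha> $$ (k, j))"
    using assms nf_carrier[of \<alpha>] by (auto simp: scalar_prod_def)
  also have "\<dots> = (\<Sum>k = 0..<n. g $$ (l, k) * (if nxt n P k j then 1 else 0)) +
      (\<Sum>k = 0..<n. g $$ (l, k) * (if k \<in> J \<and> j = Suc k then \<alpha> k else 0))"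
    using assms by (simp add: nf_entry distrib_left sum.distrib)
  also have "(\<Sum>k = 0..<n. g $$ (l, k) * (if k \<in> J \<and> j = Suc k then \<alpha> k else 0)) =
      (\<Sum>k = 0..<n. if k = j - 1 then (if 0 < j \<and> j - 1 \<in> J then \<alpha> (j - 1) * g $$ (l, j - 1) else 0) else 0)"
    by (intro sum.cong) auto
  also have "\<dots> = (if 0 < j \<and> j - 1 \<in> J then \<alpha> (j - 1) * g $$ (l, j - 1) else 0)"
    using assms(3) by (subst sum.delta) auto
  finally show ?thesis .
qed

lemma nf_mult_entry:
  assumes "g \<in> carrier_mat n n" "i < n" "j < n"
  shows "(nf \<alpha> * g) $$ (i, j) = (\<Sum>k = 0..<n. (if nxt n P i k then 1 else 0) * g $$ (k, j)) +
     (if i \<in> J then \<alpha> i * g $$ (Suc i, j) else 0)"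
proof -
  have "(nf \<alpha> * g) $$ (i, j) = (\<Sum>k = 0..<n. nf \<alpha> $$ (i, k) * g $$ (k, j))"
    using assms nf_carrier[of \<alpha>] by (auto simp: scalar_prod_def)
  also have "\<dots> = (\<Sum>k = 0..<n. (if nxt n P i k then 1 else 0) * g $$ (k, j)) +
      (\<Sum>k = 0..<n. (if i \<in> J \<and> k = Suc i then \<alpha> i else 0) * g $$ (k, j))"
    using assms by (simp add: nf_entry distrib_right sum.distrib)
  also have "(\<Sum>k = 0..<n. (if i \<in> J \<and> k = Suc i then \<alpha> i else 0) * g $$ (k, j)) =
      (\<Sum>k = 0..<n. if k = Suc i then (if i \<in> J then \<alpha> i * g $$ (Suc i, j) else 0) else 0)"
    by (intro sum.cong) auto
  also have "\<dots> = (if i \<in> J then \<alpha> i * g $$ (Suc i, j) else 0)"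
    using J_facts(5)[of i] by (subst sum.delta) auto
  finally show ?thesis .
qed

text \<open>The base change has the columns \<open>bv\<close> on \<open>P\<close> and those of
  \<open>C_columns\<close> on the complement. Scaling the complement by \<open>t\<close> multiplies
  all parameters at once.\<close>

lemma conjugate_to_nf:
  fixes A :: "'k::field mat"
  assumes A: "A \<in> N" and nz: "\<And>i. i < n \<Longrightarrow> lead A i \<noteq> 0" and t: "t \<noteq> 0"
  shows "A \<in> borel_orbit n (nf (\<lambda>a. t * inv_alpha A a))"
proof -
  let ?f = "bv n P A"
  let ?\<alpha> = "\<lambda>a. t * inv_alpha A a"
  obtain b where b: "\<And>c. c < n \<Longrightarrow> c \<notin> P \<Longrightarrow>
      (\<lambda>l. b c l + - (t / colead A c * ?f c l)) \<in> bspan ?f {p \<in> P. p < c}"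
      "\<And>c i l. c < n \<Longrightarrow> c \<notin> P \<Longrightarrow> nxt n P i c \<Longrightarrow> mulv n A (b c) l = b i l + J_term A t c l"
      "\<And>c l. c < n \<Longrightarrow> c \<notin> P \<Longrightarrow> \<nexists>i. nxt n P i c \<Longrightarrow> mulv n A (b c) l = J_term A t c l"
    using C_columns[OF A nz, of n t] by blast
  define G where "G = (\<lambda>j. if j \<in> P then ?f j else b j)"
  define g where "g = mat n n (\<lambda>(l, j). G j l)"
  have g: "g \<in> carrier_mat n n" unfolding g_def by simp
  have bc: "b c l = t / colead A c * ?f c l" if "c < n" "c \<notin> P" "c \<le> l" for c l
  proof -
    have "b c l + - (t / colead A c * ?f c l) = 0"
      by (rule bspan_support[OF b(1)[OF that(1,2)], of l]) (use bv_support[OF A] that in auto)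
    then show ?thesis by simp
  qed
  have co: "colead A i \<noteq> 0" for i unfolding colead_def using nz P_bound finite_P by auto
  have Gsup: "G j l = 0" if "j < l" "j < n" for j l
    using that bc[of j l] bv_support[OF A, of j l] unfolding G_def by auto
  have Gdiag: "G j j \<noteq> 0" if "j < n" for j
    using that bc[of j j] nz[of j] t co[of j] unfolding G_def lead_def by auto
  have "A * g = g * nf ?\<alpha>"
  proof (rule eq_matI)
    fix l j assume "l < dim_row (g * nf ?\<alpha>)" "j < dim_col (g * nf ?\<alpha>)"
    then have lj: "l < n" "j < n" using g nf_carrier[of ?\<alpha>] by auto
    have "(A * g) $$ (l, j) = (\<Sum>k = 0..<n. A $$ (l, k) * g $$ (k, j))"
      using N_carrier[OF A] g lj by (auto simp: scalar_prod_def)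
    also have "\<dots> = mulv n A (G j) l"
      using lj by (simp add: mulv_def g_def lessThan_atLeast0)
    finally have lhs: "(A * g) $$ (l, j) = mulv n A (G j) l" .
    have rhs: "(g * nf ?\<alpha>) $$ (l, j) = (\<Sum>k = 0..<n. g $$ (l, k) * (if nxt n P k j then 1 else 0)) +
      (if 0 < j \<and> j - 1 \<in> J then ?\<alpha> (j - 1) * g $$ (l, j - 1) else 0)"
      by (rule mult_nf_entry[OF g lj])
    have Jt: "(if 0 < j \<and> j - 1 \<in> J then ?\<alpha> (j - 1) * g $$ (l, j - 1) else 0) =
        (if j \<in> P then 0 else J_term A t j l)"
      using J_facts(2,3)[of "j - 1"] lj by (auto simp: g_def G_def J_term_def)
    show "(A * g) $$ (l, j) = (g * nf ?\<alpha>) $$ (l, j)"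
    proof (cases "\<exists>i. nxt n P i j")
      case True
      then obtain i where i: "nxt n P i j" by blast
      have i': "i < n" "i \<in> P \<longleftrightarrow> j \<in> P" using i unfolding nxt_def by auto
      have "(\<Sum>k = 0..<n. g $$ (l, k) * (if nxt n P k j then 1 else 0)) = G i l"
        unfolding sum_nxt_left[OF i] using lj i' by (simp add: g_def)
      then show ?thesis unfolding lhs rhs Jt
        using i' b(2)[OF lj(2) _ i] bv_P[OF i, of A] by (auto simp: G_def)
    next
      case False
      then have "(\<Sum>k = 0..<n. g $$ (l, k) * (if nxt n P k j then 1 else 0)) = 0" by simp
      then show ?thesis unfolding lhs rhs Jt
        using False b(3)[OF lj(2)] mulv_bottom_P[OF A, of j] by (auto simp: G_def)
    qed
  qed (use g nf_carrier[of ?\<alpha>] N_carrier[OF A] in auto)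
  moreover have "upper_triangular g"
    by (rule upper_triangularI) (use Gsup in \<open>auto simp: g_def\<close>)
  moreover have "g $$ (i, i) \<noteq> 0" if "i < n" for i using Gdiag[OF that] that by (simp add: g_def)
  ultimately show ?thesis using g nf_carrier N_carrier[OF A] by (intro borel_orbitI[of g]) auto
qed

text \<open>Comparing entries of \<open>nf \<beta> * g = g * nf \<alpha>\<close> at a step of either
  class equates two diagonal entries of \<open>g\<close>. At \<open>(a, Suc a)\<close> with
  \<open>a\<close> in \<open>J\<close> the parameters are then related through the two class
  constants.\<close>

lemma nf_orbit_proportional:
  fixes \<alpha> \<beta> :: "nat \<Rightarrow> 'k::field"
  assumes "nf \<beta> \<in> borel_orbit n (nf \<alpha>)"
  shows "\<exists>\<mu>. \<mu> \<noteq> 0 \<and> (\<forall>a\<in>J. \<beta> a = \<mu> * \<alpha> a)"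
proof -
  obtain g where gb: "g \<in> borel n" and g: "g \<in> carrier_mat n n" and eq: "nf \<beta> * g = g * nf \<alpha>"
    using borel_orbitE[OF assms nf_carrier] by metis
  have low: "g $$ (i, j) = 0" if "j < i" "i < n" for i j
    using gb g that unfolding borel_iff by (auto dest: upper_triangularD)
  have diag: "g $$ (i, i) \<noteq> 0" if "i < n" for i
    using gb upper_triangular_diag_nonzero[OF g] that unfolding borel_iff by blast
  have entry: "(\<Sum>k = 0..<n. (if nxt n P i k then 1 else 0) * g $$ (k, j)) + (if i \<in> J then \<beta> i * g $$ (Suc i, j) else 0) =
      (\<Sum>k = 0..<n. g $$ (i, k) * (if nxt n P k j then 1 else 0)) +
      (if 0 < j \<and> j - 1 \<in> J then \<alpha> (j - 1) * g $$ (i, j - 1) else 0)" if "i < n" "j < n" for i j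
    using arg_cong[OF eq, of "\<lambda>M. M $$ (i, j)"] mult_nf_entry[OF g that] nf_mult_entry[OF g that] by simp
  \<comment> \<open>Descending from \<open>Suc (Max I) \<in> P\<close>, an element of \<open>P\<close> whose predecessor is also in \<open>P\<close>, the columns
    in \<open>P\<close> stay one step ahead of the complement; hence the diagonal of \<open>g\<close> is constant on each class.\<close>
  have K: "g $$ (c, p) = 0" if "p \<in> P" "p \<le> Max I" "I \<noteq> {}" "c \<notin> P" "c < p" "\<And>c'. c < c' \<Longrightarrow> c' < p \<Longrightarrow> c' \<in> P" for c p
    using that
  proof (induction "n - p" arbitrary: p c rule: less_induct)
    case less
    obtain u where u: "nxt n P p u"
      using nxt_ex_right[of p "Suc (Max I)" n P] top_I less.prems P_bound by auto
    have u': "p < u" "u < n" "u \<in> P" using u less.prems(1) unfolding nxt_def by auto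
    have cn: "c < n" using less.prems u' by simp
    have uJ: "\<not> (0 < u \<and> u - 1 \<in> J)" using J_facts(3)[of "u - 1"] u' by auto
    have "c \<notin> J" using less.prems(4) J_facts(2) by blast
    then have e: "(\<Sum>k = 0..<n. (if nxt n P c k then 1 else 0) * g $$ (k, u)) = g $$ (c, p)"
      using entry[OF cn u'(2)] unfolding sum_nxt_left[OF u] if_not_P[OF uJ] by simp
    show ?case
    proof (cases "\<exists>d. nxt n P c d")
      case False
      then show ?thesis using e by simp
    next
      case True
      then obtain d where d: "nxt n P c d" by blast
      have d': "c < d" "d < n" "d \<notin> P" using d less.prems(4) unfolding nxt_def by auto
      have e': "g $$ (c, p) = g $$ (d, u)" using e unfolding sum_nxt_right[OF d] by simp
      have "p < d" using less.prems(1,6) d' by (metis nat_neq_iff)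
      show ?thesis
      proof (cases "u < d")
        case True
        then show ?thesis using e' low d' by simp
      next
        case False
        then have "d < u" using d'(3) u'(3) by (metis nat_neq_iff)
        then have du: "d = Suc p" "u = Suc (Suc p)" using nxt_P[OF u less.prems(1)] \<open>p < d\<close> by auto
        have "Max I \<in> P" using Max_in[OF finite_I less.prems(3)] I_P by blast
        \<comment> \<open>\<open>Suc p\<close> is outside \<open>P\<close>, so it is neither
          \<open>Max I\<close> nor \<open>Suc (Max I)\<close>; hence \<open>u = Suc (Suc p)\<close>
          is still in the range of the induction.\<close>
        then have "u \<le> Max I"
          using less.prems(2,3) top_I d'(3) du by (metis Suc_leI le_neq_implies_less)
        then have "g $$ (d, u) = 0"
          using less.hyps[of u d] less.prems u' d' du by auto
        then show ?thesis using e' by simp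
      qed
    qed
  qed
  \<comment> \<open>The extra terms of the equation come from \<open>J\<close>, and each contains an
    entry of \<open>g\<close> that vanishes by \<open>K\<close>.\<close>
  have same: "g $$ (i, i) = g $$ (j, j)" if ij: "nxt n P i j" for i j
  proof -
    have ij': "i < j" "j < n" "i < n" "i \<in> P \<longleftrightarrow> j \<in> P" using ij unfolding nxt_def by auto
    show ?thesis
    proof (cases "i \<in> P")
      case True
      have "\<not> (0 < j \<and> j - 1 \<in> J)" using J_facts(3)[of "j - 1"] True ij' by auto
      moreover have "g $$ (Suc i, j) = 0" if "i \<in> J"
      proof -
        have "j = Suc (Suc i)" using nxt_unique_right[OF ij J_facts(6)[OF that]] .
        moreover have "I \<noteq> {}" using J_facts(1)[OF that] by blast
        ultimately show ?thesis using K[of j "Suc i"] J_facts[OF that] J_less_Max[OF that] by auto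
      qed
      ultimately show ?thesis
        using entry[OF ij'(3,2)] unfolding sum_nxt_left[OF ij] sum_nxt_right[OF ij] by (auto split: if_splits)
    next
      case False
      then have "i \<notin> J" using J_facts(2) by blast
      moreover have "g $$ (i, j - 1) = 0" if "0 < j \<and> j - 1 \<in> J"
      proof (rule K)
        have jJ: "j - 1 \<in> J" using that by blast
        show "j - 1 \<in> P" "I \<noteq> {}" "i \<notin> P" using J_facts[OF jJ] False by auto
        show "j - 1 \<le> Max I" using J_less_Max[OF jJ] by simp
        show "i < j - 1" using ij' False J_facts(2)[OF jJ] by (metis Suc_pred' less_antisym that)
        show "c' \<in> P" if "i < c'" "c' < j - 1" for c' using ij False that unfolding nxt_def by auto
      qed
      ultimately show ?thesis
        using entry[OF ij'(3,2)] unfolding sum_nxt_left[OF ij] sum_nxt_right[OF ij] by (auto split: if_splits)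
    qed
  qed
  have const: "g $$ (i, i) = g $$ (j, j)" if "i < j" "j < n" "i \<in> P \<longleftrightarrow> j \<in> P" for i j
    using that
  proof (induction "j - i" arbitrary: i rule: less_induct)
    case less
    obtain u where u: "u \<le> j" "nxt n P i u" using nxt_ex_right[OF less.prems] by blast
    show ?case
    proof (cases "u = j")
      case True
      then show ?thesis using same u by blast
    next
      case False
      then have "i < u" "u < j" "u \<in> P \<longleftrightarrow> j \<in> P" using u less.prems unfolding nxt_def by auto
      then show ?thesis using less.hyps[of u] less.prems same[OF u(2)] diff_less_mono2[of i u j] by auto
    qed
  qed
  have const': "g $$ (i, i) = g $$ (j, j)" if "i < n" "j < n" "i \<in> P \<longleftrightarrow> j \<in> P" for i j
    using const[of i j] const[of j i] that by (metis nat_neq_iff)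
  \<comment> \<open>At \<open>(a, Suc a)\<close> the descent sums meet only entries of
    \<open>g\<close> below the diagonal, which leaves the two parameter terms.\<close>
  have rel: "\<beta> a * g $$ (Suc a, Suc a) = \<alpha> a * g $$ (a, a)" if a: "a \<in> J" for a
  proof -
    note Ja = J_facts[OF a]
    have "(\<Sum>k = 0..<n. (if nxt n P a k then 1 else 0) * g $$ (k, Suc a)) = 0"
      unfolding sum_nxt_right[OF Ja(6)] using low Ja(5) by simp
    moreover have "(\<Sum>k = 0..<n. g $$ (a, k) * (if nxt n P k (Suc a) then 1 else 0)) = 0"
    proof (rule sum.neutral, rule ballI)
      fix k
      show "g $$ (a, k) * (if nxt n P k (Suc a) then 1 else 0) = 0"
      proof (cases "nxt n P k (Suc a)")
        case True
        then have "k < a" using Ja(2,3) unfolding nxt_def by (metis less_antisym)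
        then show ?thesis using low Ja(5) by simp
      qed simp
    qed
    ultimately show ?thesis using entry[of a "Suc a"] Ja(5) a by simp
  qed
  show ?thesis
  proof (cases "J = {}")
    case True
    then show ?thesis by (intro exI[of _ 1]) auto
  next
    case False
    then obtain a0 where a0: "a0 \<in> J" by blast
    let ?\<mu> = "g $$ (a0, a0) / g $$ (Suc a0, Suc a0)"
    have nz0: "g $$ (a0, a0) \<noteq> 0" "g $$ (Suc a0, Suc a0) \<noteq> 0" using diag J_facts(5)[OF a0] by auto
    have "\<beta> a = ?\<mu> * \<alpha> a" if a: "a \<in> J" for a
    proof -
      have "g $$ (a, a) = g $$ (a0, a0)" "g $$ (Suc a, Suc a) = g $$ (Suc a0, Suc a0)"
        using const'[of a a0] const'[of "Suc a" "Suc a0"] J_facts[OF a] J_facts[OF a0] by auto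
      then show ?thesis using rel[OF a] nz0 by (simp add: field_simps)
    qed
    then show ?thesis using nz0 by (intro exI[of _ ?\<mu>]) auto
  qed
qed

end

lemma poly_fun_prod:
  "finite S \<Longrightarrow> (\<And>i. i \<in> S \<Longrightarrow> (\<lambda>A. f A i) \<in> poly_fun n) \<Longrightarrow> (\<lambda>A. \<Prod>i\<in>S. f A i) \<in> poly_fun n"
  by (induction S rule: finite_induct) (auto intro: poly_fun.const poly_fun.mult)

lemma poly_fun_common_degree:
  assumes "finite F" "F \<subseteq> poly_fun n"
  shows "\<exists>\<delta>. \<forall>p\<in>F. pdegn n \<delta> p"
  using assms
proof (induction F rule: finite_induct)
  case (insert p F)
  then obtain \<delta> \<delta>' where "\<forall>p\<in>F. pdegn n \<delta> p" "pdegn n \<delta>' p" using poly_fun_imp_pdeg[of p n] by auto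
  then have "\<forall>q\<in>insert p F. pdegn n (max \<delta> \<delta>') q" by (auto intro: pdeg.mono)
  then show ?case by blast
qed simp

context colouring
begin

section \<open>Generic orbits\<close>

text \<open>Where it is nonzero, the triangular vectors form a basis and all parameters are nonzero,
  so their ratios make sense.\<close>

definition gen_poly :: "'k::field mat \<Rightarrow> 'k" where
  "gen_poly A = (\<Prod>i\<in>{..<n}. lead A i) * (\<Prod>a\<in>J. A $$ (a, Suc a))"

lemma lead_poly_fun: "(\<lambda>A. lead A i) \<in> poly_fun n"
  unfolding lead_def by (rule bv_poly_fun)

lemma colead_poly_fun: "(\<lambda>A. colead A i) \<in> poly_fun n"
  unfolding colead_def using finite_P by (intro poly_fun_prod lead_poly_fun) auto

lemma J_entry_poly_fun: "a \<in> J \<Longrightarrow> (\<lambda>A. A $$ (a, Suc a)) \<in> poly_fun n"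
  using J_facts(5)[of a] by (intro poly_fun.coord) auto

lemma gen_poly_poly_fun: "gen_poly \<in> poly_fun n"
proof -
  have "(\<lambda>A. gen_poly A) \<in> poly_fun n"
    unfolding gen_poly_def using finite_J
    by (intro poly_fun.mult poly_fun_prod lead_poly_fun J_entry_poly_fun) auto
  then show ?thesis by simp
qed

lemma gen_poly_nonzero:
  "gen_poly A \<noteq> 0 \<longleftrightarrow> (\<forall>i<n. lead A i \<noteq> 0) \<and> (\<forall>a\<in>J. A $$ (a, Suc a) \<noteq> 0)"
  unfolding gen_poly_def using finite_J by auto

lemma colead_nonzero: "(\<And>i. i < n \<Longrightarrow> lead A i \<noteq> 0) \<Longrightarrow> colead A c \<noteq> 0"
  unfolding colead_def using P_bound finite_P by auto

lemma inv_alpha_nonzero: "gen_poly A \<noteq> 0 \<Longrightarrow> a \<in> J \<Longrightarrow> inv_alpha A a \<noteq> 0"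
  unfolding inv_alpha_def gen_poly_nonzero using J_facts(5)[of a] colead_nonzero[of A] by auto

lemma lead_nf: "i < n \<Longrightarrow> lead (nf \<alpha>) i = 1"
  unfolding lead_def by (simp add: bv_nf unit_fun_def)

lemma inv_alpha_nf:
  assumes "a \<in> J"
  shows "inv_alpha (nf \<alpha>) a = \<alpha> a"
proof -
  have "colead (nf \<alpha>) (Suc a) = 1" unfolding colead_def using P_bound by (simp add: lead_nf)
  then show ?thesis
    unfolding inv_alpha_def using J_facts(5)[OF assms] not_nxt_J[OF assms] assms
    by (simp add: lead_nf nf_entry)
qed

lemma gen_poly_nf: "(\<And>a. a \<in> J \<Longrightarrow> \<alpha> a \<noteq> 0) \<Longrightarrow> gen_poly (nf \<alpha>) \<noteq> 0"
proof -
  assume \<alpha>: "\<And>a. a \<in> J \<Longrightarrow> \<alpha> a \<noteq> 0"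
  have "nf \<alpha> $$ (a, Suc a) = \<alpha> a" if "a \<in> J" for a
    using that J_facts(5)[OF that] not_nxt_J[OF that] by (simp add: nf_entry)
  then show ?thesis unfolding gen_poly_nonzero using \<alpha> by (simp add: lead_nf)
qed

lemma generic_conjugate_to_nf:
  "A \<in> N \<Longrightarrow> gen_poly A \<noteq> 0 \<Longrightarrow> t \<noteq> 0 \<Longrightarrow> A \<in> borel_orbit n (nf (\<lambda>a. t * inv_alpha A a))"
  using conjugate_to_nf[of A t] unfolding gen_poly_nonzero by blast

lemma N_orbit: "x \<in> N \<Longrightarrow> borel_orbit n x \<subseteq> N"
  using borel_orbit_coord_space[of X n x] X_up by blast

lemma inv_alpha_proportional:
  assumes "x \<in> N" "gen_poly x \<noteq> 0" "y \<in> borel_orbit n x" "gen_poly y \<noteq> 0"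
  shows "\<exists>\<mu>. \<mu> \<noteq> 0 \<and> (\<forall>a\<in>J. inv_alpha y a = \<mu> * inv_alpha x a)"
proof -
  have y: "y \<in> N" using assms N_orbit by blast
  have nx: "x \<in> borel_orbit n (nf (inv_alpha x))" using generic_conjugate_to_nf[OF assms(1,2), of 1] by simp
  have ny: "y \<in> borel_orbit n (nf (inv_alpha y))" using generic_conjugate_to_nf[OF y assms(4), of 1] by simp
  have "nf (inv_alpha y) \<in> borel_orbit n y" by (rule borel_orbit_sym[OF ny nf_carrier])
  then have "nf (inv_alpha y) \<in> borel_orbit n x" using borel_orbit_trans assms N_carrier by blast
  then have "nf (inv_alpha y) \<in> borel_orbit n (nf (inv_alpha x))" using borel_orbit_trans nx nf_carrier by blast
  then show ?thesis by (rule nf_orbit_proportional)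
qed

text \<open>Scaling by \<open>t\<close> turns a single parameter into one, so the orbit contains the
  nonempty open set where \<open>gen_poly\<close> is nonzero, and the ideal is irreducible.\<close>

lemma dense_orbit:
  assumes inf: "infinite (UNIV :: 'k::field set)" and "card J \<le> 1"
  shows "zariski_closure n (borel_orbit n (nf (\<lambda>_. 1 :: 'k))) = zariski_closure n N"
proof
  let ?x = "nf (\<lambda>_. 1 :: 'k)"
  have sub: "borel_orbit n ?x \<subseteq> N" by (rule N_orbit[OF nf_N])
  then show "zariski_closure n (borel_orbit n ?x) \<subseteq> zariski_closure n N" by (rule zariski_closure_mono)
  have oc: "borel_orbit n ?x \<subseteq> carrier_mat n n" by (rule borel_orbit_carrier[OF nf_carrier])
  have gen: "A \<in> borel_orbit n ?x" if A: "A \<in> N" "gen_poly A \<noteq> 0" for A :: "'k mat"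
  proof (cases "J = {}")
    case True
    then have "nf (inv_alpha A) = ?x" by (intro nf_cong) auto
    then show ?thesis using generic_conjugate_to_nf[OF A, of 1] by simp
  next
    case False
    then obtain a where "a \<in> J" by blast
    then have J: "J = {a}" using assms(2) finite_J by (metis card_le_Suc0_iff_eq One_nat_def is_singletonI' is_singleton_the_elem singletonD False)
    have nz: "inv_alpha A a \<noteq> 0" using inv_alpha_nonzero[OF A(2) \<open>a \<in> J\<close>] .
    then have "nf (\<lambda>b. 1 / inv_alpha A a * inv_alpha A b) = ?x" using J by (intro nf_cong) auto
    then show ?thesis using generic_conjugate_to_nf[OF A, of "1 / inv_alpha A a"] nz by simp
  qed
  have "N \<subseteq> zariski_closure n (borel_orbit n ?x)"
  proof
    fix A :: "'k mat" assume A: "A \<in> N"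
    have "p A = 0" if p: "p \<in> poly_fun n" "\<forall>s\<in>borel_orbit n ?x. p s = 0" for p
    proof -
      have "\<forall>s\<in>N. gen_poly s * p s = 0" using gen p(2) by auto
      moreover have "\<exists>s\<in>N. gen_poly s \<noteq> (0 :: 'k)" using nf_N gen_poly_nf[of "\<lambda>_. 1 :: 'k"] by auto
      ultimately show ?thesis
        using irr_cancel[OF coord_space_irr[OF inf X_subset] gen_poly_poly_fun p(1)] A by blast
    qed
    then show "A \<in> zariski_closure n (borel_orbit n ?x)"
      unfolding mem_zariski_closure_iff[OF oc] using A N_carrier by blast
  qed
  then show "zariski_closure n N \<subseteq> zariski_closure n (borel_orbit n ?x)"
    using zariski_closure_minimal[OF zariski_closed_closure[OF oc]] by blast
qed

section \<open>Relations between the parameters as a triangular system\<close>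

lemma lead_J_expand:
  assumes "A \<in> N" "a \<in> J"
  shows "lead A a = A $$ (a, Suc (Suc a)) * lead A (Suc (Suc a)) + A $$ (a, Suc a) * bv n P A (Suc (Suc a)) (Suc a)"
proof -
  note Ja = J_facts[OF assms(2)]
  let ?F = "\<lambda>j. A $$ (a, j) * bv n P A (Suc (Suc a)) j"
  have "lead A a = (\<Sum>j<n. ?F j)"
    unfolding lead_def bv_P[OF Ja(6,2)] using Ja(5) by (simp add: mulv_def)
  also have "\<dots> = (\<Sum>j\<in>{Suc a, Suc (Suc a)}. ?F j)"
  proof (rule sum.mono_neutral_right)
    show "\<forall>j\<in>{..<n} - {Suc a, Suc (Suc a)}. ?F j = 0"
    proof
      fix j assume j: "j \<in> {..<n} - {Suc a, Suc (Suc a)}"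
      show "?F j = 0"
      proof (cases "Suc (Suc a) < j")
        case True
        then show ?thesis using bv_support[OF assms(1)] by simp
      next
        case False
        then have "(a, j) \<notin> X" using j unfolding X_def by auto
        then show ?thesis using N_entry[OF assms(1), of a j] j Ja(5) by simp
      qed
    qed
  qed (use Ja(5) in auto)
  finally show ?thesis unfolding lead_def by simp
qed

text \<open>Apart from the unknown \<open>(a, Suc (Suc a))\<close>, the relation for row
  \<open>a\<close> is computed from rows further down and the superdiagonal entry; no unknown of a
  smaller row occurs.\<close>

definition dep :: "nat \<times> nat \<Rightarrow> (nat \<times> nat) set" where
  "dep \<beta> = {\<tau> \<in> X. fst \<beta> < fst \<tau>} \<union> {(fst \<beta>, Suc (fst \<beta>))}"

text \<open>These arise by cross-multiplying
  \<open>inv_alpha A a = c a * inv_alpha A (Max J)\<close> and expanding \<open>lead A a\<close>,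
  which is affine in the entry \<open>(a, Suc (Suc a))\<close>. \<open>H1\<close> is the left side;
  on the right, up to \<open>c a\<close>, \<open>G1\<close> is the factor of that entry and
  \<open>H2\<close> the rest.\<close>

definition G1 :: "nat \<Rightarrow> 'k::field mat \<Rightarrow> 'k" where
  "G1 a A = A $$ (Max J, Suc (Max J)) * lead A (Suc (Max J)) * colead A (Suc a) * lead A (Suc (Suc a))"

definition H1 :: "nat \<Rightarrow> 'k::field mat \<Rightarrow> 'k" where
  "H1 a A = A $$ (a, Suc a) * lead A (Suc a) * lead A (Max J) * colead A (Suc (Max J))"

definition H2 :: "nat \<Rightarrow> 'k::field mat \<Rightarrow> 'k" where
  "H2 a A = A $$ (Max J, Suc (Max J)) * lead A (Suc (Max J)) * colead A (Suc a) *
     (A $$ (a, Suc a) * bv n P A (Suc (Suc a)) (Suc a))"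

text \<open>The restriction makes the dependence on \<open>dep \<beta>\<close> hold for all
  matrices, as \<open>pdeg\<close> demands; on the ideal the values do not change, see
  \<open>rel_restrict\<close>.\<close>

definition relG :: "(nat \<Rightarrow> 'k::field) \<Rightarrow> nat \<times> nat \<Rightarrow> 'k mat \<Rightarrow> 'k" where
  "relG c \<beta> A = c (fst \<beta>) * G1 (fst \<beta>) (restrict_mat n (dep \<beta>) A)"

definition relH :: "(nat \<Rightarrow> 'k::field) \<Rightarrow> nat \<times> nat \<Rightarrow> 'k mat \<Rightarrow> 'k" where
  "relH c \<beta> A = H1 (fst \<beta>) (restrict_mat n (dep \<beta>) A) - c (fst \<beta>) * H2 (fst \<beta>) (restrict_mat n (dep \<beta>) A)"

text \<open>The order is reversed because the relation for a row may involve unknowns of rows with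
  larger index, which must be solved first.\<close>

definition rel_pos :: "(nat \<times> nat) list" where
  "rel_pos = map (\<lambda>a. (a, Suc (Suc a))) (rev (sorted_list_of_set (J - {Max J})))"

lemma set_rel_pos: "set rel_pos = (\<lambda>a. (a, Suc (Suc a))) ` (J - {Max J})"
  unfolding rel_pos_def using finite_J by simp

lemma length_rel_pos: "J \<noteq> {} \<Longrightarrow> length rel_pos = card J - 1"
  unfolding rel_pos_def using finite_J by (simp add: card_Diff_singleton)

lemma distinct_rel_pos: "distinct rel_pos"
  unfolding rel_pos_def using finite_J by (simp add: distinct_map inj_on_def)

lemma below_Max_J: "a \<in> J - {Max J} \<Longrightarrow> a < Max J \<and> Max J \<in> J"
  using finite_J Max_ge[OF finite_J] Max_in[OF finite_J] by (metis Diff_iff empty_iff insertCI le_neq_implies_less)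

text \<open>The ratios \<open>c\<close> enter as scalars only, so the degree can be chosen before
  them; the estimate in \<open>orbit_dimensions\<close> relies on this uniformity.\<close>

lemma rel_degree:
  "\<exists>\<delta>. \<forall>(c :: nat \<Rightarrow> 'k::field). \<forall>\<beta>\<in>set rel_pos. pdeg (dep \<beta>) \<delta> (relG c \<beta>) \<and> pdeg (dep \<beta>) \<delta> (relH c \<beta>)"
proof -
  let ?F = "\<Union>a\<in>J - {Max J}. {G1 a, H1 a, H2 a} :: ('k mat \<Rightarrow> 'k) set"
  have poly: "G1 a \<in> poly_fun n" "H1 a \<in> poly_fun n" "H2 a \<in> poly_fun n" if a: "a \<in> J - {Max J}" for a
  proof -
    have m: "Max J \<in> J" and aJ: "a \<in> J" using below_Max_J[OF a] a by auto
    have "(\<lambda>A. G1 a A) \<in> poly_fun n" "(\<lambda>A. H1 a A) \<in> poly_fun n" "(\<lambda>A. H2 a A) \<in> poly_fun n"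
      unfolding G1_def H1_def H2_def
      by (intro poly_fun.mult lead_poly_fun colead_poly_fun bv_poly_fun J_entry_poly_fun[OF m] J_entry_poly_fun[OF aJ])+
    then show "G1 a \<in> poly_fun n" "H1 a \<in> poly_fun n" "H2 a \<in> poly_fun n" by simp_all
  qed
  have sub: "?F \<subseteq> poly_fun n" using poly by blast
  have fin: "finite ?F" using finite_J by auto
  from poly_fun_common_degree[OF fin sub] obtain \<delta> where \<delta>': "\<forall>p\<in>?F. pdegn n \<delta> p" ..
  note \<delta> = bspec[OF \<delta>']
  have "pdeg (dep \<beta>) \<delta> (relG c \<beta>) \<and> pdeg (dep \<beta>) \<delta> (relH c \<beta>)" if \<beta>: "\<beta> \<in> set rel_pos" for \<beta> and c :: "nat \<Rightarrow> 'k"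
  proof -
    have "fst \<beta> \<in> J - {Max J}" using \<beta> unfolding set_rel_pos by auto
    then have "pdegn n \<delta> (G1 (fst \<beta>) :: 'k mat \<Rightarrow> 'k)" "pdegn n \<delta> (H1 (fst \<beta>) :: 'k mat \<Rightarrow> 'k)"
      "pdegn n \<delta> (H2 (fst \<beta>) :: 'k mat \<Rightarrow> 'k)"
      using \<delta> by auto
    note r = this[THEN pdeg_restrict[where T = "dep \<beta>"]]
    have "pdeg (dep \<beta>) \<delta> (\<lambda>A. relG c \<beta> A)" "pdeg (dep \<beta>) \<delta> (\<lambda>A. relH c \<beta> A)"
      unfolding relG_def relH_def by (intro pdeg_cmult pdeg_diff r)+
    then show ?thesis by simp
  qed
  then show ?thesis by blast
qed

lemma restrict_dep:
  fixes A :: "'k::field mat" and b :: nat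
  assumes A: "A \<in> N" and a: "a \<in> J - {Max J}"
  defines "B \<equiv> restrict_mat n (dep (a, b)) A"
  shows "B $$ (a, Suc a) = A $$ (a, Suc a)" "B $$ (Max J, Suc (Max J)) = A $$ (Max J, Suc (Max J))"
    "\<And>l i. a < l \<Longrightarrow> bv n P B i l = bv n P A i l"
    "\<And>i. a < i \<Longrightarrow> lead B i = lead A i" "\<And>i. a < i \<Longrightarrow> colead B i = colead A i"
proof -
  have aJ: "a \<in> J" and m: "a < Max J" "Max J \<in> J" using below_Max_J[OF a] a by auto
  note Ja = J_facts[OF aJ] and Jm = J_facts[OF m(2)]
  have idx: "B $$ (i, j) = (if (i, j) \<in> dep (a, b) then A $$ (i, j) else 0)" if "i < n" "j < n" for i j
    using that unfolding B_def restrict_mat_def by simp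
  have BN: "B \<in> N"
    unfolding coord_space_def using N_entry[OF A] by (auto simp: idx) (simp add: B_def restrict_mat_def)
  have rows: "B $$ (i, j) = A $$ (i, j)" if "Suc a \<le> i" "i < n" "j < n" for i j
    using that N_entry[OF A, of i j] by (auto simp: idx dep_def)
  show "B $$ (a, Suc a) = A $$ (a, Suc a)" using Ja(5) by (simp add: idx dep_def)
  show "B $$ (Max J, Suc (Max J)) = A $$ (Max J, Suc (Max J))" using Jm(5) m(1) by (intro rows) auto
  show bv: "bv n P B i l = bv n P A i l" if "a < l" for i l
    by (rule bv_row_cong[OF BN A rows, of "Suc a"]) (use that in auto)
  show lead: "lead B i = lead A i" if "a < i" for i unfolding lead_def by (rule bv[OF that])
  show "colead B i = colead A i" if "a < i" for i
    unfolding colead_def by (intro prod.cong refl lead) (use that in auto)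
qed

lemma rel_restrict:
  assumes A: "A \<in> N" and a: "a \<in> J - {Max J}"
  shows "relG c (a, b) A = c a * G1 a A" "relH c (a, b) A = H1 a A - c a * H2 a A"
proof -
  have m: "a < Max J" using below_Max_J[OF a] by auto
  then show "relG c (a, b) A = c a * G1 a A" "relH c (a, b) A = H1 a A - c a * H2 a A"
    unfolding relG_def relH_def G1_def H1_def H2_def fst_conv
    by (simp_all add: restrict_dep[OF A a])
qed

lemma relation_iff:
  assumes A: "A \<in> N" and g: "gen_poly A \<noteq> 0" and a: "a \<in> J - {Max J}"
  shows "A $$ (a, Suc (Suc a)) * relG c (a, b) A = relH c (a, b) A \<longleftrightarrow> inv_alpha A a = c a * inv_alpha A (Max J)"
proof -
  have aJ: "a \<in> J" and m: "Max J \<in> J" using below_Max_J[OF a] a by auto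
  have nz: "lead A i \<noteq> 0" if "i < n" for i using g that unfolding gen_poly_nonzero by blast
  have "lead A a \<noteq> 0" "lead A (Max J) \<noteq> 0" using nz J_facts(5)[OF aJ] J_facts(5)[OF m] by auto
  moreover have "colead A (Suc a) \<noteq> 0" "colead A (Suc (Max J)) \<noteq> 0" using colead_nonzero nz by blast+
  ultimately have "inv_alpha A a = c a * inv_alpha A (Max J) \<longleftrightarrow>
     H1 a A = c a * (A $$ (Max J, Suc (Max J)) * lead A (Suc (Max J)) * colead A (Suc a)) * lead A a"
    unfolding inv_alpha_def H1_def by (simp add: field_simps)
  also have "\<dots> \<longleftrightarrow> H1 a A = A $$ (a, Suc (Suc a)) * (c a * G1 a A) + c a * H2 a A"
    unfolding lead_J_expand[OF A aJ] G1_def H2_def by (simp add: algebra_simps)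
  finally show ?thesis unfolding rel_restrict[OF A a] by (auto simp: algebra_simps)
qed

lemma rel_pos_subset: "set rel_pos \<subseteq> X"
  unfolding set_rel_pos X_def using J_facts(5) by auto

lemma rel_system:
  fixes c :: "nat \<Rightarrow> 'k::field"
  assumes c: "\<And>a. a \<in> J \<Longrightarrow> c a \<noteq> 0"
    and \<delta>: "\<forall>(c :: nat \<Rightarrow> 'k). \<forall>\<beta>\<in>set rel_pos. pdeg (dep \<beta>) \<delta> (relG c \<beta>) \<and> pdeg (dep \<beta>) \<delta> (relH c \<beta>)"
  shows "triangular_system n X rel_pos dep \<delta> (relG c) (relH c) gen_poly"
proof
  show "X \<subseteq> all_pos n" "distinct rel_pos" "set rel_pos \<subseteq> X" "gen_poly \<in> poly_fun n"
    by (rule X_subset distinct_rel_pos rel_pos_subset gen_poly_poly_fun)+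
  have "sorted_wrt (\<lambda>a a'. (a', Suc (Suc a')) \<notin> dep (a, Suc (Suc a))) (rev (sorted_list_of_set (J - {Max J})))"
    unfolding sorted_wrt_rev
    by (rule sorted_wrt_mono_rel[OF _ strict_sorted_list_of_set]) (auto simp: dep_def)
  then show "sorted_wrt (\<lambda>\<beta> \<beta>'. \<beta>' \<notin> dep \<beta>) rel_pos"
    unfolding rel_pos_def sorted_wrt_map .
  fix \<beta> assume \<beta>: "\<beta> \<in> set rel_pos"
  then obtain a where a: "a \<in> J - {Max J}" "\<beta> = (a, Suc (Suc a))" unfolding set_rel_pos by auto
  show "\<beta> \<notin> dep \<beta> \<and> dep \<beta> \<subseteq> X"
    using a J_facts(1,5)[of a] by (auto simp: dep_def X_def)
  show "pdeg (dep \<beta>) \<delta> (relG c \<beta>) \<and> pdeg (dep \<beta>) \<delta> (relH c \<beta>)" using \<delta> \<beta> by blast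
  fix A :: "'k mat" assume A: "A \<in> N" "gen_poly A \<noteq> 0"
  have m: "Max J \<in> J" using below_Max_J[OF a(1)] by blast
  have "lead A (Suc (Max J)) \<noteq> 0" "lead A (Suc (Suc a)) \<noteq> 0" "A $$ (Max J, Suc (Max J)) \<noteq> 0"
    using A(2) m a(1) J_facts(5)[OF m] J_facts(5)[of a] unfolding gen_poly_nonzero by auto
  moreover have "colead A (Suc a) \<noteq> 0" using A(2) colead_nonzero unfolding gen_poly_nonzero by blast
  ultimately show "relG c \<beta> A \<noteq> 0"
    unfolding a(2) rel_restrict[OF A(1) a(1)] G1_def using c[of a] a(1) by auto
qed

lemma rel_system_Z:
  fixes c :: "nat \<Rightarrow> 'k::field"
  assumes "triangular_system n X rel_pos dep \<delta> (relG c) (relH c) gen_poly"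
  shows "triangular_system.Z n X rel_pos (relG c) (relH c) gen_poly =
    {A \<in> N. gen_poly A \<noteq> 0 \<and> (\<forall>a\<in>J - {Max J}. inv_alpha A a = c a * inv_alpha A (Max J))}"
proof -
  have "(\<forall>\<beta>\<in>set rel_pos. A $$ \<beta> * relG c \<beta> A = relH c \<beta> A) \<longleftrightarrow>
      (\<forall>a\<in>J - {Max J}. inv_alpha A a = c a * inv_alpha A (Max J))" if "A \<in> N" "gen_poly A \<noteq> 0" for A
    unfolding set_rel_pos using relation_iff[OF that] by simp
  then show ?thesis unfolding triangular_system.Z_def[OF assms] by blast
qed

text \<open>From above: the generic points in the orbit of a generic \<open>y\<close> share the
  parameter ratios of \<open>y\<close>, hence satisfy \<open>card J - 1\<close> relations. From
  below: if all ratios are one, the whole solution set lies in the orbit of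
  \<open>nf (\<lambda>_. 1)\<close>.\<close>

lemma orbit_dimensions:
  assumes inf: "infinite (UNIV :: 'k::field set)" and "J \<noteq> {}"
  shows "x \<in> N \<Longrightarrow> zariski_dim n (borel_orbit n (x :: 'k mat)) \<le> card X - (card J - 1)"
    and "zariski_dim n (borel_orbit n (nf (\<lambda>_. 1 :: 'k))) = card X - (card J - 1)"
proof -
  let ?t = "card X - (card J - 1)"
  have m: "Max J \<in> J" using finite_J assms(2) by simp
  obtain \<delta> where \<delta>: "\<forall>(c :: nat \<Rightarrow> 'k). \<forall>\<beta>\<in>set rel_pos. pdeg (dep \<beta>) \<delta> (relG c \<beta>) \<and> pdeg (dep \<beta>) \<delta> (relH c \<beta>)"
    using rel_degree by blast
  \<comment> \<open>One constant must serve all \<open>m\<close>, although the generic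
    \<open>y\<close> chosen below depends on \<open>m\<close> and \<open>R\<close>; hence it is
    built from \<open>\<delta>\<close> and not from the ratios.\<close>
  define K where "K = ((1 + \<delta>) ^ (card J - 1)) ^ ?t"
  have bound: "R \<le> K * (m + 1) ^ ?t" if x: "x \<in> N" and ind: "has_indep (borel_orbit n x) (pdegn n m) R"
    for x :: "'k mat" and m R
  proof -
    obtain y :: "'k mat" where y: "y \<in> N" "gen_poly y \<noteq> 0" "has_indep (borel_orbit n y) (pdegn n m) R"
      using has_indep_orbit_semicontinuous[OF inf x nf_N gen_poly_poly_fun gen_poly_nf ind, of "\<lambda>_. 1"] by auto
    define c where "c = (\<lambda>a. inv_alpha y a / inv_alpha y (Max J))"
    have ym: "inv_alpha y (Max J) \<noteq> 0" by (rule inv_alpha_nonzero[OF y(2) \<open>Max J \<in> J\<close>])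
    have "c a \<noteq> 0" if "a \<in> J" for a unfolding c_def using inv_alpha_nonzero[OF y(2)] that ym by auto
    then interpret S: triangular_system n X rel_pos dep \<delta> "relG c" "relH c" gen_poly
      by (intro rel_system \<delta>)
    have yc: "y \<in> carrier_mat n n" by (rule N_carrier[OF y(1)])
    have "has_indep {s \<in> borel_orbit n y. gen_poly s \<noteq> 0} (pdegn n m) R"
      by (rule has_indep_open_subset[OF borel_orbit_irr[OF inf yc] gen_poly_poly_fun _ y(3)])
        (use borel_orbit_refl[OF yc] y(2) in blast)
    moreover have "{s \<in> borel_orbit n y. gen_poly s \<noteq> 0} \<subseteq> S.Z"
    proof
      fix s assume s: "s \<in> {s \<in> borel_orbit n y. gen_poly s \<noteq> 0}"
      obtain \<mu> where \<mu>: "\<mu> \<noteq> 0" "\<forall>a\<in>J. inv_alpha s a = \<mu> * inv_alpha y a"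
        using inv_alpha_proportional[OF y(1,2)] s by blast
      then have "\<forall>a\<in>J - {Max J}. inv_alpha s a = c a * inv_alpha s (Max J)"
        unfolding c_def using ym \<open>Max J \<in> J\<close> by auto
      then show "s \<in> S.Z"
        unfolding rel_system_Z[OF S.triangular_system_axioms] using s N_orbit[OF y(1)] by blast
    qed
    ultimately have "has_indep S.Z (pdegn n m) R" by (rule has_indep_mono)
    from S.has_indep_Z_le[OF this] show ?thesis unfolding K_def length_rel_pos[OF assms(2)] .
  qed
  show "zariski_dim n (borel_orbit n x) \<le> ?t" if x: "x \<in> N" for x :: "'k mat"
  proof -
    have xc: "x \<in> carrier_mat n n" by (rule N_carrier[OF x])
    have "irr_chain n (borel_orbit n x) 0 (\<lambda>_. zariski_closure n (borel_orbit n x))"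
      unfolding irr_chain_def using irr_imp_zariski_irreducible[OF borel_orbit_irr[OF inf xc]] by simp
    then show ?thesis using zariski_dim_bounds(2)[OF borel_orbit_carrier[OF xc] bound[OF x]] by blast
  qed
  then have le: "zariski_dim n (borel_orbit n (nf (\<lambda>_. 1 :: 'k))) \<le> ?t" using nf_N by blast
  interpret S: triangular_system n X rel_pos dep \<delta> "relG (\<lambda>_. 1 :: 'k)" "relH (\<lambda>_. 1)" gen_poly
    by (intro rel_system \<delta>) auto
  note Z = rel_system_Z[OF S.triangular_system_axioms]
  have "S.Z \<subseteq> borel_orbit n (nf (\<lambda>_. 1))"
  proof
    fix A assume A: "A \<in> S.Z"
    then have A': "A \<in> N" "gen_poly A \<noteq> 0" "\<And>a. a \<in> J \<Longrightarrow> inv_alpha A a = inv_alpha A (Max J)"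
      unfolding Z by auto
    have nz: "inv_alpha A (Max J) \<noteq> 0" by (rule inv_alpha_nonzero[OF A'(2) m])
    have "nf (\<lambda>b. 1 / inv_alpha A (Max J) * inv_alpha A b) = nf (\<lambda>_. 1)"
      using A'(3) nz by (intro nf_cong) auto
    then show "A \<in> borel_orbit n (nf (\<lambda>_. 1))"
      using generic_conjugate_to_nf[OF A'(1,2), of "1 / inv_alpha A (Max J)"] nz by simp
  qed
  then have cl: "zariski_closure n S.Z \<subseteq> zariski_closure n (borel_orbit n (nf (\<lambda>_. 1)))"
    by (rule zariski_closure_mono)
  have "nf (\<lambda>_. 1) \<in> S.Z"
    unfolding Z using nf_N gen_poly_nf[of "\<lambda>_. 1 :: 'k"] m by (auto simp: inv_alpha_nf)
  then obtain C where "irr_chain n S.Z ?t C"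
    using S.Z_chain[OF inf] unfolding length_rel_pos[OF assms(2)] by blast
  then have "irr_chain n (borel_orbit n (nf (\<lambda>_. 1 :: 'k))) ?t C"
    unfolding irr_chain_def using cl by blast
  from zariski_dim_bounds(1)[OF borel_orbit_carrier[OF nf_carrier] bound[OF nf_N[of "\<lambda>_. 1 :: 'k"]] this]
  have "?t \<le> zariski_dim n (borel_orbit n (nf (\<lambda>_. 1 :: 'k)))" .
  then show "zariski_dim n (borel_orbit n (nf (\<lambda>_. 1 :: 'k))) = ?t" using le by simp
qed

lemma orbit_codimension:
  assumes inf: "infinite (UNIV :: 'k::field set)"
  shows "(has_dense_orbit n (N :: 'k mat set) \<longleftrightarrow> card J \<le> 1) \<and> min_orbit_codim n (N :: 'k mat set) = card J - 1"
proof (cases "card J \<le> 1")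
  case True
  note d = dense_orbit[OF inf True]
  have "has_dense_orbit n (N :: 'k mat set)" unfolding has_dense_orbit_def using d nf_N by blast
  moreover have "zariski_dim n (borel_orbit n (nf (\<lambda>_. 1 :: 'k))) = zariski_dim n (N :: 'k mat set)"
    unfolding zariski_dim_def d ..
  then have "\<exists>x\<in>(N :: 'k mat set). 0 = zariski_dim n (N :: 'k mat set) - zariski_dim n (borel_orbit n x)"
    using nf_N by (intro bexI[of _ "nf (\<lambda>_. 1)"]) auto
  then have "min_orbit_codim n (N :: 'k mat set) = 0" unfolding min_orbit_codim_def by (intro Least_eq_0)
  ultimately show ?thesis using True by simp
next
  case False
  then have J: "J \<noteq> {}" by auto
  note dims = orbit_dimensions[OF inf J] and dN = zariski_dim_coord_space[OF inf X_subset]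
  \<comment> \<open>This guards the truncated subtraction: \<open>rel_pos\<close> consists of that
    many distinct positions in \<open>X\<close>.\<close>
  have "card J - 1 \<le> card X"
    using card_mono[OF finite_subset[OF X_subset] rel_pos_subset] distinct_card[OF distinct_rel_pos]
    unfolding length_rel_pos[OF J] by simp
  then have eq: "card X - (card X - (card J - 1)) = card J - 1" by simp
  have codim: "min_orbit_codim n (N :: 'k mat set) = card J - 1"
    unfolding min_orbit_codim_def
  proof (rule Least_equality)
    show "\<exists>x\<in>(N :: 'k mat set). card J - 1 = zariski_dim n (N :: 'k mat set) - zariski_dim n (borel_orbit n x)"
      using nf_N dims(2) dN eq by (intro bexI[of _ "nf (\<lambda>_. 1)"]) auto
    fix y assume "\<exists>x\<in>(N :: 'k mat set). y = zariski_dim n (N :: 'k mat set) - zariski_dim n (borel_orbit n x)"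
    then obtain x :: "'k mat" where x: "x \<in> N" "y = card X - zariski_dim n (borel_orbit n x)" unfolding dN by blast
    then show "card J - 1 \<le> y" using dims(1)[OF x(1)] eq by linarith
  qed
  have "\<not> has_dense_orbit n (N :: 'k mat set)"
  proof
    assume "has_dense_orbit n (N :: 'k mat set)"
    then obtain x :: "'k mat" where x: "x \<in> N" "zariski_closure n (borel_orbit n x) = zariski_closure n N"
      unfolding has_dense_orbit_def by blast
    then have "zariski_dim n (borel_orbit n x) = card X" unfolding dN[symmetric] zariski_dim_def by simp
    then show False using dims(1)[OF x(1)] False eq by linarith
  qed
  then show ?thesis using codim False by simp
qed

end

section \<open>Ideals between the derived algebra and the nilradical\<close>

text \<open>Over a finite field the product of all \<open>[:- a, 1:]\<close> vanishes everywhere, so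
  adding one gives a nonconstant polynomial without a root.\<close>

lemma alg_closed_infinite:
  assumes "alg_closed TYPE('k::field)"
  shows "infinite (UNIV :: 'k set)"
proof
  assume fin: "finite (UNIV :: 'k set)"
  define q where "q = (\<Prod>a\<in>(UNIV :: 'k set). [:- a, 1:])"
  have q0: "poly q x = 0" for x
    unfolding q_def poly_prod using fin by (auto intro!: bexI[of _ x])
  have "q \<noteq> 0" unfolding q_def using fin by simp
  have "degree (q + 1) \<ge> 1"
  proof (rule ccontr)
    assume "\<not> degree (q + 1) \<ge> 1"
    then have "degree (q + 1) = 0" by simp
    then obtain c where c: "q + 1 = [:c:]" by (rule degree_eq_zeroE)
    have "poly (q + 1) 0 = poly [:c:] 0" unfolding c ..
    then have "c = 1" using q0 by simp
    then show False using c \<open>q \<noteq> 0\<close> by (simp add: one_pCons)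
  qed
  then obtain x where "poly (q + 1) x = 0" using assms unfolding alg_closed_def by blast
  then show False using q0 by simp
qed

section \<open>The ideal as a coordinate space\<close>

definition unit_mat :: "nat \<Rightarrow> nat \<Rightarrow> nat \<Rightarrow> 'k::field mat" where
  "unit_mat n i j = mat n n (\<lambda>\<tau>. if \<tau> = (i, j) then 1 else 0)"

lemma elem_mat_unit: "elem_mat n (Suc i) (Suc j) = unit_mat n i j"
  unfolding elem_mat_def unit_mat_def by (rule eq_matI) auto

lemma unit_mat_carrier [simp]: "unit_mat n i j \<in> carrier_mat n n"
  unfolding unit_mat_def by simp

lemma unit_mat_dim [simp]: "dim_row (unit_mat n i j) = n" "dim_col (unit_mat n i j) = n"
  unfolding unit_mat_def by simp_all

lemma unit_mat_index [simp]: "a < n \<Longrightarrow> b < n \<Longrightarrow> unit_mat n i j $$ (a, b) = (if a = i \<and> b = j then 1 else 0)"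
  unfolding unit_mat_def by simp

lemma unit_mat_mult_left:
  assumes "A \<in> carrier_mat n n" "a < n" "b < n" "j < n"
  shows "(unit_mat n i j * A) $$ (a, b) = (if a = i then A $$ (j, b) else 0)"
proof -
  have "(unit_mat n i j * A) $$ (a, b) = (\<Sum>k = 0..<n. (unit_mat n i j :: 'a mat) $$ (a, k) * A $$ (k, b))"
    using assms unit_mat_carrier[of n i j] by (auto simp: scalar_prod_def)
  also have "\<dots> = (\<Sum>k = 0..<n. if k = j then (if a = i then A $$ (j, b) else 0) else 0)"
    using assms by (intro sum.cong) auto
  finally show ?thesis using assms by simp
qed

lemma unit_mat_mult_right:
  assumes "A \<in> carrier_mat n n" "a < n" "b < n" "i < n"
  shows "(A * unit_mat n i j) $$ (a, b) = (if b = j then A $$ (a, i) else 0)"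
proof -
  have "(A * unit_mat n i j) $$ (a, b) = (\<Sum>k = 0..<n. A $$ (a, k) * (unit_mat n i j :: 'a mat) $$ (k, b))"
    using assms unit_mat_carrier[of n i j] by (auto simp: scalar_prod_def)
  also have "\<dots> = (\<Sum>k = 0..<n. if k = i then (if b = j then A $$ (a, i) else 0) else 0)"
    using assms by (intro sum.cong) auto
  finally show ?thesis using assms by simp
qed

lemma lie_bracket_unit_diag:
  assumes "A \<in> carrier_mat n n" "a < n" "b < n" "k < n"
  shows "lie_bracket (unit_mat n k k) A $$ (a, b) = (if a = k then A $$ (k, b) else 0) - (if b = k then A $$ (a, k) else 0)"
proof -
  have "lie_bracket (unit_mat n k k) A $$ (a, b) = (unit_mat n k k * A) $$ (a, b) - (A * unit_mat n k k) $$ (a, b)"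
    unfolding lie_bracket_def using assms by (simp del: index_mult_mat(1))
  then show ?thesis using assms by (simp only: unit_mat_mult_left unit_mat_mult_right)
qed

text \<open>Bracketing with the diagonal units at \<open>Suc i\<close> and then at \<open>i\<close>
  isolates the entry \<open>(i, Suc i)\<close> up to sign; the mirror entry
  \<open>(Suc i, i)\<close> would survive too, but vanishes in the nilradical.\<close>

lemma unit_mat_superdiag_in_ideal:
  assumes ideal: "lie_ideal_of_b n N" and "N \<subseteq> nilrad n"
    and A: "A \<in> N" and i: "Suc i < n" "A $$ (i, Suc i) \<noteq> 0"
  shows "unit_mat n i (Suc i) \<in> N"
proof -
  have Ac: "A \<in> carrier_mat n n" and nil: "\<And>a b. a < n \<Longrightarrow> b \<le> a \<Longrightarrow> A $$ (a, b) = 0"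
    using A assms(2) unfolding nilrad_def by auto
  have borel: "unit_mat n k k \<in> borel_lie n" for k
    unfolding borel_lie_def by (auto intro!: upper_triangularI simp: unit_mat_def)
  have brack: "lie_bracket (unit_mat n k k) B \<in> N" if "B \<in> N" for k B
    using ideal borel that unfolding lie_ideal_of_b_def by blast
  define B where "B = lie_bracket (unit_mat n (Suc i) (Suc i)) A"
  define D where "D = lie_bracket (unit_mat n i i) B"
  have BN: "B \<in> N" and DN: "D \<in> N" unfolding D_def B_def using brack A by auto
  then have Bc: "B \<in> carrier_mat n n" and Dc: "D \<in> carrier_mat n n"
    using assms(2) unfolding nilrad_def by auto
  have Bidx: "B $$ (a, b) = (if a = Suc i then A $$ (Suc i, b) else 0) - (if b = Suc i then A $$ (a, Suc i) else 0)"
    if "a < n" "b < n" for a b unfolding B_def by (rule lie_bracket_unit_diag[OF Ac that i(1)])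
  have Didx: "D $$ (a, b) = (if a = i then B $$ (i, b) else 0) - (if b = i then B $$ (a, i) else 0)"
    if "a < n" "b < n" for a b unfolding D_def using lie_bracket_unit_diag[OF Bc that] i(1) by simp
  have "unit_mat n i (Suc i) = (- 1 / A $$ (i, Suc i)) \<cdot>\<^sub>m D"
  proof (rule eq_matI)
    fix a b assume "a < dim_row ((- 1 / A $$ (i, Suc i)) \<cdot>\<^sub>m D)" "b < dim_col ((- 1 / A $$ (i, Suc i)) \<cdot>\<^sub>m D)"
    then have ab: "a < n" "b < n" using Dc by auto
    have "D $$ (a, b) = (if a = i \<and> b = Suc i then - A $$ (i, Suc i) else 0)"
      unfolding Didx[OF ab] using ab i(1) nil[of "Suc i" i] by (auto simp: Bidx)
    then show "unit_mat n i (Suc i) $$ (a, b) = ((- 1 / A $$ (i, Suc i)) \<cdot>\<^sub>m D) $$ (a, b)"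
      using ab Dc i(2) by auto
  qed (use Dc in auto)
  then show ?thesis using DN ideal unfolding lie_ideal_of_b_def subspace_mat_def by auto
qed

lemma unit_mat_in_derived:
  assumes "Suc i < j" "j < n"
  shows "unit_mat n i j \<in> derived_nilrad n"
proof -
  let ?X = "unit_mat n i (Suc i) :: 'a mat" and ?Y = "unit_mat n (Suc i) j :: 'a mat"
  have nil: "?X \<in> nilrad n" "?Y \<in> nilrad n" using assms unfolding nilrad_def by auto
  have "lie_bracket ?X ?Y + 0\<^sub>m n n \<in> derived_nilrad n"
    by (rule derived_nilrad.add[OF nil derived_nilrad.zero])
  moreover have "lie_bracket ?X ?Y + 0\<^sub>m n n = unit_mat n i j"
  proof (rule eq_matI)
    fix a b assume "a < dim_row (unit_mat n i j :: 'a mat)" "b < dim_col (unit_mat n i j :: 'a mat)"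
    then have ab: "a < n" "b < n" by (auto simp: unit_mat_def)
    have "(?X * ?Y) $$ (a, b) = (if a = i \<and> b = j then 1 else 0)" "(?Y * ?X) $$ (a, b) = 0"
      using ab assms unit_mat_mult_left[of ?Y n a b "Suc i" i] unit_mat_mult_left[of ?X n a b j "Suc i"] by auto
    moreover have "dim_row ?X = n" "dim_row ?Y = n" "dim_col ?X = n" "dim_col ?Y = n" by (auto simp: unit_mat_def)
    ultimately show "(lie_bracket ?X ?Y + 0\<^sub>m n n) $$ (a, b) = unit_mat n i j $$ (a, b)"
      unfolding lie_bracket_def using ab by (simp del: index_mult_mat(1))
  qed (auto simp: lie_bracket_def unit_mat_def)
  ultimately show ?thesis by simp
qed

lemma coord_space_subset:
  assumes sub: "subspace_mat n N" and "finite F" "\<And>i j. (i, j) \<in> F \<Longrightarrow> unit_mat n i j \<in> N"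
  shows "coord_space n F \<subseteq> N"
  using assms(2,3)
proof (induction F rule: finite_induct)
  case empty
  have "A = 0\<^sub>m n n" if "A \<in> coord_space n {}" for A :: "'a mat"
    using that unfolding coord_space_def by (intro eq_matI) auto
  then show ?case using sub unfolding subspace_mat_def by auto
next
  case (insert \<tau> F)
  obtain i j where ij: "\<tau> = (i, j)" by fastforce
  show ?case
  proof
    fix A :: "'a mat" assume A: "A \<in> coord_space n (insert \<tau> F)"
    then have Ac: "A \<in> carrier_mat n n" unfolding coord_space_def by blast
    have "upd_mat n A \<tau> 0 \<in> coord_space n F"
      using A unfolding coord_space_def upd_mat_def by auto
    then have "upd_mat n A \<tau> 0 \<in> N" using insert.IH insert.prems by blast
    moreover have "A $$ \<tau> \<cdot>\<^sub>m unit_mat n i j \<in> N"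
      using insert.prems[of i j] ij sub unfolding subspace_mat_def by auto
    moreover have "A = A $$ \<tau> \<cdot>\<^sub>m unit_mat n i j + upd_mat n A \<tau> 0"
      using Ac by (intro eq_matI) (auto simp: ij upd_mat_def unit_mat_def)
    ultimately show "A \<in> N" using sub unfolding subspace_mat_def by metis
  qed
qed

text \<open>Units beyond the superdiagonal come from the derived algebra. On the superdiagonal, one
  element with a nonzero entry forces the corresponding unit into the ideal.\<close>

lemma ideal_eq_coord_space:
  fixes N :: "'k::field mat set"
  assumes ideal: "lie_ideal_of_b n N" and "derived_nilrad n \<subseteq> N" "N \<subseteq> nilrad n"
  defines "I \<equiv> {i. Suc i < n \<and> unit_mat n i (Suc i) \<in> N}"
  shows "N = coord_space n {(i, j). j < n \<and> (Suc i < j \<or> j = Suc i \<and> i \<in> I)}" (is "N = coord_space n ?X")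
proof
  show "N \<subseteq> coord_space n ?X"
  proof
    fix A assume A: "A \<in> N"
    have "A $$ (i, j) = 0" if "i < n" "j < n" "(i, j) \<notin> ?X" for i j
    proof (cases "j \<le> i")
      case True
      then show ?thesis using A assms(3) that unfolding nilrad_def by blast
    next
      case False
      then have "j = Suc i" "i \<notin> I" using that by auto
      then show ?thesis using unit_mat_superdiag_in_ideal[OF ideal assms(3) A, of i] that unfolding I_def by auto
    qed
    then show "A \<in> coord_space n ?X" using A assms(3) unfolding coord_space_def nilrad_def by blast
  qed
  have "?X \<subseteq> {..<n} \<times> {..<n}" by auto
  then have "finite ?X" by (rule finite_subset) simp
  moreover have "unit_mat n i j \<in> N" if "(i, j) \<in> ?X" for i j
    using that unit_mat_in_derived[of i j n] assms(2) unfolding I_def by auto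
  moreover have "subspace_mat n N" using ideal unfolding lie_ideal_of_b_def by blast
  ultimately show "coord_space n ?X \<subseteq> N" by (intro coord_space_subset)
qed

text \<open>Above \<open>Max I\<close> the colours alternate starting with \<open>Suc (Max I) \<in> P\<close>; below, the colour of \<open>i\<close>
  is the parity of its distance to the next element of \<open>I\<close>.\<close>

lemma colouring_ex:
  assumes I: "\<And>i. i \<in> I \<Longrightarrow> Suc i < n"
  shows "\<exists>P. colouring n I P"
proof -
  have finI: "finite I" using I by (meson Suc_lessD bounded_nat_set_is_finite)
  define b where "b = (\<lambda>i. LEAST b. b \<in> I \<and> i \<le> b)"
  define P where "P = {i. i < n \<and> (if \<exists>b\<in>I. i \<le> b then even (b i + i) else odd (Max I + i))}"
  have "colouring n I P"
  proof
    fix i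
    show "i \<in> I \<Longrightarrow> Suc i < n" by (rule I)
    show "i \<in> P \<Longrightarrow> i < n" unfolding P_def by blast
    show "i \<in> P" if i: "i \<in> I"
    proof -
      have "b i = i" unfolding b_def using i by (intro Least_equality) auto
      then show ?thesis unfolding P_def using i I[OF i] by auto
    qed
    show "i \<in> P \<longleftrightarrow> Suc i \<notin> P" if i: "i \<notin> I" "Suc i < n"
    proof -
      have eq: "b' \<in> I \<and> i \<le> b' \<longleftrightarrow> b' \<in> I \<and> Suc i \<le> b'" for b'
        using i(1) by (metis Suc_leD Suc_leI le_neq_implies_less)
      then have "(\<exists>b\<in>I. i \<le> b) \<longleftrightarrow> (\<exists>b\<in>I. Suc i \<le> b)" by blast
      moreover have "b i = b (Suc i)" unfolding b_def eq ..
      ultimately show ?thesis unfolding P_def using i(2) by auto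
    qed
    show "Suc (Max I) \<in> P" if "I \<noteq> {}"
    proof -
      have "Max I \<in> I" using that finI by simp
      moreover have "\<not> (\<exists>b\<in>I. Suc (Max I) \<le> b)" using finI Max_ge by (metis Suc_n_not_le_n le_trans)
      ultimately show ?thesis unfolding P_def using I by auto
    qed
  qed
  then show ?thesis by blast
qed

text \<open>From \<open>b\<close>, which is in \<open>P\<close>, the colours alternate downwards as
  far as \<open>Suc a\<close>, since \<open>I\<close> has no element in between.\<close>

lemma (in colouring) J_iff_even_gap:
  assumes "a \<in> I" "b \<in> I" "a < b" "\<And>l. a < l \<Longrightarrow> l < b \<Longrightarrow> l \<notin> I"
  shows "a \<in> J \<longleftrightarrow> even (b - a)"
proof -
  have "Suc a \<le> b" using assms(3) by simp
  have "l \<in> P \<longleftrightarrow> even (b - l)" if "Suc a \<le> l" "l \<le> b" for l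
    using that(2,1)
  proof (induction rule: inc_induct)
    case base
    then show ?case using I_P[OF assms(2)] by simp
  next
    case (step l)
    have "Suc l < n" using step.hyps I_bound[OF assms(2)] by simp
    moreover have "l \<notin> I" using assms(4) step by auto
    moreover have "b - l = Suc (b - Suc l)" using step.hyps by simp
    ultimately show ?case using alternate[of l] step by simp
  qed
  from this[OF order_refl \<open>Suc a \<le> b\<close>] have "Suc a \<in> P \<longleftrightarrow> even (b - Suc a)" .
  moreover have "b - a = Suc (b - Suc a)" using assms(3) by simp
  ultimately show ?thesis unfolding J_def using assms(1) by simp
qed

text \<open>An interior entry of the sequence is a gap between consecutive elements, and
  \<open>?h\<close> sends its position to the lower end of the gap, shifted to 0-based rows. The
  first and last entries are not such gaps.\<close>

lemma (in colouring) even_count_eq_card_J: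
  assumes "superdiag_indices n N' = Suc ` I"
  shows "even_count n N' = card J"
proof -
  define s where "s = sorted_list_of_set (Suc ` I)"
  have fin: "finite (Suc ` I)" using finite_I by simp
  have set_s: "set s = Suc ` I" and sorted: "sorted_wrt (<) s" and dist: "distinct s"
    unfolding s_def using fin by (auto intro: strict_sorted_list_of_set)
  have mono: "s ! i < s ! j" if "i < j" "j < length s" for i j
    using sorted_wrt_nth_less[OF sorted that] .
  show ?thesis
  proof (cases "s = []")
    case True
    then have "J = {}" using set_s unfolding J_def by simp
    \<comment> \<open>For this sequence of length one, \<open>length a - 2\<close> is zero and no
      position is counted.\<close>
    moreover have "seq_a n N' = [n]" unfolding seq_a_def assms s_def[symmetric] using True by simp
    ultimately show ?thesis unfolding even_count_def by (simp add: Let_def)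
  next
    case False
    define L where "L = length s"
    have L: "0 < L" unfolding L_def using False by simp
    have a: "seq_a n N' = [hd s] @ map (\<lambda>j. s ! j - s ! (j - 1)) [1..<L] @ [n - last s]"
      unfolding seq_a_def assms s_def[symmetric] L_def using False by simp
    define S where "S = {i. 1 \<le> i \<and> i \<le> L - 1 \<and> even (s ! i - s ! (i - 1))}"
    have "length (seq_a n N') = L + 1" unfolding a using L by simp
    moreover have "seq_a n N' ! i = s ! i - s ! (i - 1)" if "1 \<le> i" "i \<le> L - 1" for i
      unfolding a using that L by (auto simp: nth_append nth_Cons')
    ultimately have ec: "even_count n N' = card S"
      unfolding even_count_def S_def by (auto simp: Let_def intro!: arg_cong[of _ _ card])
    let ?h = "\<lambda>i. s ! (i - 1) - 1"
    have memI: "s ! i - 1 \<in> I" "s ! i > 0" if "i < L" for i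
      using that set_s nth_mem[of i s] unfolding L_def by auto
    have gap: "?h i \<in> J \<longleftrightarrow> even (s ! i - s ! (i - 1))" if i: "1 \<le> i" "i \<le> L - 1" for i
    proof -
      have iL: "i - 1 < L" "i < L" using i L by auto
      have lt: "s ! (i - 1) < s ! i" using mono[of "i - 1" i] i iL unfolding L_def by auto
      have "l \<notin> I" if l: "?h i < l" "l < s ! i - 1" for l
      proof
        assume "l \<in> I"
        then have "Suc l \<in> set s" using set_s by simp
        then obtain k where k: "k < length s" "s ! k = Suc l" by (auto simp: in_set_conv_nth)
        have "s ! (i - 1) < s ! k" "s ! k < s ! i" using k(2) l by auto
        then have "i - 1 < k" "k < i"
          using mono[of k "i - 1"] mono[of i k] k(1) iL unfolding L_def
          by (metis linorder_neqE_nat order_less_asym order_less_irrefl)+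
        then show False by simp
      qed
      moreover have "?h i < s ! i - 1" using lt memI(2)[OF iL(1)] by linarith
      ultimately have "?h i \<in> J \<longleftrightarrow> even ((s ! i - 1) - ?h i)"
        using memI(1) iL by (intro J_iff_even_gap) auto
      also have "(s ! i - 1) - ?h i = s ! i - s ! (i - 1)" using memI(2)[OF iL(1)] lt by simp
      finally show ?thesis .
    qed
    have "J \<subseteq> ?h ` S"
    proof
      fix x assume x: "x \<in> J"
      then have "Suc x \<in> set s" using set_s J_facts(1) by auto
      then obtain k where k: "k < L" "s ! k = Suc x" unfolding L_def by (auto simp: in_set_conv_nth)
      \<comment> \<open>An element of \<open>J\<close> lies below \<open>Max I\<close>, so its
        position in \<open>s\<close> is not the last one and a gap starts there.\<close>
      have "I \<noteq> {}" using J_facts(1)[OF x] by blast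
      then have "Suc (Max I) \<in> set s" using set_s Max_in[OF finite_I] by blast
      then obtain k' where k': "k' < L" "s ! k' = Suc (Max I)" unfolding L_def by (auto simp: in_set_conv_nth)
      have "s ! k < s ! k'" using J_less_Max[OF x] k(2) k'(2) by simp
      then have "k < k'" using mono[of k' k] k(1) unfolding L_def by (metis linorder_neqE_nat order_less_asym order_less_irrefl)
      then have *: "1 \<le> Suc k" "Suc k \<le> L - 1" using k' by auto
      have "?h (Suc k) = x" using k(2) by simp
      then show "x \<in> ?h ` S" using gap[OF *] x * unfolding S_def by (intro image_eqI[of _ _ "Suc k"]) auto
    qed
    moreover have "?h ` S \<subseteq> J" using gap unfolding S_def by auto
    ultimately have "J = ?h ` S" by blast
    moreover have "inj_on ?h S"
    proof (rule inj_onI)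
      fix i j assume ij: "i \<in> S" "j \<in> S" "?h i = ?h j"
      then have L': "i - 1 < L" "j - 1 < L" "1 \<le> i" "1 \<le> j" using L unfolding S_def by auto
      then have "s ! (i - 1) = s ! (j - 1)" using ij(3) memI(2)[of "i - 1"] memI(2)[of "j - 1"] by linarith
      then have "i - 1 = j - 1" using L' dist unfolding L_def by (simp add: nth_eq_iff_index_eq)
      then show "i = j" using L' by simp
    qed
    ultimately show ?thesis using ec card_image by metis
  qed
qed

theorem theorem1p1:
  fixes N :: "'k::field mat set" and n :: nat
  assumes "alg_closed TYPE('k)"
    and "n \<ge> 2"
    and "lie_ideal_of_b n N"
    and "derived_nilrad n \<subseteq> N" and "N \<subseteq> nilrad n"
  shows "(has_dense_orbit n N \<longleftrightarrow> even_count n N \<le> 1)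
       \<and> min_orbit_codim n N = max 0 (int (even_count n N) - 1)"
proof -
  define I where "I = {i. Suc i < n \<and> unit_mat n i (Suc i) \<in> N}"
  obtain P where "colouring n I P" using colouring_ex[of I n] unfolding I_def by blast
  then interpret C: colouring n I P .
  have N: "N = coord_space n C.X"
    unfolding C.X_def unfolding I_def by (rule ideal_eq_coord_space[OF assms(3-5)])
  have "superdiag_indices n N = Suc ` I"
  proof (rule Set.set_eqI)
    fix i
    show "i \<in> superdiag_indices n N \<longleftrightarrow> i \<in> Suc ` I"
      unfolding superdiag_indices_def I_def using assms(2)
      by (cases i) (auto simp: elem_mat_unit[symmetric])
  qed
  then have "even_count n N = card C.J" by (rule C.even_count_eq_card_J)
  then show ?thesis
    using C.orbit_codimension[OF alg_closed_infinite[OF assms(1)]] unfolding N by auto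
qed

end
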